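(* Let the step sizes be $\alpha_t=a/(t+1)$, $t=0,1,\dots$, with $a>0$, and let $b>0$. Consider, under the network, observability, observation-noise, communication-noise and nonlinearity assumptions listed in the context, the iterates $$\mathbf{x}_{i}^{t+1}=\mathbf{x}_{i}^{t}-\alpha_{t}\left(\frac{b}{a}\sum_{j\in\Omega_{i}}\boldsymbol{\Psi}_{\mathrm c}\left(\mathbf{x}_{i}^{t}-\mathbf{x}_{j}^{t}+\boldsymbol{\xi}_{ij}^t\right)-\mathbf{h}_{i}\Psi_{\mathrm o}\left(z_{i}^{t}-\mathbf{h}_{i}^{\top}\mathbf{x}_{i}^{t}\right)\right),\quad i=1,\dots,N,$$ and let $\mathbf{x}^t\in\mathbb{R}^{MN}$ be the vector stacking $\mathbf{x}_1^t,\dots,\mathbf{x}_N^t$. Let $$\boldsymbol{\Sigma}=\tfrac12\mathbf{I}-a\left(\tfrac{b}{a}\varphi_{\mathrm c}'(0)\,\mathbf{L}\otimes\mathbf{I}_M+\varphi_{\mathrm o}'(0)\,\mathbf{H}^\top\mathbf{H}\right),$$ and let $a$ be large enough that $\boldsymbol{\Sigma}$ is stable (all its eigenvalues have negative real part). Then, as $t\to\infty$, in distribution, $$\sqrt{t+1}\,(\mathbf{x}^t-\mathbf{1}_N\otimes\boldsymbol{\theta}^\ast)\Rightarrow\mathcal{N}(\mathbf{0},\mathbf{S}),\qquad \mathbf{S}=a^2\int_0^\infty e^{\boldsymbol{\Sigma}v}\,\mathbf{S}_0\,e^{\boldsymbol{\Sigma}^\top v}\,dv,$$ where $$\mathbf{S}_0=\frac{b^2}{a^2}\sigma_{\mathrm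 c}^2\,\mathrm{Diag}(\{d_i\mathbf{I}_M\})-\frac{b}{a}\mathbf{K}_{\mathrm{c,o}}\mathbf{H}-\frac{b}{a}\mathbf{H}^\top\mathbf{K}_{\mathrm{c,o}}^\top+\sigma_{\mathrm o}^2\mathbf{H}^\top\mathbf{H},$$ with $\sigma_{\mathrm o}^2=\int|\Psi_{\mathrm o}(w)|^2p_{\mathrm o}(w)\,dw$, $\sigma_{\mathrm c}^2=\int|\Psi_{\mathrm c}(w)|^2p_{\mathrm c}(w)\,dw$, and $\mathbf{K}_{\mathrm{c,o}}\in\mathbb{R}^{MN\times N}$ the effective cross-covariance matrix whose entry in row $s=M(i-1)+\ell$ ($i\in\{1,\dots,N\}$, $\ell\in\{1,\dots,M\}$) and column $k\in\{1,\dots,N\}$ is $$\sum_{j\in\Omega_i}\iint\Psi_{\mathrm c}(w_{ij\ell})\,\Psi_{\mathrm o}(w_k)\,d\Phi^{\mathrm{c,o}}_{k,ij\ell}(w_{ij\ell},w_k),$$ where $\Phi^{\mathrm{c,o}}_{k,ij\ell}$ is the joint distribution of $\big([\boldsymbol{\xi}_{ij}^t]_\ell,\,n_k^t\big)$.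
   Context: Network and observations. There are $N\ge2$ agents $V=\{1,\dots,N\}$ connected by a static, undirected, simple (no self or multiple links), connected graph $G=(V,E)$. $\Omega_i=\{j:\{i,j\}\in E\}$, $d_i=|\Omega_i|$, and $\mathbf{L}=\mathbf{D}-\mathbf{A}$ is the graph Laplacian ($\mathbf{D}$ the degree matrix, $\mathbf{A}$ the 0-1 adjacency matrix). The set of arcs $E_d$ contains both $(i,j)$ and $(j,i)$ for every $\{i,j\}\in E$. An unknown $\boldsymbol{\theta}^\ast\in\mathbb{R}^M$ is observed at times $t=0,1,\dots$ through $z_i^t=\mathbf{h}_i^\top\boldsymbol{\theta}^\ast+n_i^t\in\mathbb{R}$, where $\mathbf{h}_i\in\mathbb{R}^M$ is deterministic and nonzero, and $\sum_{i=1}^N\mathbf{h}_i\mathbf{h}_i^\top$ is invertible. $\mathbf{H}\in\mathbb{R}^{N\times MN}$ is the matrix whose $i$-th row is $[\mathbf{0},\dots,\mathbf{0},\mathbf{h}_i^\top,\mathbf{0},\dots,\mathbf{0}]$, with $\mathbf{h}_i^\top$ in the $i$-th block of size $M$. $\mathrm{Diag}(\{d_i\mathbf{I}_M\})$ is the $MN\times MN$ block diagonal matrix with blocks $d_i\mathbf{I}_M$. $\mathbf{1}_N$ is the all-ones vector and $\otimes$ the Kronecker product. The initial points $\mathbf{x}_i^0\in\mathbb{R}^M$ are arbitrary and deterministic. Observation noise. The random variables $n_i^t$ are mutually independent over all pairs $(i,t)$ and all have the same probability density function (pdf) $p_{\mathrm o}$, where $p_{\mathrm o}(u)=p_{\mathrm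 o}(-u)$ for all $u$, $p_{\mathrm o}(u)>0$ for $|u|\le r_{\mathrm o}$ for some constant $r_{\mathrm o}>0$, and $\int|u|p_{\mathrm o}(u)\,du<\infty$. Communication noise. For each arc $(i,j)\in E_d$, $\boldsymbol{\xi}_{ij}^t\in\mathbb{R}^M$ is i.i.d. in $t$ and independent across different arcs, and its entries are mutually independent. Each entry $[\boldsymbol{\xi}_{ij}^t]_\ell$, $\ell=1,\dots,M$, has the same pdf $p_{\mathrm c}$, where $p_{\mathrm c}(u)=p_{\mathrm c}(-u)$ for all $u$, $p_{\mathrm c}(u)>0$ for $|u|\le r_{\mathrm c}$ for some constant $r_{\mathrm c}>0$, and $\int|u|p_{\mathrm c}(u)\,du<\infty$. Observation and communication noises at the same time $t$ may be mutually dependent; the joint collection $\big((n_i^t)_i,(\boldsymbol{\xi}_{ij}^t)_{(i,j)\in E_d}\big)$ is i.i.d. in $t$. Nonlinearities. $\Psi_{\mathrm o},\Psi_{\mathrm c}:\mathbb{R}\to\mathbb{R}$, and $\boldsymbol{\Psi}_{\mathrm c}:\mathbb{R}^M\to\mathbb{R}^M$ applies $\Psi_{\mathrm c}$ to each component. Each $\Psi\in\{\Psi_{\mathrm o},\Psi_{\mathrm c}\}$ satisfies: (1) $\Psi$ is odd; (2) $\Psi(u)>0$ for $u>0$; (3) $\Psi$ is monotonically nondecreasing; (4) $\Psi$ is continuous except possibly on a set of Lebesgue measure zero, and is piecewise differentiable; (5) $|\Psi(u)|\le c_1$ for all $u$, for some constant $c_1>0$; (6) $\Psi$ is either discontinuous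 at zero or strictly increasing on $(-c_2,c_2)$ for some $c_2>0$. Smoothed nonlinearities. $\varphi_{\mathrm o}(u)=\int\Psi_{\mathrm o}(u+w)p_{\mathrm o}(w)\,dw$ and $\varphi_{\mathrm c}(u)=\int\Psi_{\mathrm c}(u+w)p_{\mathrm c}(w)\,dw$; it is taken as known in this setting that both are differentiable at $0$ with $\varphi_{\mathrm o}'(0)>0$ and $\varphi_{\mathrm c}'(0)>0$. *)

theory Defs
  imports "HOL-Probability.Probability"
begin

section \<open>Graphs on a finite vertex type\<close>

definition simple_graph :: "'n set set \<Rightarrow> bool" where
  "simple_graph E \<longleftrightarrow> (\<forall>e\<in>E. card e = 2)"

definition arcs_of :: "'n set set \<Rightarrow> ('n \<times> 'n) set" where
  "arcs_of E = {(i, j). {i, j} \<in> E}"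

definition neighbours :: "'n set set \<Rightarrow> 'n \<Rightarrow> 'n set" where
  "neighbours E i = {j. {i, j} \<in> E}"

definition degree_of :: "'n set set \<Rightarrow> 'n \<Rightarrow> nat" where
  "degree_of E i = card (neighbours E i)"

definition connected_graph :: "'n set set \<Rightarrow> bool" where
  "connected_graph E \<longleftrightarrow> (\<forall>i j. (i, j) \<in> (arcs_of E)\<^sup>*)"

definition adjacency_matrix :: "'n::finite set set \<Rightarrow> real^'n^'n" where
  "adjacency_matrix E = (\<chi> i j. if {i, j} \<in> E then 1 else 0)"

definition degree_matrix :: "'n::finite set set \<Rightarrow> real^'n^'n" where
  "degree_matrix E = (\<chi> i j. if i = j then real (degree_of E i) else 0)"

definition laplacian :: "'n::finite set set \<Rightarrow> real^'n^'n" where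
  "laplacian E = degree_matrix E - adjacency_matrix E"


section \<open>Block vectors and matrices\<close>

text \<open>
  A vector in \<open>R^(MN)\<close> is indexed by pairs: the pair of agent \<open>i\<close> and component \<open>l\<close>
  plays the role of position \<open>M(i-1) + l\<close>. In \<open>real^'c^'r\<close>, \<open>'r\<close> indexes rows and
  \<open>'c\<close> columns.
\<close>

definition stack :: "('n::finite \<Rightarrow> real^'m) \<Rightarrow> real^('n \<times> 'm::finite)" where
  "stack x = (\<chi> s. x (fst s) $ snd s)"

definition kron_vec :: "real^'n \<Rightarrow> real^'m \<Rightarrow> real^('n::finite \<times> 'm::finite)" where
  "kron_vec u v = (\<chi> s. u $ fst s * v $ snd s)"

definition kron :: "real^'c^'r \<Rightarrow> real^'d^'s
    \<Rightarrow> real^('c::finite \<times> 'd::finite)^('r::finite \<times> 's::finite)" where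
  "kron A B = (\<chi> r c. A $ fst r $ fst c * B $ snd r $ snd c)"

definition block_diag :: "('n::finite \<Rightarrow> real^'m^'m) \<Rightarrow> real^('n \<times> 'm::finite)^('n \<times> 'm)" where
  "block_diag B = (\<chi> r c. if fst r = fst c then B (fst r) $ snd r $ snd c else 0)"

definition observation_matrix :: "('n::finite \<Rightarrow> real^'m) \<Rightarrow> real^('n \<times> 'm::finite)^'n" where
  "observation_matrix h = (\<chi> i s. if fst s = i then h i $ snd s else 0)"

definition componentwise :: "(real \<Rightarrow> real) \<Rightarrow> real^'m \<Rightarrow> real^'m::finite" where
  "componentwise \<Psi> v = (\<chi> l. \<Psi> (v $ l))"


section \<open>Stability and the matrix exponential\<close>

definition complex_eigenvalue :: "real^'k^'k::finite \<Rightarrow> complex \<Rightarrow> bool" where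
  "complex_eigenvalue A \<mu> \<longleftrightarrow>
     (\<exists>v::complex^'k. v \<noteq> 0 \<and> (\<chi> i j. complex_of_real (A $ i $ j)) *v v = \<mu> *s v)"

definition stable_matrix :: "real^'k^'k::finite \<Rightarrow> bool" where
  "stable_matrix A \<longleftrightarrow> (\<forall>\<mu>. complex_eigenvalue A \<mu> \<longrightarrow> Re \<mu> < 0)"

text \<open>
  The class-based \<open>exp\<close> and \<open>^\<close> do not apply here: \<open>*\<close> on \<open>real^'k^'k\<close> is entrywise.
\<close>

primrec matrix_power :: "real^'k^'k \<Rightarrow> nat \<Rightarrow> real^'k^'k::finite" where
  "matrix_power A 0 = mat 1"
| "matrix_power A (Suc k) = A ** matrix_power A k"

definition matrix_exp :: "real^'k^'k \<Rightarrow> real^'k^'k::finite" where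
  "matrix_exp A = (\<Sum>k. (1 / fact k) *\<^sub>R matrix_power A k)"


section \<open>Probabilistic notions\<close>

text \<open>The density is taken to be a nonnegative real function.\<close>

definition noise_pdf :: "(real \<Rightarrow> real) \<Rightarrow> bool" where
  "noise_pdf p \<longleftrightarrow>
     p \<in> borel_measurable borel \<and> (\<forall>u. 0 \<le> p u) \<and> (\<integral>\<^sup>+u. ennreal (p u) \<partial>lborel) = 1 \<and>
     (\<forall>u. p (- u) = p u) \<and>
     (\<exists>r>0. \<forall>u. \<bar>u\<bar> \<le> r \<longrightarrow> 0 < p u) \<and>
     integrable lborel (\<lambda>u. \<bar>u\<bar> * p u)"

definition (in prob_space) iid_seq :: "'b measure \<Rightarrow> (nat \<Rightarrow> 'a \<Rightarrow> 'b) \<Rightarrow> bool" where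
  "iid_seq N X \<longleftrightarrow>
     indep_vars (\<lambda>_. N) X UNIV \<and> (\<forall>s t. distr M N (X s) = distr M N (X t))"

text \<open>
  The law with characteristic function \<open>exp(i u.m - u.Su/2)\<close>; singular covariance
  matrices, for which there is no density, are included.
\<close>

definition multivariate_normal :: "real^'k \<Rightarrow> real^'k^'k \<Rightarrow> (real^'k::finite) measure \<Rightarrow> bool" where
  "multivariate_normal m S N \<longleftrightarrow>
     prob_space N \<and> sets N = sets borel \<and>
     (\<forall>u. (\<integral>x. cis (u \<bullet> x) \<partial>N) = cis (u \<bullet> m) * exp (- complex_of_real (u \<bullet> (S *v u)) / 2))"

text \<open>The library's \<open>weak_conv_m\<close> covers only measures on the real line.\<close>

definition weakly_converges :: "(nat \<Rightarrow> 'b::topological_space measure) \<Rightarrow> 'b measure \<Rightarrow> bool" where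
  "weakly_converges \<mu> \<nu> \<longleftrightarrow>
     (\<forall>f::'b \<Rightarrow> real. continuous_on UNIV f \<and> bounded (range f) \<longrightarrow>
        (\<lambda>t. \<integral>x. f x \<partial>\<mu> t) \<longlonglongrightarrow> (\<integral>x. f x \<partial>\<nu>))"


section \<open>Nonlinearities\<close>

text \<open>
  The library's \<open>piecewise_differentiable_on\<close> requires continuity, which would exclude
  sign and quantisation functions.
\<close>

definition piecewise_differentiable :: "(real \<Rightarrow> real) \<Rightarrow> bool" where
  "piecewise_differentiable f \<longleftrightarrow>
     (\<exists>S. (\<forall>r. finite (S \<inter> {-r..r})) \<and> (\<forall>u. u \<notin> S \<longrightarrow> f differentiable at u))"

definition admissible_nonlinearity :: "(real \<Rightarrow> real) \<Rightarrow> bool" where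
  "admissible_nonlinearity \<Psi> \<longleftrightarrow>
     (\<forall>u. \<Psi> (- u) = - \<Psi> u) \<and>
     (\<forall>u>0. 0 < \<Psi> u) \<and>
     mono \<Psi> \<and>
     {u. \<not> isCont \<Psi> u} \<in> null_sets lebesgue \<and> piecewise_differentiable \<Psi> \<and>
     (\<exists>c\<^sub>1>0. \<forall>u. \<bar>\<Psi> u\<bar> \<le> c\<^sub>1) \<and>
     (\<not> isCont \<Psi> 0 \<or> (\<exists>c\<^sub>2>0. strict_mono_on {-c\<^sub>2<..<c\<^sub>2} \<Psi>))"

definition smoothed :: "(real \<Rightarrow> real) \<Rightarrow> (real \<Rightarrow> real) \<Rightarrow> real \<Rightarrow> real" where
  "smoothed \<Psi> p u = (\<integral>w. \<Psi> (u + w) * p w \<partial>lborel)"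

definition effective_variance :: "(real \<Rightarrow> real) \<Rightarrow> (real \<Rightarrow> real) \<Rightarrow> real" where
  "effective_variance \<Psi> p = (\<integral>w. \<bar>\<Psi> w\<bar>\<^sup>2 * p w \<partial>lborel)"

text \<open>
  \<open>\<Phi> k i j l\<close> is the joint distribution of the \<open>l\<close>-th noise component on arc \<open>(i, j)\<close>
  (first coordinate) and the observation noise of agent \<open>k\<close> (second coordinate).
\<close>

definition effective_cross_cov ::
  "'n set set \<Rightarrow> (real \<Rightarrow> real) \<Rightarrow> (real \<Rightarrow> real)
     \<Rightarrow> ('n \<Rightarrow> 'n \<Rightarrow> 'n \<Rightarrow> 'm \<Rightarrow> (real \<times> real) measure) \<Rightarrow> real^'n::finite^('n \<times> 'm::finite)" where
  "effective_cross_cov E \<Psi>\<^sub>c \<Psi>\<^sub>o \<Phi> =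
     (\<chi> s k. \<Sum>j\<in>neighbours E (fst s).
        \<integral>w. \<Psi>\<^sub>c (fst w) * \<Psi>\<^sub>o (snd w) \<partial>(\<Phi> k (fst s) j (snd s)))"

end

theory Submission
  imports Defs "HOL-Real_Asymp.Real_Asymp"
begin

text \<open>
  Centre the iterates at the target: the stacked errors \<open>Y t = x t - 1 \<otimes> \<theta>\<close> satisfy the
  Robbins--Monro recursion \<open>Y (t+1) = Y t - a/(t+1) G (Y t) (\<nu> t)\<close>, in which \<open>\<nu> t\<close> is the
  joint noise at time \<open>t\<close> (i.i.d. in \<open>t\<close>) and \<open>G\<close> is bounded because the nonlinearities are.
  The mean field \<open>g y = E (G y \<nu>)\<close> is built from the smoothed nonlinearities; it vanishes at
  \<open>0\<close>, its derivative there is the symmetric matrix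
  \<open>J = (b/a) \<phi>\<^sub>c'(0) L \<otimes> I + \<phi>\<^sub>o'(0) H\<^sup>T H\<close>, and stability of \<open>\<Sigma> = I/2 - a J\<close> says
  exactly that \<open>a J > I/2\<close>.

  \<^emph>\<open>Rate.\<close> Oddness and monotonicity make \<open>y \<bullet> g (c y)\<close> nondecreasing in \<open>c\<close>, so the quadratic
  lower bound for \<open>y \<bullet> g y\<close> near \<open>0\<close> propagates to
  \<open>y \<bullet> g y \<ge> \<beta> min |y|\<^sup>2 \<delta>\<^sup>2\<close> everywhere, with \<open>2 a \<beta> > 1\<close> (\<open>drift_from_linearisation\<close>).
  The drift is too weak far from \<open>0\<close> for a quadratic Lyapunov function, but
  \<open>exp (|y|\<^sup>2 / \<delta>\<^sup>2) - 1\<close> grows fast enough to contract with the full local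
  rate \<open>2 a \<beta>\<close> on the whole space. This gives \<open>E |Y t|\<^sup>2 = O(1/t)\<close> directly
  (\<open>second_moment\<close>), with neither almost sure convergence nor localisation.

  \<^emph>\<open>Linearisation.\<close> Write \<open>Y\<close> as the solution of the linear recursion driven by the i.i.d. noise
  \<open>- G 0 (\<nu> t)\<close>, plus a martingale part driven by the fluctuation of \<open>G (Y t) - G 0\<close>, plus a
  part driven by the Taylor remainder of \<open>g\<close>. The fluctuation tends to \<open>0\<close> in
  mean square because the nonlinearities are almost everywhere continuous and the noise has a
  density. The last two parts are \<open>o(t\<^bsup>-1/2\<^esup>)\<close> in mean (\<open>linearisation_error\<close>).

  \<^emph>\<open>Limit law.\<close> The characteristic function of the linear recursion is compared, one step at a
  time, with that of a Gaussian recursion; each step costs \<open>O(t\<^bsup>-3\<^esup>)\<close> while the damping is faster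
  than \<open>t\<^bsup>-3/2\<^esup>\<close> (\<open>linear_char_gaussian\<close>). The rescaled Gaussian covariances converge to the
  solution \<open>S\<close> of the Lyapunov equation \<open>\<Sigma> S + S \<Sigma> = - a\<^sup>2 S\<^sub>0\<close>
  (\<open>linear_quadratic_lyapunov\<close>), and the integral in the theorem solves it
  (\<open>lyapunov_integral\<close>). Tightness from the second moments and a Stone--Weierstrass argument turn
  convergence of characteristic functions into weak convergence
  (\<open>weakly_converges_characteristic\<close>).
\<close>


section \<open>Recursive inequalities with harmonic step sizes\<close>

text \<open>
  The limit \<open>F / \<kappa>\<close> is the fixed point of the recursion. The positive part of \<open>s t - F / \<kappa>\<close> is
  damped by \<open>1 - \<kappa> / (t + 1)\<close> at each step, hence \<open>O(t\<^bsup>-\<kappa>\<^esup>)\<close>: the factors telescope because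
  \<open>((t + 2) / (t + 1))\<^bsup>\<kappa>\<^esup> (1 - \<kappa> / (t + 1)) \<le> exp (\<kappa> / (t + 1)) exp (- \<kappa> / (t + 1)) = 1\<close>.
\<close>
lemma chung_core:
  fixes s :: "nat \<Rightarrow> real"
  assumes k: "0 < \<kappa>"
    and rec: "\<forall>\<^sub>F t in sequentially. s (Suc t) \<le> (1 - \<kappa> / (real t + 1)) * s t + F / (real t + 1)"
    and e: "0 < e"
  shows "\<forall>\<^sub>F t in sequentially. s t \<le> F / \<kappa> + e"
proof -
  obtain t0 where t0: "\<And>t. t \<ge> t0 \<Longrightarrow> s (Suc t) \<le> (1 - \<kappa> / (real t + 1)) * s t + F / (real t + 1)" "real t0 \<ge> \<kappa>"
  proof -
    obtain t1 where t1: "\<And>t. t \<ge> t1 \<Longrightarrow> s (Suc t) \<le> (1 - \<kappa> / (real t + 1)) * s t + F / (real t + 1)"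
      using rec unfolding eventually_sequentially by blast
    obtain t2 where t2: "real t2 \<ge> \<kappa>" using real_arch_simple by blast
    show ?thesis using that[of "max t1 t2"] t1 t2 by auto
  qed
  define d where "d t = max 0 (s t - F / \<kappa>)" for t
  have d0: "0 \<le> d t" for t by (simp add: d_def)
  have dS: "d (Suc t) \<le> (1 - \<kappa> / (real t + 1)) * d t" if "t \<ge> t0" for t
  proof -
    have nn: "0 \<le> 1 - \<kappa> / (real t + 1)" using t0(2) that by (simp add: field_simps)
    have "s (Suc t) - F / \<kappa> \<le> (1 - \<kappa> / (real t + 1)) * (s t - F / \<kappa>)"
    proof -
      have "(1 - \<kappa> * y) * (s t - F / \<kappa>) = (1 - \<kappa> * y) * s t + F * y - F / \<kappa>" for y
        using k by (simp add: field_simps)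
      from this[of "1 / (real t + 1)"] show ?thesis using t0(1)[OF that] by simp
    qed
    also have "\<dots> \<le> (1 - \<kappa> / (real t + 1)) * d t"
      by (rule mult_left_mono[OF _ nn]) (simp add: d_def)
    finally show ?thesis using nn d0[of t] by (simp add: d_def)
  qed
  have step: "(real (Suc t) + 1) powr \<kappa> * (1 - \<kappa> / (real t + 1)) \<le> (real t + 1) powr \<kappa>" for t
  proof -
    have "(real (Suc t) + 1) powr \<kappa> = (real t + 1) powr \<kappa> * (1 + 1 / (real t + 1)) powr \<kappa>"
    proof -
      have "real (Suc t) + 1 = (real t + 1) * (1 + 1 / (real t + 1))" by (simp add: field_simps)
      then show ?thesis by (metis powr_mult)
    qed
    also have "(1 + 1 / (real t + 1)) powr \<kappa> \<le> exp (1 / (real t + 1)) powr \<kappa>"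
      by (rule powr_mono2) (use k exp_ge_add_one_self[of "1 / (real t + 1)"] in auto)
    also have "exp (1 / (real t + 1)) powr \<kappa> = exp (\<kappa> / (real t + 1))"
      by (simp add: exp_powr_real)
    finally have A: "(real (Suc t) + 1) powr \<kappa> \<le> (real t + 1) powr \<kappa> * exp (\<kappa> / (real t + 1))"
      by (simp add: mult_left_mono)
    have B: "1 - \<kappa> / (real t + 1) \<le> exp (- (\<kappa> / (real t + 1)))"
      using exp_ge_add_one_self[of "- (\<kappa> / (real t + 1))"] by simp
    have "(real (Suc t) + 1) powr \<kappa> * (1 - \<kappa> / (real t + 1)) \<le> (real (Suc t) + 1) powr \<kappa> * exp (- (\<kappa> / (real t + 1)))"
      by (rule mult_left_mono[OF B]) simp
    also have "\<dots> \<le> (real t + 1) powr \<kappa> * exp (\<kappa> / (real t + 1)) * exp (- (\<kappa> / (real t + 1)))"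
      by (rule mult_right_mono[OF A]) simp
    also have "\<dots> = (real t + 1) powr \<kappa>" by (simp add: exp_minus)
    finally show ?thesis .
  qed
  have bound: "(real t + 1) powr \<kappa> * d t \<le> (real t0 + 1) powr \<kappa> * d t0" if "t \<ge> t0" for t
    using that
  proof (induction t rule: dec_induct)
    case (step t)
    have "(real (Suc t) + 1) powr \<kappa> * d (Suc t) \<le> (real (Suc t) + 1) powr \<kappa> * ((1 - \<kappa> / (real t + 1)) * d t)"
      using dS[of t] step by (intro mult_left_mono) auto
    also have "\<dots> \<le> (real t + 1) powr \<kappa> * d t"
      using mult_right_mono[OF \<open>\<And>t. (real (Suc t) + 1) powr \<kappa> * (1 - \<kappa> / (real t + 1)) \<le> (real t + 1) powr \<kappa>\<close>[of t] d0[of t]] by (simp add: mult.assoc)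
    finally show ?case using step by simp
  qed simp
  have "(\<lambda>t. ((real t0 + 1) powr \<kappa> * d t0) * (real t + 1) powr (-\<kappa>)) \<longlonglongrightarrow> 0"
    using k by real_asymp
  then have "\<forall>\<^sub>F t in sequentially. ((real t0 + 1) powr \<kappa> * d t0) * (real t + 1) powr (-\<kappa>) < e"
    using e by (rule order_tendstoD)
  then show ?thesis
    using eventually_ge_at_top[of t0]
  proof eventually_elim
    case (elim t)
    have "d t = ((real t + 1) powr \<kappa> * d t) * (real t + 1) powr (-\<kappa>)"
      by (simp add: powr_minus)
    also have "\<dots> \<le> ((real t0 + 1) powr \<kappa> * d t0) * (real t + 1) powr (-\<kappa>)"
      by (rule mult_right_mono[OF bound]) (use elim in auto)
    also have "\<dots> < e" using elim by simp
    finally show ?case by (simp add: d_def)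
  qed
qed

text \<open>
  The weight \<open>(t + 1)\<^bsup>p\<^esup>\<close> lowers the damping constant from \<open>c\<close> to \<open>c - p\<close> up to terms of second
  order; half of \<open>c - p\<close> is given away to absorb them. This is Chung's lemma with an explicit
  dependence on \<open>F\<close>, so that it also yields the version with vanishing forcing.
\<close>
lemma chung_weighted:
  fixes r :: "nat \<Rightarrow> real"
  assumes p: "0 \<le> p" "p < c" and F: "0 \<le> F" and r: "\<And>t. 0 \<le> r t"
    and rec: "\<forall>\<^sub>F t in sequentially. r (Suc t) \<le> (1 - c / (real t + 1)) * r t + F * (real t + 1) powr (- p - 1)"
    and e: "0 < e"
  shows "\<forall>\<^sub>F t in sequentially. (real t + 1) powr p * r t \<le> F * (2 powr p * 2 / (c - p)) + e"
proof -
  define \<kappa> where "\<kappa> = (c - p) / 2"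
  have k: "0 < \<kappa>" using p by (simp add: \<kappa>_def)
  define q where "q t = ((real t + 2) / (real t + 1)) powr p" for t :: nat
  have q1: "(real (Suc t) + 1) powr p = q t * (real t + 1) powr p" for t
  proof -
    have "real (Suc t) + 1 = (real t + 2) / (real t + 1) * (real t + 1)" by simp
    then show ?thesis unfolding q_def by (metis powr_mult)
  qed
  have q2: "q t \<le> 2 powr p" for t
    unfolding q_def by (rule powr_mono2) (use p in \<open>auto simp: field_simps\<close>)
  have q3: "q t \<le> exp (p / (real t + 1))" for t
  proof -
    have "q t \<le> exp (1 / (real t + 1)) powr p"
      unfolding q_def
    proof (rule powr_mono2)
      have "(real t + 2) / (real t + 1) = 1 + 1 / (real t + 1)" by (simp add: field_simps)
      also have "\<dots> \<le> exp (1 / (real t + 1))" by (rule exp_ge_add_one_self)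
      finally show "(real t + 2) / (real t + 1) \<le> exp (1 / (real t + 1))" .
    qed (use p in auto)
    then show ?thesis by (simp add: exp_powr_real)
  qed
  have "\<forall>\<^sub>F t in sequentially. exp (- ((c - p) / (real t + 1))) \<le> 1 - ((c - p) / 2) / (real t + 1)"
  proof -
    have "c - p > 0" using p by simp
    then have "\<forall>\<^sub>F x in at_right 0. exp (- x) \<le> 1 - x / (2::real)" by real_asymp
    moreover have "filterlim (\<lambda>t::nat. (c - p) / (real t + 1)) (at_right 0) sequentially"
      using \<open>c - p > 0\<close> by real_asymp
    ultimately have "\<forall>\<^sub>F t::nat in sequentially. exp (- ((c - p) / (real t + 1))) \<le> 1 - ((c - p) / (real t + 1)) / 2"
      by (rule eventually_compose_filterlim)
    then show ?thesis by (simp add: field_simps)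
  qed
  then have "\<forall>\<^sub>F t in sequentially. (real (Suc t) + 1) powr p * r (Suc t) \<le>
      (1 - \<kappa> / (real t + 1)) * ((real t + 1) powr p * r t) + (F * 2 powr p) / (real t + 1)"
    using rec eventually_ge_at_top[of "nat \<lceil>c\<rceil>"]
  proof eventually_elim
    case (elim t)
    have ct: "c \<le> real t" using elim(3) by linarith
    have nn: "0 \<le> 1 - c / (real t + 1)" using ct by (simp add: field_simps)
    have "(1 - c / (real t + 1)) * q t \<le> exp (- (c / (real t + 1))) * exp (p / (real t + 1))"
      using exp_ge_add_one_self[of "- (c / (real t + 1))"] q3[of t] nn
      by (intro mult_mono) (auto simp: q_def)
    also have "\<dots> = exp (- ((c - p) / (real t + 1)))"
      by (simp add: exp_add[symmetric] diff_divide_distrib)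
    also have "\<dots> \<le> 1 - \<kappa> / (real t + 1)" using elim(1) by (simp add: \<kappa>_def)
    finally have A: "(1 - c / (real t + 1)) * q t \<le> 1 - \<kappa> / (real t + 1)" .
    have "(real (Suc t) + 1) powr p * r (Suc t) \<le> (q t * (real t + 1) powr p) *
       ((1 - c / (real t + 1)) * r t + F * (real t + 1) powr (- p - 1))"
      unfolding q1 using elim(2) by (intro mult_left_mono) (auto simp: q_def)
    also have "\<dots> = ((1 - c / (real t + 1)) * q t) * ((real t + 1) powr p * r t) + q t * (F * ((real t + 1) powr p * (real t + 1) powr (- p - 1)))"
      by (simp add: algebra_simps)
    also have "(real t + 1) powr p * (real t + 1) powr (- p - 1) = 1 / (real t + 1)"
      by (simp add: powr_add[symmetric] powr_minus_divide)
    also have "((1 - c / (real t + 1)) * q t) * ((real t + 1) powr p * r t) + q t * (F * (1 / (real t + 1)))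
       \<le> (1 - \<kappa> / (real t + 1)) * ((real t + 1) powr p * r t) + 2 powr p * (F * (1 / (real t + 1)))"
      using r[of t] F by (intro add_mono mult_right_mono A q2) auto
    finally show ?case by (simp add: mult_ac)
  qed
  from chung_core[OF k this e] show ?thesis
    by (simp add: \<kappa>_def field_simps)
qed

lemma chung_bounded:
  fixes r :: "nat \<Rightarrow> real"
  assumes "0 \<le> p" "p < c" "0 \<le> F" "\<And>t. 0 \<le> r t"
    and "\<forall>\<^sub>F t in sequentially. r (Suc t) \<le> (1 - c / (real t + 1)) * r t + F * (real t + 1) powr (- p - 1)"
  obtains K where "0 \<le> K" "\<And>t. (real t + 1) powr p * r t \<le> K"
proof -
  from chung_weighted[OF assms, of 1] obtain t0 where t0:
    "\<And>t. t \<ge> t0 \<Longrightarrow> (real t + 1) powr p * r t \<le> F * (2 powr p * 2 / (c - p)) + 1"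
    by (auto simp: eventually_sequentially)
  define K where "K = (F * (2 powr p * 2 / (c - p)) + 1) + (\<Sum>t<t0. (real t + 1) powr p * r t)"
  have nn: "0 \<le> (real t + 1) powr p * r t" for t using assms(4) by simp
  have n2: "0 \<le> F * (2 powr p * 2 / (c - p)) + 1" using assms by (auto intro!: add_nonneg_nonneg)
  have "(real t + 1) powr p * r t \<le> K" for t
  proof (cases "t \<ge> t0")
    case True
    have "0 \<le> (\<Sum>t<t0. (real t + 1) powr p * r t)" by (rule sum_nonneg) (rule nn)
    then show ?thesis using t0[OF True] unfolding K_def by linarith
  next
    case False
    then have "(real t + 1) powr p * r t \<le> (\<Sum>t<t0. (real t + 1) powr p * r t)"
      using nn by (intro member_le_sum) auto
    then show ?thesis using n2 by (simp add: K_def)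
  qed
  moreover have "0 \<le> K" using nn[of 0] calculation[of 0] by linarith
  ultimately show ?thesis using that by blast
qed

lemma chung_tendsto_0:
  fixes r :: "nat \<Rightarrow> real"
  assumes p: "0 \<le> p" "p < c" and r: "\<And>t. 0 \<le> r t" and f: "f \<longlonglongrightarrow> 0"
    and rec: "\<forall>\<^sub>F t in sequentially. r (Suc t) \<le> (1 - c / (real t + 1)) * r t + f t * (real t + 1) powr (- p - 1)"
  shows "(\<lambda>t. (real t + 1) powr p * r t) \<longlonglongrightarrow> 0"
proof (rule tendstoI)
  fix e :: real assume e: "0 < e"
  define F where "F = e / 4 / (2 powr p * 2 / (c - p))"
  have F: "0 < F" using e p by (simp add: F_def)
  have "\<forall>\<^sub>F t in sequentially. f t < F" using f F by (rule order_tendstoD)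
  with rec have "\<forall>\<^sub>F t in sequentially. r (Suc t) \<le> (1 - c / (real t + 1)) * r t + F * (real t + 1) powr (- p - 1)"
  proof eventually_elim
    case (elim t)
    have "f t * (real t + 1) powr (- p - 1) \<le> F * (real t + 1) powr (- p - 1)"
      using elim by (intro mult_right_mono) auto
    with elim show ?case by linarith
  qed
  from chung_weighted[OF p _ r this, of "e/4"] F e
  have "\<forall>\<^sub>F t in sequentially. (real t + 1) powr p * r t \<le> F * (2 powr p * 2 / (c - p)) + e / 4" by simp
  moreover have "F * (2 powr p * 2 / (c - p)) = e / 4"
  proof -
    have "2 powr p * 2 / (c - p) \<noteq> 0" using p by simp
    then show ?thesis unfolding F_def by (rule nonzero_eq_divide_eq[THEN iffD1, OF _ refl])
  qed
  ultimately have "\<forall>\<^sub>F t in sequentially. (real t + 1) powr p * r t \<le> e / 4 + e / 4" by (simp only:)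
  then show "\<forall>\<^sub>F t in sequentially. dist ((real t + 1) powr p * r t) 0 < e"
  proof eventually_elim
    case (elim t) then show ?case using r[of t] e by simp
  qed
qed

section \<open>Recursions driven by independent identically distributed noise\<close>

text \<open>
  The state is a function of the strictly earlier noise only; its independence from the present
  noise follows from this representation.
\<close>
lemma (in prob_space) recursion_adapted:
  fixes \<nu> :: "nat \<Rightarrow> 'a \<Rightarrow> 'v" and Z :: "nat \<Rightarrow> 'a \<Rightarrow> 'z"
  assumes \<Phi>: "\<And>t. case_prod (\<Phi> t) \<in> Q \<Otimes>\<^sub>M N \<rightarrow>\<^sub>M Q" and zi: "zi \<in> space Q"
    and Z0: "\<And>\<omega>. \<omega> \<in> space M \<Longrightarrow> Z 0 \<omega> = zi"
    and ZS: "\<And>t \<omega>. \<omega> \<in> space M \<Longrightarrow> Z (Suc t) \<omega> = \<Phi> t (Z t \<omega>) (\<nu> t \<omega>)"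
  shows "\<exists>f \<in> Pi\<^sub>M {..<t} (\<lambda>_. N) \<rightarrow>\<^sub>M Q. \<forall>\<omega>\<in>space M. Z t \<omega> = f (restrict (\<lambda>s. \<nu> s \<omega>) {..<t})"
proof (induction t)
  case 0
  have "(\<lambda>_. zi) \<in> Pi\<^sub>M {..<0} (\<lambda>_. N) \<rightarrow>\<^sub>M Q" using zi by (rule measurable_const)
  then show ?case by (rule bexI[where x="\<lambda>_. zi", rotated]) (simp add: Z0)
next
  case (Suc t)
  from Suc.IH obtain f where f[measurable]: "f \<in> Pi\<^sub>M {..<t} (\<lambda>_. N) \<rightarrow>\<^sub>M Q"
    and all: "\<forall>\<omega>\<in>space M. Z t \<omega> = f (restrict (\<lambda>s. \<nu> s \<omega>) {..<t})" by (rule bexE)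
  have fZ: "Z t \<omega> = f (restrict (\<lambda>s. \<nu> s \<omega>) {..<t})" if "\<omega> \<in> space M" for \<omega>
    by (rule bspec[OF all that])
  define f' where "f' p = case_prod (\<Phi> t) (f (restrict p {..<t}), p t)" for p
  have f'm: "f' \<in> Pi\<^sub>M {..<Suc t} (\<lambda>_. N) \<rightarrow>\<^sub>M Q"
    unfolding f'_def
  proof (rule measurable_compose[OF _ \<Phi>], rule measurable_Pair)
    show "(\<lambda>p. f (restrict p {..<t})) \<in> Pi\<^sub>M {..<Suc t} (\<lambda>_. N) \<rightarrow>\<^sub>M Q"
      by (rule measurable_compose[OF _ f], rule measurable_restrict_subset) auto
    show "(\<lambda>p. p t) \<in> Pi\<^sub>M {..<Suc t} (\<lambda>_. N) \<rightarrow>\<^sub>M N"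
      by (rule measurable_component_singleton) auto
  qed
  have f'Z: "Z (Suc t) \<omega> = f' (restrict (\<lambda>s. \<nu> s \<omega>) {..<Suc t})" if "\<omega> \<in> space M" for \<omega>
  proof -
    have "restrict (restrict (\<lambda>s. \<nu> s \<omega>) {..<Suc t}) {..<t} = restrict (\<lambda>s. \<nu> s \<omega>) {..<t}"
      by (auto simp: restrict_def fun_eq_iff)
    then show ?thesis using that by (simp add: f'_def ZS fZ)
  qed
  show ?case by (rule bexI[where x=f', OF _ f'm]) (rule ballI, rule f'Z)
qed

locale iid_noise = prob_space M for M :: "'w measure" +
  fixes N :: "'v measure" and \<nu> :: "nat \<Rightarrow> 'w \<Rightarrow> 'v"
  assumes iid: "iid_seq N \<nu>"
begin

definition law :: "'v measure" where "law = distr M N (\<nu> 0)"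

lemma noise_measurable [measurable]: "\<nu> t \<in> M \<rightarrow>\<^sub>M N"
  using iid by (auto simp: iid_seq_def indep_vars_def)

lemma sets_law [simp, measurable_cong]: "sets law = sets N"
  by (simp add: law_def)

lemma distr_noise: "distr M N (\<nu> t) = law"
  using iid by (auto simp: iid_seq_def law_def)

sublocale law: prob_space law
  unfolding law_def by (rule prob_space_distr) simp

lemma recursion_independent:
  fixes Z :: "nat \<Rightarrow> 'w \<Rightarrow> 'z"
  assumes \<Phi>: "\<And>t. case_prod (\<Phi> t) \<in> Q \<Otimes>\<^sub>M N \<rightarrow>\<^sub>M Q" and zi: "zi \<in> space Q"
    and Z0: "\<And>\<omega>. \<omega> \<in> space M \<Longrightarrow> Z 0 \<omega> = zi"
    and ZS: "\<And>t \<omega>. \<omega> \<in> space M \<Longrightarrow> Z (Suc t) \<omega> = \<Phi> t (Z t \<omega>) (\<nu> t \<omega>)"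
  shows "Z t \<in> M \<rightarrow>\<^sub>M Q"
    and "distr M (Q \<Otimes>\<^sub>M N) (\<lambda>\<omega>. (Z t \<omega>, \<nu> t \<omega>)) = distr M Q (Z t) \<Otimes>\<^sub>M law"
proof -
  from recursion_adapted[where t=t and \<Phi>=\<Phi> and Z=Z and \<nu>=\<nu>, OF \<Phi> zi Z0 ZS]
  obtain f where f[measurable]: "f \<in> Pi\<^sub>M {..<t} (\<lambda>_. N) \<rightarrow>\<^sub>M Q"
    and all: "\<forall>\<omega>\<in>space M. Z t \<omega> = f (restrict (\<lambda>s. \<nu> s \<omega>) {..<t})" by (rule bexE)
  have fZ: "Z t \<omega> = f (restrict (\<lambda>s. \<nu> s \<omega>) {..<t})" if "\<omega> \<in> space M" for \<omega>
    by (rule bspec[OF all that])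
  let ?P = "Pi\<^sub>M {..<t} (\<lambda>_. N)" and ?T = "Pi\<^sub>M {t} (\<lambda>_. N)"
  have "indep_var (Pi\<^sub>M {..<t} (\<lambda>_. N)) (\<lambda>\<omega>. restrict (\<lambda>i. \<nu> i \<omega>) {..<t})
                  (Pi\<^sub>M {t} (\<lambda>_. N)) (\<lambda>\<omega>. restrict (\<lambda>i. \<nu> i \<omega>) {t})"
    by (rule indep_var_restrict[where I=UNIV]) (use iid in \<open>auto simp: iid_seq_def\<close>)
  then have eq: "distr M ?P (\<lambda>\<omega>. restrict (\<lambda>i. \<nu> i \<omega>) {..<t}) \<Otimes>\<^sub>M distr M ?T (\<lambda>\<omega>. restrict (\<lambda>i. \<nu> i \<omega>) {t})
      = distr M (?P \<Otimes>\<^sub>M ?T) (\<lambda>\<omega>. (restrict (\<lambda>i. \<nu> i \<omega>) {..<t}, restrict (\<lambda>i. \<nu> i \<omega>) {t}))"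
    unfolding indep_var_distribution_eq by blast
  have r1[measurable]: "(\<lambda>\<omega>. restrict (\<lambda>i. \<nu> i \<omega>) {..<t}) \<in> M \<rightarrow>\<^sub>M ?P"
    and r2[measurable]: "(\<lambda>\<omega>. restrict (\<lambda>i. \<nu> i \<omega>) {t}) \<in> M \<rightarrow>\<^sub>M ?T"
    by (rule measurable_restrict, measurable)+
  have ev[measurable]: "(\<lambda>p. p t) \<in> ?T \<rightarrow>\<^sub>M N" by (rule measurable_component_singleton) simp
  show "Z t \<in> M \<rightarrow>\<^sub>M Q"
    by (rule measurable_cong[THEN iffD2, OF fZ measurable_compose[OF r1 f]])
  have evd: "distr (distr M ?T (\<lambda>\<omega>. restrict (\<lambda>i. \<nu> i \<omega>) {t})) N (\<lambda>p. p t) = law"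
    by (subst distr_distr[OF ev r2]) (simp add: comp_def distr_noise)
  have fd: "distr (distr M ?P (\<lambda>\<omega>. restrict (\<lambda>i. \<nu> i \<omega>) {..<t})) Q f = distr M Q (Z t)"
    by (subst distr_distr[OF f r1]) (auto intro!: distr_cong simp: fZ)
  have "distr M (Q \<Otimes>\<^sub>M N) (\<lambda>\<omega>. (Z t \<omega>, \<nu> t \<omega>))
      = distr (distr M (?P \<Otimes>\<^sub>M ?T) (\<lambda>\<omega>. (restrict (\<lambda>i. \<nu> i \<omega>) {..<t}, restrict (\<lambda>i. \<nu> i \<omega>) {t})))
          (Q \<Otimes>\<^sub>M N) (\<lambda>(p, q). (f p, q t))"
    by (subst distr_distr) (auto intro!: distr_cong simp: fZ)
  also have "\<dots> = distr M Q (Z t) \<Otimes>\<^sub>M law"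
    unfolding eq[symmetric] fd[symmetric]
    by (subst evd[symmetric], subst pair_measure_distr)
      (auto simp: evd intro: law.sigma_finite_measure_axioms)
  finally show "distr M (Q \<Otimes>\<^sub>M N) (\<lambda>\<omega>. (Z t \<omega>, \<nu> t \<omega>)) = distr M Q (Z t) \<Otimes>\<^sub>M law" .
qed

text \<open>
  This replaces conditioning on the past: the present noise may be integrated out first, with the
  state frozen. Stating it through integrability of the composed variable allows functions
  that are bounded only on the range of \<open>Z\<close>.
\<close>
lemma expectation_fresh_noise:
  fixes F :: "'z \<Rightarrow> 'v \<Rightarrow> 'b::{banach, second_countable_topology}"
  assumes Z[measurable]: "Z \<in> M \<rightarrow>\<^sub>M Q"
    and ind: "distr M (Q \<Otimes>\<^sub>M N) (\<lambda>\<omega>. (Z \<omega>, \<nu> t \<omega>)) = distr M Q Z \<Otimes>\<^sub>M law"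
    and F[measurable]: "case_prod F \<in> Q \<Otimes>\<^sub>M N \<rightarrow>\<^sub>M borel"
    and int: "integrable M (\<lambda>\<omega>. F (Z \<omega>) (\<nu> t \<omega>))"
  shows "expectation (\<lambda>\<omega>. F (Z \<omega>) (\<nu> t \<omega>)) = expectation (\<lambda>\<omega>. \<integral>v. F (Z \<omega>) v \<partial>law)"
    and "integrable M (\<lambda>\<omega>. \<integral>v. F (Z \<omega>) v \<partial>law)"
proof -
  interpret Z: prob_space "distr M Q Z" by (rule prob_space_distr) simp
  interpret P: pair_prob_space "distr M Q Z" law ..
  have FF[measurable]: "case_prod F \<in> borel_measurable (distr M Q Z \<Otimes>\<^sub>M law)" using F by simp
  have int': "integrable (distr M Q Z \<Otimes>\<^sub>M law) (case_prod F)"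
    unfolding ind[symmetric] by (subst integrable_distr_eq) (use int in auto)
  have "expectation (\<lambda>\<omega>. F (Z \<omega>) (\<nu> t \<omega>)) = (\<integral>p. case_prod F p \<partial>distr M (Q \<Otimes>\<^sub>M N) (\<lambda>\<omega>. (Z \<omega>, \<nu> t \<omega>)))"
    by (subst integral_distr) auto
  also have "\<dots> = (\<integral>p. case_prod F p \<partial>(distr M Q Z \<Otimes>\<^sub>M law))" by (simp add: ind)
  also have "\<dots> = (\<integral>z. \<integral>v. F z v \<partial>law \<partial>distr M Q Z)"
    using P.integral_fst'[OF int'] by simp
  also have "\<dots> = expectation (\<lambda>\<omega>. \<integral>v. F (Z \<omega>) v \<partial>law)"
    by (subst integral_distr) auto
  finally show "expectation (\<lambda>\<omega>. F (Z \<omega>) (\<nu> t \<omega>)) = expectation (\<lambda>\<omega>. \<integral>v. F (Z \<omega>) v \<partial>law)" .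
  show "integrable M (\<lambda>\<omega>. \<integral>v. F (Z \<omega>) v \<partial>law)"
    using P.integrable_fst'[OF int'] by (subst (asm) integrable_distr_eq) auto
qed

end

section \<open>The mean-square rate of a bounded Robbins--Monro recursion\<close>

lemma exp_le_quadratic:
  fixes x :: real
  assumes "\<bar>x\<bar> \<le> 1"
  shows "exp x \<le> 1 + x + x\<^sup>2"
proof (cases "0 \<le> x")
  case True
  then show ?thesis using exp_bound[of x] assms by simp
next
  case False
  define y where "y = - x"
  have y: "0 \<le> y" "y \<le> 1" using False assms by (auto simp: y_def)
  have "1 \<le> 1 + y ^ 3" using y by simp
  also have "\<dots> = (1 + y) * (1 - y + y\<^sup>2)" by (simp add: algebra_simps power2_eq_square power3_eq_cube)
  also have "\<dots> \<le> exp y * (1 - y + y\<^sup>2)"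
  proof (rule mult_right_mono)
    have "0 \<le> y\<^sup>2" by simp
    then show "0 \<le> 1 - y + y\<^sup>2" using y by linarith
  qed (use exp_ge_add_one_self[of y] in simp)
  finally show ?thesis by (simp add: y_def exp_minus field_simps)
qed

text \<open>
  The truncation \<open>min x 1\<close>, which models a drift that stops growing, costs nothing once it is
  multiplied by \<open>exp x\<close>. This is why the exponential Lyapunov function contracts at the local rate.
\<close>
lemma exp_minus_one_le_mult_min:
  fixes x :: real
  assumes "0 \<le> x"
  shows "exp x - 1 \<le> exp x * min x 1"
proof (cases "x \<le> 1")
  case True
  have "1 - x \<le> exp (- x)" using exp_ge_add_one_self[of "- x"] by simp
  then have "exp x * (1 - x) \<le> exp x * exp (- x)" by (intro mult_left_mono) auto
  then show ?thesis using True by (simp add: exp_minus algebra_simps)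
qed simp

locale bounded_robbins_monro = iid_noise M N \<nu>
  for M :: "'w measure" and N :: "'v measure" and \<nu> :: "nat \<Rightarrow> 'w \<Rightarrow> 'v" +
  fixes G :: "'a::euclidean_space \<Rightarrow> 'v \<Rightarrow> 'a" and C a :: real
    and y0 :: 'a and Y :: "nat \<Rightarrow> 'w \<Rightarrow> 'a"
  assumes G_measurable: "case_prod G \<in> borel \<Otimes>\<^sub>M N \<rightarrow>\<^sub>M borel"
    and G_bound: "norm (G y v) \<le> C"
    and a_pos: "0 < a"
    and Y_0: "\<omega> \<in> space M \<Longrightarrow> Y 0 \<omega> = y0"
    and Y_Suc: "\<omega> \<in> space M \<Longrightarrow>
          Y (Suc t) \<omega> = Y t \<omega> - (a / (real t + 1)) *\<^sub>R G (Y t \<omega>) (\<nu> t \<omega>)"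
begin

definition mean_field :: "'a \<Rightarrow> 'a" where "mean_field y = (\<integral>v. G y v \<partial>law)"

text \<open>
  A deterministic envelope of the iterates: the increments are at most \<open>C a / (t + 1)\<close>. Variables
  at a fixed time are therefore bounded and have all expectations needed, and \<open>growth\<^sup>2 / t\<close> tends to \<open>0\<close>, so
  second-order terms of the Lyapunov function are negligible.
\<close>
definition growth :: "nat \<Rightarrow> real" where "growth t = norm y0 + 2 * C * a * ln (real t + 1)"

lemma G_measurable' [measurable (raw)]:
  assumes [measurable]: "f \<in> L \<rightarrow>\<^sub>M borel" "h \<in> L \<rightarrow>\<^sub>M N"
  shows "(\<lambda>x. G (f x) (h x)) \<in> borel_measurable L"
proof -
  have "(\<lambda>x. case_prod G (f x, h x)) \<in> borel_measurable L"
    by (rule measurable_compose[OF _ G_measurable]) simp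
  then show ?thesis by simp
qed

lemma G_measurable_noise [measurable]: "G y \<in> borel_measurable law"
proof -
  have "(\<lambda>v. G y v) \<in> borel_measurable law" by measurable
  then show ?thesis by simp
qed

lemma C_nonneg: "0 \<le> C"
  using G_bound[of undefined undefined] norm_ge_zero order_trans by blast

lemma G_integrable [simp]: "integrable law (G y)"
  by (rule law.integrable_const_bound[where B=C]) (use G_bound in auto)

lemma mean_field_bound: "norm (mean_field y) \<le> C"
proof -
  have "norm (mean_field y) \<le> (\<integral>v. norm (G y v) \<partial>law)"
    unfolding mean_field_def by (rule integral_norm_bound)
  also have "\<dots> \<le> (\<integral>v. C \<partial>law)" by (rule integral_mono) (use G_bound in auto)
  finally show ?thesis using law.prob_space by simp
qed

lemma mean_field_measurable [measurable]: "mean_field \<in> borel_measurable borel"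
  unfolding mean_field_def by measurable

lemma G_step_measurable: "case_prod (\<lambda>y v. y - c *\<^sub>R G y v) \<in> borel \<Otimes>\<^sub>M N \<rightarrow>\<^sub>M borel"
  by measurable

lemmas Y_independent = recursion_independent[where Z=Y and zi=y0 and Q=borel
    and \<Phi>="\<lambda>t y v. y - (a / (real t + 1)) *\<^sub>R G y v", OF G_step_measurable _ Y_0 Y_Suc, simplified]

lemma Y_measurable [measurable]: "Y t \<in> borel_measurable M"
  by (rule Y_independent(1))

lemma Y_growth:
  assumes "\<omega> \<in> space M"
  shows "norm (Y t \<omega>) \<le> growth t"
proof (induction t)
  case 0
  then show ?case using Y_0[OF assms] by (simp add: growth_def)
next
  case (Suc t)
  have "ln ((real t + 1) / (real t + 2)) \<le> (real t + 1) / (real t + 2) - 1"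
    by (rule ln_le_minus_one) simp
  then have "1 / (real t + 2) \<le> ln (real t + 2) - ln (real t + 1)"
    by (simp add: ln_div field_simps)
  moreover have "1 / (real t + 1) \<le> 2 * (1 / (real t + 2))" by (simp add: field_simps)
  ultimately have *: "1 / (real t + 1) \<le> 2 * (ln (real t + 2) - ln (real t + 1))"
    by (meson mult_left_mono order_trans zero_le_numeral)
  have "norm (Y (Suc t) \<omega>) \<le> norm (Y t \<omega>) + a / (real t + 1) * norm (G (Y t \<omega>) (\<nu> t \<omega>))"
    unfolding Y_Suc[OF assms] using norm_triangle_ineq4[of "Y t \<omega>" "(a / (real t + 1)) *\<^sub>R G (Y t \<omega>) (\<nu> t \<omega>)"] a_pos
    by simp
  also have "\<dots> \<le> growth t + a / (real t + 1) * C"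
    using Suc a_pos G_bound by (intro add_mono mult_left_mono) auto
  also have "\<dots> \<le> growth (Suc t)"
  proof -
    have "(a * C) * (1 / (real t + 1)) \<le> (a * C) * (2 * (ln (real t + 2) - ln (real t + 1)))"
      using * a_pos C_nonneg by (intro mult_left_mono) auto
    then show ?thesis by (simp add: growth_def algebra_simps)
  qed
  finally show ?case .
qed

lemma growth_tendsto: "(\<lambda>t. (K1 + K2 * (growth t)\<^sup>2) / (real t + 1)) \<longlonglongrightarrow> 0"
proof -
  have "(\<lambda>t::nat. 1 / (real t + 1)) \<longlonglongrightarrow> 0" "(\<lambda>t::nat. ln (real t + 1) / (real t + 1)) \<longlonglongrightarrow> 0"
    "(\<lambda>t::nat. (ln (real t + 1))\<^sup>2 / (real t + 1)) \<longlonglongrightarrow> 0"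
    by real_asymp+
  note this(1)[THEN tendsto_mult_left, of "K1 + K2 * (norm y0)\<^sup>2"]
    this(2)[THEN tendsto_mult_left, of "4 * C * a * K2 * norm y0"]
    this(3)[THEN tendsto_mult_left, of "4 * C\<^sup>2 * a\<^sup>2 * K2"]
  from tendsto_add[OF tendsto_add[OF this(1,2)] this(3)] show ?thesis
    by (simp add: growth_def power2_eq_square add_divide_distrib algebra_simps)
qed

lemma growth_tendsto': "(\<lambda>t. (K1 * growth t + K2) / (real t + 1)) \<longlonglongrightarrow> 0"
  unfolding growth_def by real_asymp

lemma integrable_Y:
  fixes f :: "'a \<Rightarrow> 'b::{banach, second_countable_topology}"
  assumes [measurable]: "f \<in> borel_measurable borel" and "\<And>y. norm y \<le> growth t \<Longrightarrow> norm (f y) \<le> K"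
  shows "integrable M (\<lambda>\<omega>. f (Y t \<omega>))"
  by (rule integrable_const_bound[where B=K]) (use assms(2) Y_growth in auto)

lemma integrable_norm_Y: "integrable M (\<lambda>\<omega>. norm (Y t \<omega>))" "integrable M (\<lambda>\<omega>. (norm (Y t \<omega>))\<^sup>2)"
  by (rule integrable_Y[where K="growth t"], simp_all)
    (rule integrable_Y[where K="(growth t)\<^sup>2"], auto intro: power_mono)

text \<open>
  With \<open>x = |y|\<^sup>2 / \<delta>\<^sup>2\<close> and \<open>D\<close> its increment, \<open>exp (x + D) \<le> exp x (1 + D + D\<^sup>2)\<close>. The mean of the
  first-order term is at most \<open>- 2 \<alpha> \<beta> exp x (min x 1) \<le> - 2 \<alpha> \<beta> (exp x - 1)\<close>. In the
  second-order term \<open>D\<^sup>2 = O(\<alpha>\<^sup>2 (|y|\<^sup>2 + 1))\<close>; splitting \<open>exp x = 1 + (exp x - 1)\<close> leaves a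
  forcing of order \<open>\<alpha>\<^sup>2\<close> and a multiple of the Lyapunov function that is \<open>o(\<alpha>)\<close>.
\<close>
lemma exp_moment_step:
  assumes drift: "\<And>y. \<beta> * min ((norm y)\<^sup>2) (\<delta>\<^sup>2) \<le> y \<bullet> mean_field y" and \<delta>: "0 < \<delta>"
    and \<beta>: "0 \<le> \<beta>"
    and small: "(2 * a * C * growth t + a\<^sup>2 * C\<^sup>2) / (real t + 1) \<le> \<delta>\<^sup>2" and ta: "a \<le> real t + 1"
  defines "c1 \<equiv> C\<^sup>2 / \<delta>\<^sup>2 + 2 * C ^ 4 / \<delta> ^ 4" and "c2 \<equiv> 8 * C\<^sup>2 / \<delta> ^ 4"
    and "u \<equiv> \<lambda>t. expectation (\<lambda>\<omega>. exp ((norm (Y t \<omega>))\<^sup>2 / \<delta>\<^sup>2) - 1)"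
  shows "u (Suc t) \<le> (1 - 2 * a * \<beta> / (real t + 1)
      + a\<^sup>2 * (c1 + c2 * \<delta>\<^sup>2 + c2 * (growth t)\<^sup>2) / (real t + 1)\<^sup>2) * u t + a\<^sup>2 * c1 / (real t + 1)\<^sup>2"
proof -
  define \<alpha> where "\<alpha> = a / (real t + 1)"
  have \<alpha>: "0 < \<alpha>" "\<alpha> \<le> 1" using a_pos ta by (auto simp: \<alpha>_def)
  define U :: "'a \<Rightarrow> real" where "U y = exp ((norm y)\<^sup>2 / \<delta>\<^sup>2) - 1" for y
  have c12: "0 \<le> c1" "0 \<le> c2" using \<delta> by (auto simp: c1_def c2_def)
  have Um[measurable]: "U \<in> borel_measurable borel" unfolding U_def by measurable
  have U0: "0 \<le> U y" for y by (simp add: U_def)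
  have Ub: "norm (U y) \<le> exp (R\<^sup>2 / \<delta>\<^sup>2)" if "norm y \<le> R" for y R
    using U0[of y] that \<delta> by (auto simp: U_def intro!: divide_right_mono power_mono add_increasing2 order_trans[OF diff_le_eq[THEN iffD2]])
  have intU: "integrable M (\<lambda>\<omega>. U (Y s \<omega>))" for s
    by (rule integrable_Y[OF Um Ub])
  have uU: "u s = expectation (\<lambda>\<omega>. U (Y s \<omega>))" for s by (simp add: u_def U_def)
  define k where "k = 1 - 2 * \<alpha> * \<beta> + \<alpha>\<^sup>2 * (c1 + c2 * \<delta>\<^sup>2 + c2 * (growth t)\<^sup>2)"
  define F where "F y v = U (y - \<alpha> *\<^sub>R G y v)" for y v
  have FY: "F (Y t \<omega>) (\<nu> t \<omega>) = U (Y (Suc t) \<omega>)" if "\<omega> \<in> space M" for \<omega>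
    using Y_Suc[OF that] by (simp add: F_def \<alpha>_def)
  have Fm: "case_prod F \<in> borel \<Otimes>\<^sub>M N \<rightarrow>\<^sub>M borel" unfolding F_def by measurable
  have intF: "integrable M (\<lambda>\<omega>. F (Y t \<omega>) (\<nu> t \<omega>))"
    using intU[of "Suc t"] by (rule Bochner_Integration.integrable_cong[THEN iffD1, rotated -1]) (auto simp: FY)
  have key: "(\<integral>v. F y v \<partial>law) \<le> k * U y + \<alpha>\<^sup>2 * c1" if y: "norm y \<le> growth t" for y
  proof -
    define x where "x = (norm y)\<^sup>2 / \<delta>\<^sup>2"
    define D where "D v = (- 2 * \<alpha> * (y \<bullet> G y v) + \<alpha>\<^sup>2 * (norm (G y v))\<^sup>2) / \<delta>\<^sup>2" for v
    have x0: "0 \<le> x" by (simp add: x_def)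
    have FD: "F y v = exp x * exp (D v) - 1" for v
    proof -
      have "(norm (y - \<alpha> *\<^sub>R G y v))\<^sup>2 = (norm y)\<^sup>2 - 2 * \<alpha> * (y \<bullet> G y v) + \<alpha>\<^sup>2 * (norm (G y v))\<^sup>2"
        unfolding power2_norm_eq_inner
        by (simp add: inner_diff_left inner_diff_right inner_commute power2_eq_square algebra_simps)
      then show ?thesis by (simp add: F_def U_def x_def D_def exp_add[symmetric] add_divide_distrib diff_divide_distrib)
    qed
    have g1: "\<bar>y \<bullet> G y v\<bar> \<le> norm y * C" for v
      using Cauchy_Schwarz_ineq2[of y "G y v"] mult_left_mono[OF G_bound[of y v] norm_ge_zero[of y]] by linarith
    have g2: "(norm (G y v))\<^sup>2 \<le> C\<^sup>2" for v by (rule power_mono[OF G_bound]) simp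
    have num: "\<bar>- 2 * \<alpha> * (y \<bullet> G y v) + \<alpha>\<^sup>2 * (norm (G y v))\<^sup>2\<bar> \<le> 2 * \<alpha> * (norm y * C) + \<alpha>\<^sup>2 * C\<^sup>2" for v
    proof -
      have "2 * \<alpha> * \<bar>y \<bullet> G y v\<bar> \<le> 2 * \<alpha> * (norm y * C)" using g1[of v] \<alpha> by simp
      moreover have "\<alpha>\<^sup>2 * (norm (G y v))\<^sup>2 \<le> \<alpha>\<^sup>2 * C\<^sup>2" using g2[of v] by (simp add: mult_left_mono)
      moreover have "\<bar>- 2 * \<alpha> * (y \<bullet> G y v)\<bar> = 2 * \<alpha> * \<bar>y \<bullet> G y v\<bar>" using \<alpha> by (simp add: abs_mult)
      moreover have "0 \<le> \<alpha>\<^sup>2 * (norm (G y v))\<^sup>2" by simp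
      ultimately show ?thesis by linarith
    qed
    have D1: "\<bar>D v\<bar> \<le> 1" for v
    proof -
      have "2 * \<alpha> * (norm y * C) + \<alpha>\<^sup>2 * C\<^sup>2 \<le> 2 * \<alpha> * (growth t * C) + \<alpha>\<^sup>2 * C\<^sup>2"
        using y \<alpha> C_nonneg by (simp add: mult_right_mono)
      also have "\<dots> \<le> (2 * a * C * growth t + a\<^sup>2 * C\<^sup>2) / (real t + 1)"
      proof -
        have "\<alpha>\<^sup>2 \<le> a\<^sup>2 / (real t + 1)" 
          unfolding \<alpha>_def power_divide by (intro divide_left_mono) (auto simp: power2_eq_square)
        then have "\<alpha>\<^sup>2 * C\<^sup>2 \<le> a\<^sup>2 / (real t + 1) * C\<^sup>2" by (intro mult_right_mono) auto
        then show ?thesis by (simp add: \<alpha>_def add_divide_distrib mult_ac)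
      qed
      also have "\<dots> \<le> \<delta>\<^sup>2" by (rule small)
      finally show ?thesis using num[of v] \<delta> by (simp add: D_def abs_divide field_simps)
    qed
    have D2: "(D v)\<^sup>2 \<le> \<alpha>\<^sup>2 * (c2 * (norm y)\<^sup>2 + 2 * C ^ 4 / \<delta> ^ 4)" for v
    proof -
      have "(- 2 * \<alpha> * (y \<bullet> G y v) + \<alpha>\<^sup>2 * (norm (G y v))\<^sup>2)\<^sup>2 \<le> (2 * \<alpha> * (norm y * C) + \<alpha>\<^sup>2 * C\<^sup>2)\<^sup>2"
        using num[of v] by (rule abs_le_square_iff[THEN iffD1, OF order_trans[OF _ abs_ge_self]])
      also have "\<dots> \<le> 2 * (2 * \<alpha> * (norm y * C))\<^sup>2 + 2 * (\<alpha>\<^sup>2 * C\<^sup>2)\<^sup>2"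
        using sum_squares_bound[of "2 * \<alpha> * (norm y * C)" "\<alpha>\<^sup>2 * C\<^sup>2"] by (simp add: power2_sum)
      also have "\<dots> \<le> \<alpha>\<^sup>2 * (8 * C\<^sup>2 * (norm y)\<^sup>2 + 2 * C ^ 4)"
      proof -
        have "\<alpha>\<^sup>2 * C ^ 4 * \<alpha>\<^sup>2 \<le> \<alpha>\<^sup>2 * C ^ 4 * 1"
          using \<alpha> by (intro mult_left_mono power_le_one) auto
        moreover have "2 * (2 * \<alpha> * (norm y * C))\<^sup>2 + 2 * (\<alpha>\<^sup>2 * C\<^sup>2)\<^sup>2 = 8 * (\<alpha>\<^sup>2 * (C\<^sup>2 * (norm y)\<^sup>2)) + 2 * (\<alpha>\<^sup>2 * C ^ 4 * \<alpha>\<^sup>2)"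
          by (simp add: power_mult_distrib algebra_simps power4_eq_xxxx power2_eq_square)
        ultimately show ?thesis by (simp add: algebra_simps)
      qed
      finally have "(D v)\<^sup>2 \<le> \<alpha>\<^sup>2 * (8 * C\<^sup>2 * (norm y)\<^sup>2 + 2 * C ^ 4) / (\<delta>\<^sup>2)\<^sup>2"
        unfolding D_def power_divide by (rule divide_right_mono) simp
      also have "\<dots> = \<alpha>\<^sup>2 * (c2 * (norm y)\<^sup>2 + 2 * C ^ 4 / \<delta> ^ 4)"
        by (simp add: c2_def add_divide_distrib algebra_simps power_mult[symmetric])
      finally show ?thesis .
    qed
    have Fle: "F y v \<le> exp x * (1 + \<alpha>\<^sup>2 * (c1 + c2 * (norm y)\<^sup>2)) - 1 - exp x * (2 * \<alpha> / \<delta>\<^sup>2) * (y \<bullet> G y v)" for v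
    proof -
      have "exp (D v) \<le> 1 + D v + (D v)\<^sup>2" by (rule exp_le_quadratic[OF D1])
      also have "\<dots> \<le> 1 + (- (2 * \<alpha> / \<delta>\<^sup>2) * (y \<bullet> G y v) + \<alpha>\<^sup>2 * (C\<^sup>2 / \<delta>\<^sup>2)) + \<alpha>\<^sup>2 * (c2 * (norm y)\<^sup>2 + 2 * C ^ 4 / \<delta> ^ 4)"
      proof -
        have "D v \<le> - (2 * \<alpha> / \<delta>\<^sup>2) * (y \<bullet> G y v) + \<alpha>\<^sup>2 * (C\<^sup>2 / \<delta>\<^sup>2)"
        proof -
          have "D v = - (2 * \<alpha> / \<delta>\<^sup>2) * (y \<bullet> G y v) + \<alpha>\<^sup>2 * ((norm (G y v))\<^sup>2 / \<delta>\<^sup>2)"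
            by (simp add: D_def add_divide_distrib diff_divide_distrib)
          moreover have "\<alpha>\<^sup>2 * ((norm (G y v))\<^sup>2 / \<delta>\<^sup>2) \<le> \<alpha>\<^sup>2 * (C\<^sup>2 / \<delta>\<^sup>2)"
            using g2[of v] by (intro mult_left_mono divide_right_mono) auto
          ultimately show ?thesis by linarith
        qed
        with D2[of v] show ?thesis by linarith
      qed
      also have "\<dots> = 1 + \<alpha>\<^sup>2 * (c1 + c2 * (norm y)\<^sup>2) - (2 * \<alpha> / \<delta>\<^sup>2) * (y \<bullet> G y v)"
        by (simp add: c1_def algebra_simps)
      finally have "exp x * exp (D v) \<le> exp x * (1 + \<alpha>\<^sup>2 * (c1 + c2 * (norm y)\<^sup>2) - (2 * \<alpha> / \<delta>\<^sup>2) * (y \<bullet> G y v))"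
        by (rule mult_left_mono) simp
      then show ?thesis by (simp add: FD algebra_simps)
    qed
    have Fy[measurable]: "F y \<in> borel_measurable law"
    proof -
      have "(\<lambda>v. F y v) \<in> borel_measurable law" unfolding F_def by measurable
      then show ?thesis by simp
    qed
    have intFy: "integrable law (F y)"
    proof (rule law.integrable_const_bound[where B="exp ((norm y + \<alpha> * C)\<^sup>2 / \<delta>\<^sup>2)"])
      have "norm (y - \<alpha> *\<^sub>R G y v) \<le> norm y + \<alpha> * C" for v
      proof -
        have "norm (y - \<alpha> *\<^sub>R G y v) \<le> norm y + \<alpha> * norm (G y v)"
          using norm_triangle_ineq4[of y "\<alpha> *\<^sub>R G y v"] \<alpha> by simp
        also have "\<dots> \<le> norm y + \<alpha> * C" using G_bound \<alpha> by (simp add: mult_left_mono)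
        finally show ?thesis .
      qed
      then show "AE v in law. norm (F y v) \<le> exp ((norm y + \<alpha> * C)\<^sup>2 / \<delta>\<^sup>2)"
        unfolding F_def by (intro AE_I2 Ub)
    qed simp
    have "(\<integral>v. F y v \<partial>law) \<le> (\<integral>v. exp x * (1 + \<alpha>\<^sup>2 * (c1 + c2 * (norm y)\<^sup>2)) - 1 - exp x * (2 * \<alpha> / \<delta>\<^sup>2) * (y \<bullet> G y v) \<partial>law)"
      by (rule integral_mono[OF intFy _ Fle]) simp
    also have "\<dots> = exp x * (1 + \<alpha>\<^sup>2 * (c1 + c2 * (norm y)\<^sup>2)) - 1 - exp x * (2 * \<alpha> / \<delta>\<^sup>2) * (y \<bullet> mean_field y)"
      using law.prob_space by (simp add: mean_field_def)
    also have "\<dots> \<le> exp x * (1 + \<alpha>\<^sup>2 * (c1 + c2 * (norm y)\<^sup>2)) - 1 - 2 * \<alpha> * \<beta> * U y"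
    proof -
      have Ux: "U y \<le> exp x * min x 1" using exp_minus_one_le_mult_min[OF x0] by (simp add: U_def x_def)
      have m: "min ((norm y)\<^sup>2) (\<delta>\<^sup>2) = \<delta>\<^sup>2 * min x 1"
        using \<delta> by (auto simp: x_def min_def field_simps)
      have "\<beta> * min x 1 \<le> (y \<bullet> mean_field y) / \<delta>\<^sup>2"
        using drift[of y] \<delta> unfolding m by (simp add: field_simps)
      then have "exp x * (2 * \<alpha>) * (\<beta> * min x 1) \<le> exp x * (2 * \<alpha>) * ((y \<bullet> mean_field y) / \<delta>\<^sup>2)"
        using \<alpha> by (intro mult_left_mono) auto
      moreover have "(2 * \<alpha> * \<beta>) * U y \<le> (2 * \<alpha> * \<beta>) * (exp x * min x 1)"
        using Ux \<alpha> \<beta> by (intro mult_left_mono) auto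
      ultimately show ?thesis by (simp add: mult_ac)
    qed
    also have "\<dots> \<le> k * U y + \<alpha>\<^sup>2 * c1"
    proof -
      have ex: "exp x = U y + 1" by (simp add: U_def x_def)
      have "x \<le> U y" using exp_ge_add_one_self[of x] unfolding ex by simp
      then have a1: "(norm y)\<^sup>2 \<le> \<delta>\<^sup>2 * U y" using \<delta> by (simp add: x_def field_simps)
      have a2: "(norm y)\<^sup>2 * U y \<le> (growth t)\<^sup>2 * U y" using y U0 by (intro mult_right_mono power_mono) auto
      have "c2 * ((norm y)\<^sup>2 + (norm y)\<^sup>2 * U y) \<le> c2 * (\<delta>\<^sup>2 * U y + (growth t)\<^sup>2 * U y)"
        using a1 a2 c12 by (intro mult_left_mono) auto
      then have "\<alpha>\<^sup>2 * (c2 * ((norm y)\<^sup>2 + (norm y)\<^sup>2 * U y)) \<le> \<alpha>\<^sup>2 * (c2 * (\<delta>\<^sup>2 * U y + (growth t)\<^sup>2 * U y))"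
        by (rule mult_left_mono) simp
      then show ?thesis unfolding ex k_def by (simp add: algebra_simps)
    qed
    finally show ?thesis .
  qed
  have "u (Suc t) = expectation (\<lambda>\<omega>. F (Y t \<omega>) (\<nu> t \<omega>))"
    unfolding uU by (rule Bochner_Integration.integral_cong) (auto simp: FY)
  also have "\<dots> = expectation (\<lambda>\<omega>. \<integral>v. F (Y t \<omega>) v \<partial>law)"
    by (rule expectation_fresh_noise(1)[OF Y_independent Fm intF])
  also have "\<dots> \<le> expectation (\<lambda>\<omega>. k * U (Y t \<omega>) + \<alpha>\<^sup>2 * c1)"
    by (rule integral_mono[OF expectation_fresh_noise(2)[OF Y_independent Fm intF]])
      (use intU key Y_growth in auto)
  also have "\<dots> = k * u t + \<alpha>\<^sup>2 * c1"
    using intU by (simp add: uU prob_space)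
  finally show ?thesis by (simp add: k_def \<alpha>_def power_divide)
qed

text \<open>
  Chung's lemma applies because \<open>2 a \<beta> > 1\<close>, and the quadratic is dominated by the exponential
  Lyapunov function.
\<close>
lemma second_moment:
  assumes drift: "\<And>y. \<beta> * min ((norm y)\<^sup>2) (\<delta>\<^sup>2) \<le> y \<bullet> mean_field y" and \<delta>: "0 < \<delta>"
    and \<beta>: "1 < 2 * a * \<beta>"
  obtains K where "0 \<le> K" "\<And>t. (real t + 1) * expectation (\<lambda>\<omega>. (norm (Y t \<omega>))\<^sup>2) \<le> K"
proof -
  define c1 where "c1 = C\<^sup>2 / \<delta>\<^sup>2 + 2 * C ^ 4 / \<delta> ^ 4"
  define c2 where "c2 = 8 * C\<^sup>2 / \<delta> ^ 4"
  define u where "u t = expectation (\<lambda>\<omega>. exp ((norm (Y t \<omega>))\<^sup>2 / \<delta>\<^sup>2) - 1)" for t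
  define c where "c = (1 + 2 * a * \<beta>) / 2"
  have "1 < (1 + s) / 2 \<and> (1 + s) / 2 < s" if "1 < s" for s :: real using that by simp
  from this[OF \<beta>] have c: "1 < c" and c': "c < 2 * a * \<beta>" by (simp_all only: c_def)
  have "0 < 2 * a * \<beta>" using \<beta> by linarith
  then have \<beta>0: "0 \<le> \<beta>" using a_pos by (simp add: zero_less_mult_iff)
  have c1: "0 \<le> c1" using \<delta> by (simp add: c1_def)
  have u0: "0 \<le> u t" for t unfolding u_def by (rule integral_nonneg_AE) simp
  have "(\<lambda>t. (2 * a * C * growth t + a\<^sup>2 * C\<^sup>2) / (real t + 1)) \<longlonglongrightarrow> 0" by (rule growth_tendsto')
  then have e1: "\<forall>\<^sub>F t in sequentially. (2 * a * C * growth t + a\<^sup>2 * C\<^sup>2) / (real t + 1) < \<delta>\<^sup>2"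
    using \<delta> by (intro order_tendstoD) auto
  have "(\<lambda>t. (a\<^sup>2 * (c1 + c2 * \<delta>\<^sup>2) + a\<^sup>2 * c2 * (growth t)\<^sup>2) / (real t + 1)) \<longlonglongrightarrow> 0" by (rule growth_tendsto)
  then have e2: "\<forall>\<^sub>F t in sequentially. (a\<^sup>2 * (c1 + c2 * \<delta>\<^sup>2) + a\<^sup>2 * c2 * (growth t)\<^sup>2) / (real t + 1) < 2 * a * \<beta> - c"
    using c' by (intro order_tendstoD) auto
  have e3: "\<forall>\<^sub>F t in sequentially. a \<le> real t + 1" by real_asymp
  have rec: "\<forall>\<^sub>F t in sequentially. u (Suc t) \<le> (1 - c / (real t + 1)) * u t + (a\<^sup>2 * c1) * (real t + 1) powr (- 1 - 1)"
    using e1 e2 e3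
  proof eventually_elim
    case (elim t)
    have pw: "(real t + 1) powr (- 1 - 1) = 1 / (real t + 1)\<^sup>2"
      by (simp add: powr_minus_divide powr_numeral)
    have "u (Suc t) \<le> (1 - 2 * a * \<beta> / (real t + 1)
      + a\<^sup>2 * (c1 + c2 * \<delta>\<^sup>2 + c2 * (growth t)\<^sup>2) / (real t + 1)\<^sup>2) * u t + a\<^sup>2 * c1 / (real t + 1)\<^sup>2"
      unfolding u_def c1_def c2_def by (rule exp_moment_step[OF drift \<delta> \<beta>0]) (use elim in auto)
    also have "\<dots> \<le> (1 - c / (real t + 1)) * u t + a\<^sup>2 * c1 / (real t + 1)\<^sup>2"
    proof -
      have "a\<^sup>2 * (c1 + c2 * \<delta>\<^sup>2 + c2 * (growth t)\<^sup>2) / (real t + 1)\<^sup>2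
         = ((a\<^sup>2 * (c1 + c2 * \<delta>\<^sup>2) + a\<^sup>2 * c2 * (growth t)\<^sup>2) / (real t + 1)) / (real t + 1)"
        by (simp add: power2_eq_square algebra_simps)
      also have "\<dots> \<le> (2 * a * \<beta> - c) / (real t + 1)"
        using elim by (intro divide_right_mono) auto
      finally have "1 - 2 * a * \<beta> / (real t + 1) + a\<^sup>2 * (c1 + c2 * \<delta>\<^sup>2 + c2 * (growth t)\<^sup>2) / (real t + 1)\<^sup>2 \<le> 1 - c / (real t + 1)"
        by (simp add: diff_divide_distrib)
      then show ?thesis using u0[of t] by (simp add: mult_right_mono)
    qed
    finally show ?case unfolding pw by simp
  qed
  obtain K where K: "0 \<le> K" "\<And>t. (real t + 1) powr 1 * u t \<le> K"
    by (rule chung_bounded[OF _ c _ u0 rec]) (use c1 in auto)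
  have "(real t + 1) * expectation (\<lambda>\<omega>. (norm (Y t \<omega>))\<^sup>2) \<le> \<delta>\<^sup>2 * K" for t
  proof -
    have "expectation (\<lambda>\<omega>. (norm (Y t \<omega>))\<^sup>2) \<le> expectation (\<lambda>\<omega>. \<delta>\<^sup>2 * (exp ((norm (Y t \<omega>))\<^sup>2 / \<delta>\<^sup>2) - 1))"
    proof (rule integral_mono[OF integrable_norm_Y(2)])
      show "integrable M (\<lambda>\<omega>. \<delta>\<^sup>2 * (exp ((norm (Y t \<omega>))\<^sup>2 / \<delta>\<^sup>2) - 1))"
        by (rule integrable_Y[where f="\<lambda>y. \<delta>\<^sup>2 * (exp ((norm y)\<^sup>2 / \<delta>\<^sup>2) - 1)" and K="\<delta>\<^sup>2 * (exp ((growth t)\<^sup>2 / \<delta>\<^sup>2) - 1)"])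
          (auto intro!: mult_left_mono divide_right_mono power_mono)
      fix \<omega> 
      show "(norm (Y t \<omega>))\<^sup>2 \<le> \<delta>\<^sup>2 * (exp ((norm (Y t \<omega>))\<^sup>2 / \<delta>\<^sup>2) - 1)"
        using exp_ge_add_one_self[of "(norm (Y t \<omega>))\<^sup>2 / \<delta>\<^sup>2"] \<delta> by (simp add: field_simps)
    qed
    also have "\<dots> = \<delta>\<^sup>2 * u t" by (simp add: u_def)
    finally have "(real t + 1) * expectation (\<lambda>\<omega>. (norm (Y t \<omega>))\<^sup>2) \<le> (real t + 1) * (\<delta>\<^sup>2 * u t)"
      by (intro mult_left_mono) auto
    also have "\<dots> = \<delta>\<^sup>2 * ((real t + 1) powr 1 * u t)" by simp
    also have "\<dots> \<le> \<delta>\<^sup>2 * K" using K(2)[of t] by (intro mult_left_mono) auto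
    finally show ?thesis .
  qed
  then show ?thesis using that[of "\<delta>\<^sup>2 * K"] K(1) by auto
qed

end

text \<open>
  The derivative gives \<open>\<beta> |y|\<^sup>2 \<le> y \<bullet> g y\<close> on a small ball. Monotonicity along rays compares any
  other point with its projection to the ball's boundary, so the lower bound does not
  deteriorate further out, although \<open>g\<close> is bounded.
\<close>
lemma drift_from_linearisation:
  fixes g :: "'a::euclidean_space \<Rightarrow> 'a"
  assumes deriv: "(g has_derivative B) (at 0)" and g0: "g 0 = 0"
    and lower: "\<And>u. \<beta>0 * (norm u)\<^sup>2 \<le> u \<bullet> B u" and \<beta>: "0 \<le> \<beta>" "\<beta> < \<beta>0"
    and ray: "\<And>c y. 0 \<le> c \<Longrightarrow> c \<le> 1 \<Longrightarrow> y \<bullet> g (c *\<^sub>R y) \<le> y \<bullet> g y"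
  obtains \<delta> where "0 < \<delta>" "\<And>y. \<beta> * min ((norm y)\<^sup>2) (\<delta>\<^sup>2) \<le> y \<bullet> g y"
proof -
  have e: "0 < \<beta>0 - \<beta>" using \<beta> by simp
  obtain d where d: "0 < d" "\<And>y. norm (y - 0) < d \<Longrightarrow> norm (g y - g 0 - B (y - 0)) \<le> (\<beta>0 - \<beta>) * norm (y - 0)"
    using deriv e unfolding has_derivative_at_alt by blast
  define \<delta> where "\<delta> = d / 2"
  have \<delta>: "0 < \<delta>" "\<delta> < d" using d(1) by (auto simp: \<delta>_def)
  have near: "\<beta> * (norm y)\<^sup>2 \<le> y \<bullet> g y" if "norm y \<le> \<delta>" for y
  proof -
    have r: "norm (g y - B y) \<le> (\<beta>0 - \<beta>) * norm y" using d(2)[of y] that \<delta> g0 by simp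
    have "\<bar>y \<bullet> (g y - B y)\<bar> \<le> norm y * norm (g y - B y)" by (rule Cauchy_Schwarz_ineq2)
    also have "\<dots> \<le> norm y * ((\<beta>0 - \<beta>) * norm y)" using r by (rule mult_left_mono) simp
    also have "\<dots> = \<beta>0 * (norm y)\<^sup>2 - \<beta> * (norm y)\<^sup>2" by (simp add: power2_eq_square algebra_simps)
    finally have "\<bar>y \<bullet> g y - y \<bullet> B y\<bar> \<le> \<beta>0 * (norm y)\<^sup>2 - \<beta> * (norm y)\<^sup>2" by (simp add: inner_diff_right)
    then show ?thesis using lower[of y] by linarith
  qed
  have "\<beta> * min ((norm y)\<^sup>2) (\<delta>\<^sup>2) \<le> y \<bullet> g y" for y
  proof (cases "norm y \<le> \<delta>")
    case True
    have "\<beta> * min ((norm y)\<^sup>2) (\<delta>\<^sup>2) \<le> \<beta> * (norm y)\<^sup>2" using \<beta>(1) by (intro mult_left_mono) auto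
    then show ?thesis using near[OF True] by linarith
  next
    case False
    define c where "c = \<delta> / norm y"
    have y0: "y \<noteq> 0" using False \<delta> by auto
    have c: "0 < c" "c \<le> 1" using False \<delta> y0 by (simp_all add: c_def)
    have w: "norm (c *\<^sub>R y) = \<delta>" using y0 \<delta> by (simp add: c_def)
    have "\<beta> * \<delta>\<^sup>2 \<le> c * (y \<bullet> g (c *\<^sub>R y))" using near[of "c *\<^sub>R y"] w by simp
    also have "\<dots> \<le> c * (y \<bullet> g y)" using c ray[of c y] by (intro mult_left_mono) auto
    finally have 1: "\<beta> * \<delta>\<^sup>2 \<le> c * (y \<bullet> g y)" .
    then have "0 \<le> c * (y \<bullet> g y)" using \<beta>(1) by (meson mult_nonneg_nonneg order_trans zero_le_power2)
    then have "0 \<le> y \<bullet> g y" using c(1) by (simp add: zero_le_mult_iff)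
    then have "c * (y \<bullet> g y) \<le> y \<bullet> g y" using c by (simp add: mult_left_le_one_le)
    moreover have "\<beta> * min ((norm y)\<^sup>2) (\<delta>\<^sup>2) \<le> \<beta> * \<delta>\<^sup>2" using \<beta>(1) by (intro mult_left_mono) auto
    ultimately show ?thesis using 1 by linarith
  qed
  with \<delta>(1) show ?thesis using that by blast
qed

section \<open>Comparison with the linear recursion\<close>

locale linearised_robbins_monro = bounded_robbins_monro M N \<nu> G C a y0 Y
  for M :: "'w measure" and N :: "'v measure" and \<nu> :: "nat \<Rightarrow> 'w \<Rightarrow> 'v"
    and G :: "'a::euclidean_space \<Rightarrow> 'v \<Rightarrow> 'a" and C a :: real
    and y0 :: 'a and Y :: "nat \<Rightarrow> 'w \<Rightarrow> 'a" +
  fixes B :: "'a \<Rightarrow> 'a" and \<beta> \<delta> :: real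
  assumes B_linear: "linear B"
    and B_lower: "\<beta> * (norm v)\<^sup>2 \<le> v \<bullet> B v"
    and drift: "\<beta> * min ((norm y)\<^sup>2) (\<delta>\<^sup>2) \<le> y \<bullet> mean_field y"
    and \<delta>_pos: "0 < \<delta>" and \<beta>: "1 < 2 * a * \<beta>"
    and mean_field_0: "mean_field 0 = 0"
    and mean_field_derivative: "(mean_field has_derivative B) (at 0)"
    and noise_continuous: "((\<lambda>y. \<integral>v. (norm (G y v - G 0 v))\<^sup>2 \<partial>law) \<longlongrightarrow> 0) (at 0)"
begin

definition contraction :: "nat \<Rightarrow> 'a \<Rightarrow> 'a" where
  "contraction t v = v - (a / (real t + 1)) *\<^sub>R B v"

definition rate :: "nat \<Rightarrow> real" where "rate t = onorm (contraction t)"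

lemma B_bounded_linear: "bounded_linear B"
  using B_linear by (simp add: linear_conv_bounded_linear)

lemma contraction_bounded_linear: "bounded_linear (contraction t)"
  unfolding contraction_def[abs_def]
  by (intro bounded_linear_sub bounded_linear_ident bounded_linear_scaleR_right[THEN bounded_linear_compose] B_bounded_linear)

lemma contraction_measurable [measurable]: "contraction t \<in> borel_measurable borel"
  by (intro borel_measurable_continuous_onI linear_continuous_on contraction_bounded_linear)

lemma B_measurable [measurable]: "B \<in> borel_measurable borel"
  by (intro borel_measurable_continuous_onI linear_continuous_on B_bounded_linear)

lemma contraction_rate: "norm (contraction t v) \<le> rate t * norm v"
  unfolding rate_def by (rule onorm[OF contraction_bounded_linear])

lemma rate_nonneg: "0 \<le> rate t"
  unfolding rate_def by (rule onorm_pos_le[OF contraction_bounded_linear])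

text \<open>
  \<open>|v - \<alpha> B v|\<^sup>2 \<le> (1 - 2 \<alpha> \<beta> + O(\<alpha>\<^sup>2)) |v|\<^sup>2\<close>, so the operator norm is eventually below
  \<open>1 - c / (t + 1)\<close> for every \<open>c < a \<beta>\<close>; the choice leaves \<open>c > 1/2\<close>.
\<close>
lemma rate_eventually:
  obtains c where "1 / 2 < c"
    "\<forall>\<^sub>F t in sequentially. rate t \<le> 1 - c / (real t + 1) \<and> 0 \<le> 1 - c / (real t + 1)"
proof -
  have "1 / 2 < (1 + s) / 4 \<and> (1 + s) / 2 < s" if "1 < s" for s :: real using that by simp
  note this[OF \<beta>]
  moreover define c where "c = (1 + 2 * a * \<beta>) / 4"
  ultimately have c: "1 / 2 < c" "2 * c < 2 * a * \<beta>" by (simp_all only: c_def) (simp add: field_simps)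
  obtain L where L: "\<And>v. norm (B v) \<le> norm v * L" "0 \<le> L"
    using bounded_linear.nonneg_bounded[OF B_bounded_linear] by blast
  have "(\<lambda>t. a\<^sup>2 * L\<^sup>2 / (real t + 1)) \<longlonglongrightarrow> 0" by real_asymp
  then have "\<forall>\<^sub>F t in sequentially. a\<^sup>2 * L\<^sup>2 / (real t + 1) < 2 * a * \<beta> - 2 * c"
    using c by (intro order_tendstoD) auto
  moreover have "\<forall>\<^sub>F t in sequentially. 0 \<le> 1 - c / (real t + 1)" by real_asymp
  ultimately have "\<forall>\<^sub>F t in sequentially. rate t \<le> 1 - c / (real t + 1) \<and> 0 \<le> 1 - c / (real t + 1)"
  proof eventually_elim
    case (elim t)
    define \<alpha> where "\<alpha> = a / (real t + 1)"
    have \<alpha>: "0 < \<alpha>" using a_pos by (simp add: \<alpha>_def)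
    have "norm (contraction t v) \<le> (1 - c / (real t + 1)) * norm v" for v
    proof (rule power2_le_imp_le)
      have "(norm (contraction t v))\<^sup>2 = (norm v)\<^sup>2 - 2 * \<alpha> * (v \<bullet> B v) + \<alpha>\<^sup>2 * (norm (B v))\<^sup>2"
        unfolding power2_norm_eq_inner contraction_def \<alpha>_def[symmetric]
        by (simp add: inner_diff_left inner_diff_right inner_commute power2_eq_square algebra_simps)
      also have "\<dots> \<le> (norm v)\<^sup>2 - 2 * \<alpha> * (\<beta> * (norm v)\<^sup>2) + \<alpha>\<^sup>2 * (norm v * L)\<^sup>2"
      proof -
        have "2 * \<alpha> * (\<beta> * (norm v)\<^sup>2) \<le> 2 * \<alpha> * (v \<bullet> B v)" using B_lower[of v] \<alpha> by (intro mult_left_mono) auto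
        moreover have "\<alpha>\<^sup>2 * (norm (B v))\<^sup>2 \<le> \<alpha>\<^sup>2 * (norm v * L)\<^sup>2" using L by (intro mult_left_mono power_mono) auto
        ultimately show ?thesis by linarith
      qed
      also have "\<dots> = (1 + (a\<^sup>2 * L\<^sup>2 / (real t + 1) - 2 * a * \<beta>) / (real t + 1)) * (norm v)\<^sup>2"
        by (simp add: \<alpha>_def power_divide power2_eq_square add_divide_distrib diff_divide_distrib algebra_simps)
      also have "\<dots> \<le> (1 + (- 2 * c) / (real t + 1)) * (norm v)\<^sup>2"
        using elim by (intro mult_right_mono add_left_mono divide_right_mono) auto
      also have "\<dots> \<le> (1 - c / (real t + 1))\<^sup>2 * (norm v)\<^sup>2"
        by (intro mult_right_mono) (auto simp: power2_diff)
      finally show "(norm (contraction t v))\<^sup>2 \<le> ((1 - c / (real t + 1)) * norm v)\<^sup>2"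
        by (simp add: power_mult_distrib)
    qed (use elim in auto)
    then show ?case unfolding rate_def using elim by (auto intro: onorm_bound)
  qed
  with c(1) show ?thesis using that by blast
qed

text \<open>
  The powers \<open>n = 1, 2, 3\<close> govern the remainder, the variances and the characteristic functions.
\<close>
lemma rate_power_eventually:
  assumes "0 < n"
  obtains c where "real n / 2 < c" "\<forall>\<^sub>F t in sequentially. rate t ^ n \<le> 1 - c / (real t + 1)"
proof -
  obtain c where c: "1 / 2 < c"
    "\<forall>\<^sub>F t in sequentially. rate t \<le> 1 - c / (real t + 1) \<and> 0 \<le> 1 - c / (real t + 1)"
    by (rule rate_eventually)
  define d where "d = (n * c + n / 2) / 2"
  have d: "real n / 2 < d" "d < n * c" using c(1) assms by (auto simp: d_def field_simps)
  have "\<forall>\<^sub>F t::nat in sequentially. exp (- (real n * c / (real t + 1))) \<le> 1 - d / (real t + 1)"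
  proof -
    have nc: "0 < real n * c" using c(1) assms by simp
    have "\<forall>\<^sub>F x in at_right 0. exp (- ((real n * c) * x)) \<le> 1 - d * x" using d nc by real_asymp
    moreover have "filterlim (\<lambda>t::nat. 1 / (real t + 1)) (at_right 0) sequentially" by real_asymp
    ultimately have "\<forall>\<^sub>F t::nat in sequentially. exp (- ((real n * c) * (1 / (real t + 1)))) \<le> 1 - d * (1 / (real t + 1))"
      by (rule eventually_compose_filterlim)
    then show ?thesis by simp
  qed
  with c(2) have "\<forall>\<^sub>F t in sequentially. rate t ^ n \<le> 1 - d / (real t + 1)"
  proof eventually_elim
    case (elim t)
    have "1 - c / (real t + 1) \<le> exp (- (c / (real t + 1)))"
      using exp_ge_add_one_self[of "- (c / (real t + 1))"] by simp
    then have "rate t \<le> exp (- (c / (real t + 1)))" using elim by linarith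
    then have "rate t ^ n \<le> exp (- (c / (real t + 1))) ^ n" by (rule power_mono[OF _ rate_nonneg])
    also have "\<dots> = exp (- (real n * c / (real t + 1)))" by (simp add: exp_of_nat_mult[symmetric])
    finally show ?case using elim by linarith
  qed
  with d show ?thesis using that by blast
qed

text \<open>
  The decomposition \<open>Y = linear_part + martingale_part + drift_part\<close>: all three obey the linear
  recursion with matrix \<open>B\<close>, driven respectively by \<open>- G 0 (\<nu> t)\<close>, by \<open>fluctuation\<close> (which has mean
  zero and variance at most \<open>noise_modulus\<close>) and by \<open>- remainder\<close>.
\<close>
definition fluctuation :: "'a \<Rightarrow> 'v \<Rightarrow> 'a" where
  "fluctuation y v = mean_field y - G y v + G 0 v"

definition remainder :: "'a \<Rightarrow> 'a" where "remainder y = mean_field y - B y"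

definition noise_modulus :: "'a \<Rightarrow> real" where
  "noise_modulus y = (\<integral>v. (norm (G y v - G 0 v))\<^sup>2 \<partial>law)"

primrec linear_part :: "nat \<Rightarrow> 'w \<Rightarrow> 'a" where
  "linear_part 0 \<omega> = 0"
| "linear_part (Suc t) \<omega> = contraction t (linear_part t \<omega>) - (a / (real t + 1)) *\<^sub>R G 0 (\<nu> t \<omega>)"

primrec martingale_part :: "nat \<Rightarrow> 'w \<Rightarrow> 'a" where
  "martingale_part 0 \<omega> = 0"
| "martingale_part (Suc t) \<omega> = contraction t (martingale_part t \<omega>)
     + (a / (real t + 1)) *\<^sub>R fluctuation (Y t \<omega>) (\<nu> t \<omega>)"

definition drift_part :: "nat \<Rightarrow> 'w \<Rightarrow> 'a" where
  "drift_part t \<omega> = Y t \<omega> - linear_part t \<omega> - martingale_part t \<omega>"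

lemma fluctuation_measurable [measurable (raw)]:
  assumes [measurable]: "f \<in> L \<rightarrow>\<^sub>M borel" "h \<in> L \<rightarrow>\<^sub>M N"
  shows "(\<lambda>x. fluctuation (f x) (h x)) \<in> borel_measurable L"
  unfolding fluctuation_def by measurable

lemma fluctuation_bound: "norm (fluctuation y v) \<le> 3 * C"
proof -
  have "norm (fluctuation y v) \<le> norm (mean_field y) + norm (G y v) + norm (G 0 v)"
    unfolding fluctuation_def by (meson add_mono norm_triangle_ineq norm_triangle_ineq4 order_refl order_trans)
  then show ?thesis using mean_field_bound[of y] G_bound[of y v] G_bound[of 0 v] by linarith
qed

lemma fluctuation_integrable: "integrable law (fluctuation y)"
proof -
  have "integrable law (\<lambda>v. mean_field y - G y v + G 0 v)" by simp
  then show ?thesis by (simp add: fluctuation_def[abs_def])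
qed

lemma fluctuation_mean: "(\<integral>v. fluctuation y v \<partial>law) = 0"
  using mean_field_0 law.prob_space by (simp add: fluctuation_def mean_field_def[symmetric])

lemma noise_modulus_integrable: "integrable law (\<lambda>v. (norm (G y v - G 0 v))\<^sup>2)"
proof (rule law.integrable_const_bound[where B="(2 * C)\<^sup>2"])
  have "norm (G y v - G 0 v) \<le> 2 * C" for v
    using norm_triangle_ineq4[of "G y v" "G 0 v"] G_bound[of y v] G_bound[of 0 v] by linarith
  then have "(norm (G y v - G 0 v))\<^sup>2 \<le> (2 * C)\<^sup>2" for v by (rule power_mono) simp
  then show "AE v in law. norm ((norm (G y v - G 0 v))\<^sup>2) \<le> (2 * C)\<^sup>2"
    by (intro AE_I2) (simp only: real_norm_def abs_power2)
qed simp

lemma noise_modulus_bound: "noise_modulus y \<le> 4 * C\<^sup>2"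
proof -
  have "norm (G y v - G 0 v) \<le> 2 * C" for v
    using norm_triangle_ineq4[of "G y v" "G 0 v"] G_bound[of y v] G_bound[of 0 v] by linarith
  then have "(norm (G y v - G 0 v))\<^sup>2 \<le> (2 * C)\<^sup>2" for v by (rule power_mono) simp
  then have "noise_modulus y \<le> (\<integral>v. (2 * C)\<^sup>2 \<partial>law)"
    unfolding noise_modulus_def by (intro integral_mono noise_modulus_integrable) auto
  then show ?thesis using law.prob_space by (simp add: power_mult_distrib)
qed

lemma noise_modulus_nonneg: "0 \<le> noise_modulus y"
  unfolding noise_modulus_def by (rule integral_nonneg_AE) simp

lemma noise_modulus_measurable [measurable]: "noise_modulus \<in> borel_measurable borel"
  unfolding noise_modulus_def by measurable

lemma fluctuation_variance: "(\<integral>v. (norm (fluctuation y v))\<^sup>2 \<partial>law) \<le> noise_modulus y"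
proof -
  define X where "X v = G y v - G 0 v" for v
  have Xi: "integrable law X" unfolding X_def by simp
  have EX: "(\<integral>v. X v \<partial>law) = mean_field y"
    using mean_field_0 by (simp add: X_def mean_field_def)
  have eq: "(norm (fluctuation y v))\<^sup>2 = (norm (X v))\<^sup>2 - 2 * (mean_field y \<bullet> X v) + (norm (mean_field y))\<^sup>2" for v
  proof -
    have "fluctuation y v = mean_field y - X v" by (simp add: fluctuation_def X_def)
    then show ?thesis unfolding power2_norm_eq_inner
      by (simp add: inner_diff_left inner_diff_right inner_commute)
  qed
  have "(\<integral>v. (norm (fluctuation y v))\<^sup>2 \<partial>law) = noise_modulus y - 2 * (mean_field y \<bullet> mean_field y) + (norm (mean_field y))\<^sup>2"
    unfolding eq using Xi noise_modulus_integrable[of y] EX law.prob_space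
    by (simp add: X_def[symmetric] noise_modulus_def)
  also have "\<dots> \<le> noise_modulus y" by (simp add: power2_norm_eq_inner)
  finally show ?thesis .
qed

text \<open>
  The modulus is small near \<open>0\<close> and bounded elsewhere, hence at most
  \<open>e/2 + const |y|\<^sup>2\<close>, whose expectation is controlled by the second moment.
\<close>
lemma expectation_noise_modulus_tendsto:
  "(\<lambda>t. expectation (\<lambda>\<omega>. noise_modulus (Y t \<omega>))) \<longlonglongrightarrow> 0"
proof (rule tendstoI)
  fix e :: real assume e: "0 < e"
  obtain K where K: "0 \<le> K" "\<And>t. (real t + 1) * expectation (\<lambda>\<omega>. (norm (Y t \<omega>))\<^sup>2) \<le> K"
    using second_moment[OF drift \<delta>_pos \<beta>] by blast
  have "\<forall>\<^sub>F y in at 0. noise_modulus y < e / 2"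
    using noise_continuous e unfolding noise_modulus_def[symmetric] by (intro order_tendstoD) auto
  then obtain d where d: "0 < d" "\<And>y. y \<noteq> 0 \<Longrightarrow> norm y < d \<Longrightarrow> noise_modulus y < e / 2"
    by (auto simp: eventually_at)
  have pt: "noise_modulus y \<le> e / 2 + 4 * C\<^sup>2 / d\<^sup>2 * (norm y)\<^sup>2" for y
  proof (cases "norm y < d")
    case True
    have "noise_modulus y < e / 2"
      using d(2)[of y] True e by (cases "y = 0") (auto simp: noise_modulus_def)
    then show ?thesis by (simp add: add_increasing2)
  next
    case False
    then have "d\<^sup>2 \<le> (norm y)\<^sup>2" using d(1) by (intro power_mono) auto
    then have "4 * C\<^sup>2 / d\<^sup>2 * d\<^sup>2 \<le> 4 * C\<^sup>2 / d\<^sup>2 * (norm y)\<^sup>2" by (intro mult_left_mono) auto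
    then show ?thesis using noise_modulus_bound[of y] d(1) e by simp
  qed
  have le: "expectation (\<lambda>\<omega>. noise_modulus (Y t \<omega>)) \<le> e / 2 + 4 * C\<^sup>2 / d\<^sup>2 * (K / (real t + 1))" for t
  proof -
    have "expectation (\<lambda>\<omega>. noise_modulus (Y t \<omega>)) \<le> expectation (\<lambda>\<omega>. e / 2 + 4 * C\<^sup>2 / d\<^sup>2 * (norm (Y t \<omega>))\<^sup>2)"
    proof (rule integral_mono)
      show "integrable M (\<lambda>\<omega>. noise_modulus (Y t \<omega>))"
        by (rule integrable_Y[where K="4 * C\<^sup>2"]) (use noise_modulus_nonneg noise_modulus_bound in auto)
    qed (use pt integrable_norm_Y in auto)
    also have "\<dots> = e / 2 + 4 * C\<^sup>2 / d\<^sup>2 * expectation (\<lambda>\<omega>. (norm (Y t \<omega>))\<^sup>2)"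
      using integrable_norm_Y prob_space by simp
    also have "\<dots> \<le> e / 2 + 4 * C\<^sup>2 / d\<^sup>2 * (K / (real t + 1))"
      using K(2)[of t] by (intro add_left_mono mult_left_mono) (auto simp: field_simps)
    finally show ?thesis .
  qed
  have "(\<lambda>t. 4 * C\<^sup>2 / d\<^sup>2 * (K / (real t + 1))) \<longlonglongrightarrow> 0" by real_asymp
  then have "\<forall>\<^sub>F t in sequentially. 4 * C\<^sup>2 / d\<^sup>2 * (K / (real t + 1)) < e / 2"
    using e by (intro order_tendstoD) auto
  then show "\<forall>\<^sub>F t in sequentially. dist (expectation (\<lambda>\<omega>. noise_modulus (Y t \<omega>))) 0 < e"
  proof eventually_elim
    case (elim t)
    have "0 \<le> expectation (\<lambda>\<omega>. noise_modulus (Y t \<omega>))" using noise_modulus_nonneg by (intro integral_nonneg_AE) auto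
    moreover have "expectation (\<lambda>\<omega>. noise_modulus (Y t \<omega>)) < e"
      using le[of t] elim by linarith
    ultimately show ?case by simp
  qed
qed

lemma linear_part_measurable [measurable]: "linear_part t \<in> borel_measurable M"
  by (induction t) simp_all

lemma martingale_part_measurable [measurable]: "martingale_part t \<in> borel_measurable M"
  by (induction t) simp_all

lemma drift_part_measurable [measurable]: "drift_part t \<in> borel_measurable M"
  unfolding drift_part_def[abs_def] by measurable

lemma martingale_part_bounded: "\<exists>R. \<forall>\<omega>. norm (martingale_part t \<omega>) \<le> R"
proof (induction t)
  case (Suc t)
  then obtain R where R: "\<And>\<omega>. norm (martingale_part t \<omega>) \<le> R" by blast
  have "norm (martingale_part (Suc t) \<omega>) \<le> rate t * R + a / (real t + 1) * (3 * C)" for \<omega>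
  proof -
    have "norm (martingale_part (Suc t) \<omega>) \<le> norm (contraction t (martingale_part t \<omega>))
        + norm ((a / (real t + 1)) *\<^sub>R fluctuation (Y t \<omega>) (\<nu> t \<omega>))"
      by (simp del: norm_scaleR add: norm_triangle_ineq)
    also have "\<dots> \<le> rate t * R + a / (real t + 1) * (3 * C)"
      using order_trans[OF contraction_rate mult_left_mono[OF R rate_nonneg]]
        mult_left_mono[OF fluctuation_bound, of "a / (real t + 1)"] a_pos
      by (intro add_mono) auto
    finally show ?thesis .
  qed
  then show ?case by blast
qed auto

lemma linear_part_bounded: "\<exists>R. \<forall>\<omega>. norm (linear_part t \<omega>) \<le> R"
proof (induction t)
  case (Suc t)
  then obtain R where R: "\<And>\<omega>. norm (linear_part t \<omega>) \<le> R" by blast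
  have "norm (linear_part (Suc t) \<omega>) \<le> rate t * R + a / (real t + 1) * C" for \<omega>
  proof -
    have "norm (linear_part (Suc t) \<omega>) \<le> norm (contraction t (linear_part t \<omega>))
        + norm ((a / (real t + 1)) *\<^sub>R G 0 (\<nu> t \<omega>))"
      by (simp del: norm_scaleR add: norm_triangle_ineq4)
    also have "\<dots> \<le> rate t * R + a / (real t + 1) * C"
      using order_trans[OF contraction_rate mult_left_mono[OF R rate_nonneg]] G_bound a_pos
      by (intro add_mono) (auto intro: mult_left_mono divide_right_mono)
    finally show ?thesis .
  qed
  then show ?case by blast
qed auto

lemma martingale_part_integrable: "integrable M (\<lambda>\<omega>. (norm (martingale_part t \<omega>))\<^sup>2)" "integrable M (\<lambda>\<omega>. norm (martingale_part t \<omega>))"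
proof -
  obtain R where R: "\<And>\<omega>. norm (martingale_part t \<omega>) \<le> R" using martingale_part_bounded by blast
  show "integrable M (\<lambda>\<omega>. (norm (martingale_part t \<omega>))\<^sup>2)"
    by (rule integrable_const_bound[where B="R\<^sup>2"]) (use power_mono[OF R norm_ge_zero, where n=2] in auto)
  show "integrable M (\<lambda>\<omega>. norm (martingale_part t \<omega>))"
    by (rule integrable_const_bound[where B="R"]) (use R in auto)
qed

text \<open>
  The cross term vanishes because the fluctuation has mean zero given the pair of the iterate and the
  martingale part. The pair is the state of one recursion, so both are independent of the present
  noise jointly.
\<close>
lemma martingale_part_step:
  "expectation (\<lambda>\<omega>. (norm (martingale_part (Suc t) \<omega>))\<^sup>2)
     \<le> (rate t)\<^sup>2 * expectation (\<lambda>\<omega>. (norm (martingale_part t \<omega>))\<^sup>2)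
       + (a / (real t + 1))\<^sup>2 * expectation (\<lambda>\<omega>. noise_modulus (Y t \<omega>))"
proof -
  let ?Z = "\<lambda>\<omega>. (Y t \<omega>, martingale_part t \<omega>)"
  define \<alpha> where "\<alpha> = a / (real t + 1)"
  define \<Phi> where "\<Phi> t p v = (fst p - (a / (real t + 1)) *\<^sub>R G (fst p) v, contraction t (snd p) + (a / (real t + 1)) *\<^sub>R fluctuation (fst p) v)"
    for t and p :: "'a \<times> 'a" and v
  let ?Q = "borel \<Otimes>\<^sub>M borel :: ('a \<times> 'a) measure"
  have \<Phi>m: "case_prod (\<Phi> t) \<in> ?Q \<Otimes>\<^sub>M N \<rightarrow>\<^sub>M ?Q" for t
    unfolding \<Phi>_def by measurable
  note ind = recursion_independent[where Z="\<lambda>t \<omega>. (Y t \<omega>, martingale_part t \<omega>)" and zi="(y0, 0)" and Q="?Q" and \<Phi>=\<Phi>, OF \<Phi>m]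
  have ind1: "?Z \<in> M \<rightarrow>\<^sub>M ?Q" by measurable
  have ind2: "distr M (?Q \<Otimes>\<^sub>M N) (\<lambda>\<omega>. ((?Z \<omega>), \<nu> t \<omega>)) = distr M ?Q ?Z \<Otimes>\<^sub>M law"
    by (rule ind(2)) (simp_all add: space_pair_measure Y_0 Y_Suc \<Phi>_def)
  obtain R where R: "\<And>\<omega>. norm (martingale_part t \<omega>) \<le> R" using martingale_part_bounded by blast
  define F1 where "F1 p v = contraction t (snd p) \<bullet> fluctuation (fst p) v" for p :: "'a \<times> 'a" and v
  define F2 where "F2 p v = (norm (fluctuation (fst p) v))\<^sup>2" for p :: "'a \<times> 'a" and v
  have F1m: "case_prod F1 \<in> ?Q \<Otimes>\<^sub>M N \<rightarrow>\<^sub>M borel" unfolding F1_def by measurable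
  have F2m: "case_prod F2 \<in> ?Q \<Otimes>\<^sub>M N \<rightarrow>\<^sub>M borel" unfolding F2_def by measurable
  have [measurable]: "(\<lambda>\<omega>. F1 (?Z \<omega>) (\<nu> t \<omega>)) \<in> borel_measurable M"
    "(\<lambda>\<omega>. F2 (?Z \<omega>) (\<nu> t \<omega>)) \<in> borel_measurable M"
    unfolding F1_def F2_def by measurable
  have F1i: "integrable M (\<lambda>\<omega>. F1 (?Z \<omega>) (\<nu> t \<omega>))"
  proof (rule integrable_const_bound[where B="(rate t * R) * (3 * C)"])
    have "\<bar>F1 (?Z \<omega>) (\<nu> t \<omega>)\<bar> \<le> (rate t * R) * (3 * C)" for \<omega>
    proof -
      have "\<bar>F1 (?Z \<omega>) (\<nu> t \<omega>)\<bar> \<le> norm (contraction t (martingale_part t \<omega>)) * norm (fluctuation (Y t \<omega>) (\<nu> t \<omega>))"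
        unfolding F1_def by (simp add: Cauchy_Schwarz_ineq2)
      also have "\<dots> \<le> (rate t * R) * (3 * C)"
        using order_trans[OF contraction_rate mult_left_mono[OF R rate_nonneg]] fluctuation_bound
        by (intro mult_mono) (auto intro: order_trans[OF norm_ge_zero])
      finally show ?thesis .
    qed
    then show "AE \<omega> in M. norm (F1 (?Z \<omega>) (\<nu> t \<omega>)) \<le> (rate t * R) * (3 * C)" by simp
  qed simp
  have F2i: "integrable M (\<lambda>\<omega>. F2 (?Z \<omega>) (\<nu> t \<omega>))"
    by (rule integrable_const_bound[where B="(3 * C)\<^sup>2"])
      (use power_mono[OF fluctuation_bound norm_ge_zero, where n=2] in \<open>auto simp: F2_def\<close>)
  have E1: "expectation (\<lambda>\<omega>. F1 (?Z \<omega>) (\<nu> t \<omega>)) = 0"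
    by (subst expectation_fresh_noise(1)[OF ind1 ind2 F1m F1i])
      (simp add: F1_def[abs_def] fluctuation_integrable fluctuation_mean)
  have E2: "expectation (\<lambda>\<omega>. F2 (?Z \<omega>) (\<nu> t \<omega>)) \<le> expectation (\<lambda>\<omega>. noise_modulus (Y t \<omega>))"
    unfolding expectation_fresh_noise(1)[OF ind1 ind2 F2m F2i]
  proof (rule integral_mono[OF expectation_fresh_noise(2)[OF ind1 ind2 F2m F2i]])
    show "integrable M (\<lambda>\<omega>. noise_modulus (Y t \<omega>))"
      by (rule integrable_Y[where K="4 * C\<^sup>2"]) (use noise_modulus_nonneg noise_modulus_bound in auto)
    show "(\<integral>v. F2 (?Z \<omega>) v \<partial>law) \<le> noise_modulus (Y t \<omega>)" for \<omega>
      using fluctuation_variance by (simp add: F2_def)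
  qed
  have eq: "(norm (martingale_part (Suc t) \<omega>))\<^sup>2 = (norm (contraction t (martingale_part t \<omega>)))\<^sup>2
     + 2 * \<alpha> * F1 (?Z \<omega>) (\<nu> t \<omega>) + \<alpha>\<^sup>2 * F2 (?Z \<omega>) (\<nu> t \<omega>)" for \<omega>
    unfolding power2_norm_eq_inner F1_def F2_def martingale_part.simps \<alpha>_def[symmetric]
    by (simp add: inner_add_left inner_add_right inner_commute power2_eq_square algebra_simps)
  have le: "(norm (martingale_part (Suc t) \<omega>))\<^sup>2 \<le> (rate t)\<^sup>2 * (norm (martingale_part t \<omega>))\<^sup>2
     + 2 * \<alpha> * F1 (?Z \<omega>) (\<nu> t \<omega>) + \<alpha>\<^sup>2 * F2 (?Z \<omega>) (\<nu> t \<omega>)" for \<omega>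
    unfolding eq using power_mono[OF contraction_rate[of t "martingale_part t \<omega>"], of 2]
    by (simp add: power_mult_distrib)
  have "expectation (\<lambda>\<omega>. (norm (martingale_part (Suc t) \<omega>))\<^sup>2) \<le>
     expectation (\<lambda>\<omega>. (rate t)\<^sup>2 * (norm (martingale_part t \<omega>))\<^sup>2
     + 2 * \<alpha> * F1 (?Z \<omega>) (\<nu> t \<omega>) + \<alpha>\<^sup>2 * F2 (?Z \<omega>) (\<nu> t \<omega>))"
    by (rule integral_mono[OF martingale_part_integrable(1) _ le])
      (use martingale_part_integrable(1)[of t] F1i F2i in auto)
  also have "\<dots> = (rate t)\<^sup>2 * expectation (\<lambda>\<omega>. (norm (martingale_part t \<omega>))\<^sup>2)
     + 2 * \<alpha> * expectation (\<lambda>\<omega>. F1 (?Z \<omega>) (\<nu> t \<omega>)) + \<alpha>\<^sup>2 * expectation (\<lambda>\<omega>. F2 (?Z \<omega>) (\<nu> t \<omega>))"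
    using martingale_part_integrable(1)[of t] F1i F2i by simp
  also have "\<dots> \<le> (rate t)\<^sup>2 * expectation (\<lambda>\<omega>. (norm (martingale_part t \<omega>))\<^sup>2) + \<alpha>\<^sup>2 * expectation (\<lambda>\<omega>. noise_modulus (Y t \<omega>))"
    using mult_left_mono[OF E2, of "\<alpha>\<^sup>2"] by (simp add: E1)
  finally show ?thesis by (simp add: \<alpha>_def)
qed

lemma martingale_part_negligible:
  "(\<lambda>t. sqrt (real t + 1) * expectation (\<lambda>\<omega>. norm (martingale_part t \<omega>))) \<longlonglongrightarrow> 0"
proof -
  define m where "m t = expectation (\<lambda>\<omega>. (norm (martingale_part t \<omega>))\<^sup>2)" for t
  have m0: "0 \<le> m t" for t by (simp add: m_def)
  obtain c where c: "real 2 / 2 < c" "\<forall>\<^sub>F t in sequentially. rate t ^ 2 \<le> 1 - c / (real t + 1)"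
    by (rule rate_power_eventually[of 2]) simp
  have "(\<lambda>t. (real t + 1) powr 1 * m t) \<longlonglongrightarrow> 0"
  proof (rule chung_tendsto_0[where c=c])
    show "(\<lambda>t. a\<^sup>2 * expectation (\<lambda>\<omega>. noise_modulus (Y t \<omega>))) \<longlonglongrightarrow> 0"
      using tendsto_mult_left[OF expectation_noise_modulus_tendsto, of "a\<^sup>2"] by simp
    show "\<forall>\<^sub>F t in sequentially. m (Suc t) \<le> (1 - c / (real t + 1)) * m t
        + a\<^sup>2 * expectation (\<lambda>\<omega>. noise_modulus (Y t \<omega>)) * (real t + 1) powr (- 1 - 1)"
      using c(2)
    proof eventually_elim
      case (elim t)
      have "m (Suc t) \<le> (rate t)\<^sup>2 * m t + (a / (real t + 1))\<^sup>2 * expectation (\<lambda>\<omega>. noise_modulus (Y t \<omega>))"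
        unfolding m_def by (rule martingale_part_step)
      also have "(rate t)\<^sup>2 * m t \<le> (1 - c / (real t + 1)) * m t" using elim m0 by (intro mult_right_mono)
      finally show ?case by (simp add: power_divide powr_minus_divide powr_numeral)
    qed
  qed (use c m0 in auto)
  then have "(\<lambda>t. sqrt ((real t + 1) * m t)) \<longlonglongrightarrow> sqrt 0" by (intro tendsto_real_sqrt) simp
  then have lim: "(\<lambda>t. sqrt ((real t + 1) * m t)) \<longlonglongrightarrow> 0" by simp
  show ?thesis
  proof (rule tendsto_sandwich[OF _ _ tendsto_const lim])
    show "\<forall>\<^sub>F t in sequentially. 0 \<le> sqrt (real t + 1) * expectation (\<lambda>\<omega>. norm (martingale_part t \<omega>))"
      by simp
    show "\<forall>\<^sub>F t in sequentially. sqrt (real t + 1) * expectation (\<lambda>\<omega>. norm (martingale_part t \<omega>)) \<le> sqrt ((real t + 1) * m t)"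
    proof (intro always_eventually allI)
      fix t
      have "(expectation (\<lambda>\<omega>. norm (martingale_part t \<omega>)))\<^sup>2 \<le> m t"
        using variance_eq[OF martingale_part_integrable(2,1)] variance_positive[of "\<lambda>\<omega>. norm (martingale_part t \<omega>)"]
        by (simp add: m_def)
      then have "expectation (\<lambda>\<omega>. norm (martingale_part t \<omega>)) \<le> sqrt (m t)" by (rule real_le_rsqrt)
      then show "sqrt (real t + 1) * expectation (\<lambda>\<omega>. norm (martingale_part t \<omega>)) \<le> sqrt ((real t + 1) * m t)"
        by (simp add: real_sqrt_mult)
    qed
  qed
qed

text \<open>
  The quadratic term covers the region away from \<open>0\<close>, where the remainder grows linearly. In
  this form the bound can be integrated using second moments only.
\<close>
lemma remainder_bound:
  assumes "0 < e"
  obtains K where "0 \<le> K" "\<And>y. norm (remainder y) \<le> e * norm y + K * (norm y)\<^sup>2"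
proof -
  have "((\<lambda>y. (mean_field y - mean_field 0 - B (y - 0)) /\<^sub>R norm (y - 0)) \<longlongrightarrow> 0) (at 0)"
    using mean_field_derivative by (simp add: has_derivative_at_within)
  from tendstoD[OF this assms] obtain d where d: "0 < d"
    "\<And>y. y \<noteq> 0 \<Longrightarrow> norm y < d \<Longrightarrow> norm ((mean_field y - mean_field 0 - B (y - 0)) /\<^sub>R norm (y - 0)) < e"
    by (auto simp: eventually_at)
  obtain L where L: "\<And>v. norm (B v) \<le> norm v * L" "0 \<le> L"
    using bounded_linear.nonneg_bounded[OF B_bounded_linear] by blast
  define K where "K = (C / d + L) / d"
  have K: "0 \<le> K" using d L C_nonneg by (simp add: K_def)
  have "norm (remainder y) \<le> e * norm y + K * (norm y)\<^sup>2" for y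
  proof (cases "norm y < d")
    case True
    have "norm (remainder y) \<le> e * norm y"
    proof (cases "y = 0")
      case True
      then show ?thesis by (simp add: remainder_def mean_field_0 linear_0[OF B_linear])
    next
      case False
      have "norm (mean_field y - B y) / norm y < e"
        using d(2)[OF False True] by (simp add: mean_field_0 divide_inverse mult.commute)
      then show ?thesis using False by (simp add: remainder_def pos_divide_less_eq)
    qed
    then show ?thesis using K by (simp add: add_increasing2)
  next
    case False
    then have y: "d \<le> norm y" by simp
    have "norm (remainder y) \<le> norm (mean_field y) + norm (B y)"
      unfolding remainder_def by (rule norm_triangle_ineq4)
    also have "\<dots> \<le> C + norm y * L" using mean_field_bound L by (intro add_mono) auto
    also have "C \<le> C / d * norm y" using y d C_nonneg by (simp add: field_simps mult_left_mono)
    also have "C / d * norm y + norm y * L = (C / d + L) * norm y" by (simp add: algebra_simps)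
    also have "\<dots> \<le> (C / d + L) * (norm y / d * norm y)"
    proof (rule mult_left_mono)
      have "d * norm y \<le> norm y * norm y" using y by (rule mult_right_mono) simp
      then show "norm y \<le> norm y / d * norm y" using d(1) by (simp add: field_simps)
    qed (use d L C_nonneg in auto)
    also have "\<dots> = K * (norm y)\<^sup>2" by (simp add: K_def power2_eq_square)
    finally show ?thesis using assms by (simp add: add_increasing)
  qed
  with K show ?thesis using that by blast
qed

lemma remainder_measurable [measurable]: "remainder \<in> borel_measurable borel"
  unfolding remainder_def by measurable

lemma integrable_remainder: "integrable M (\<lambda>\<omega>. norm (remainder (Y t \<omega>)))"
proof -
  obtain K where K: "0 \<le> K" "\<And>y. norm (remainder y) \<le> 1 * norm y + K * (norm y)\<^sup>2"
    using remainder_bound[of 1] by auto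
  show ?thesis
  proof (rule integrable_Y[where K="growth t + K * (growth t)\<^sup>2"])
    fix y :: 'a assume "norm y \<le> growth t"
    then have "1 * norm y + K * (norm y)\<^sup>2 \<le> growth t + K * (growth t)\<^sup>2"
      using K(1) by (auto intro!: add_mono mult_left_mono power_mono)
    with K(2)[of y] show "norm (norm (remainder y)) \<le> growth t + K * (growth t)\<^sup>2" by simp
  qed simp
qed

lemma remainder_negligible:
  "(\<lambda>t. sqrt (real t + 1) * expectation (\<lambda>\<omega>. norm (remainder (Y t \<omega>)))) \<longlonglongrightarrow> 0"
proof (rule tendstoI)
  fix e :: real assume e: "0 < e"
  obtain K where K: "0 \<le> K" "\<And>t. (real t + 1) * expectation (\<lambda>\<omega>. (norm (Y t \<omega>))\<^sup>2) \<le> K"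
    using second_moment[OF drift \<delta>_pos \<beta>] by blast
  define d where "d = e / (2 * (sqrt K + 1))"
  have d: "0 < d" using e K by (simp add: d_def add_nonneg_pos)
  have dK: "d * sqrt K < e / 2"
  proof -
    have "d * sqrt K < d * (sqrt K + 1)" using d by simp
    also have "\<dots> = e / 2" using K(1) by (simp add: d_def field_simps add_nonneg_eq_0_iff)
    finally show ?thesis .
  qed
  obtain L where L: "0 \<le> L" "\<And>y. norm (remainder y) \<le> d * norm y + L * (norm y)\<^sup>2"
    using remainder_bound[OF d] by blast
  have le: "sqrt (real t + 1) * expectation (\<lambda>\<omega>. norm (remainder (Y t \<omega>))) \<le> d * sqrt K + L * K / sqrt (real t + 1)" for t
  proof -
    let ?m = "expectation (\<lambda>\<omega>. (norm (Y t \<omega>))\<^sup>2)"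
    have "(expectation (\<lambda>\<omega>. norm (Y t \<omega>)))\<^sup>2 \<le> ?m"
      using variance_eq[OF integrable_norm_Y] variance_positive[of "\<lambda>\<omega>. norm (Y t \<omega>)"] by simp
    then have "expectation (\<lambda>\<omega>. norm (Y t \<omega>)) \<le> sqrt ?m" by (rule real_le_rsqrt)
    then have "sqrt (real t + 1) * expectation (\<lambda>\<omega>. norm (Y t \<omega>)) \<le> sqrt ((real t + 1) * ?m)"
      by (simp add: real_sqrt_mult)
    also have "\<dots> \<le> sqrt K" using K(2)[of t] by simp
    finally have 1: "sqrt (real t + 1) * expectation (\<lambda>\<omega>. norm (Y t \<omega>)) \<le> sqrt K" .
    have "(real t + 1) / sqrt (real t + 1) = sqrt (real t + 1)" by (rule real_div_sqrt) simp
    then have "sqrt (real t + 1) * ?m = (real t + 1) * ?m / sqrt (real t + 1)"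
      by (metis times_divide_eq_left)
    also have "\<dots> \<le> K / sqrt (real t + 1)" using K(2)[of t] by (intro divide_right_mono) auto
    finally have 2: "sqrt (real t + 1) * ?m \<le> K / sqrt (real t + 1)" .
    have "expectation (\<lambda>\<omega>. norm (remainder (Y t \<omega>))) \<le> expectation (\<lambda>\<omega>. d * norm (Y t \<omega>) + L * (norm (Y t \<omega>))\<^sup>2)"
      by (intro integral_mono integrable_remainder L(2)) (use integrable_norm_Y in auto)
    also have "\<dots> = d * expectation (\<lambda>\<omega>. norm (Y t \<omega>)) + L * ?m"
      using integrable_norm_Y by simp
    finally have "sqrt (real t + 1) * expectation (\<lambda>\<omega>. norm (remainder (Y t \<omega>)))
       \<le> sqrt (real t + 1) * (d * expectation (\<lambda>\<omega>. norm (Y t \<omega>)) + L * ?m)"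
      by (rule mult_left_mono) simp
    also have "\<dots> = d * (sqrt (real t + 1) * expectation (\<lambda>\<omega>. norm (Y t \<omega>))) + L * (sqrt (real t + 1) * ?m)"
      by (simp add: algebra_simps)
    also have "\<dots> \<le> d * sqrt K + L * (K / sqrt (real t + 1))"
      using 1 2 d L(1) by (intro add_mono mult_left_mono) auto
    finally show ?thesis by simp
  qed
  have "(\<lambda>t. L * K / sqrt (real t + 1)) \<longlonglongrightarrow> 0" by real_asymp
  then have "\<forall>\<^sub>F t in sequentially. L * K / sqrt (real t + 1) < e / 2"
    using e by (intro order_tendstoD) auto
  then show "\<forall>\<^sub>F t in sequentially. dist (sqrt (real t + 1) * expectation (\<lambda>\<omega>. norm (remainder (Y t \<omega>)))) 0 < e"
  proof eventually_elim
    case (elim t)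
    have "sqrt (real t + 1) * expectation (\<lambda>\<omega>. norm (remainder (Y t \<omega>))) < e / 2 + e / 2"
      by (rule le_less_trans[OF le add_strict_mono[OF dK elim]])
    then show ?case by simp
  qed
qed

lemma drift_part_Suc:
  assumes "\<omega> \<in> space M"
  shows "drift_part (Suc t) \<omega> = contraction t (drift_part t \<omega>) - (a / (real t + 1)) *\<^sub>R remainder (Y t \<omega>)"
  unfolding drift_part_def
  by (simp add: Y_Suc[OF assms] contraction_def remainder_def fluctuation_def
      linear_diff[OF B_linear] linear_add[OF B_linear] algebra_simps)

lemma drift_part_integrable: "integrable M (\<lambda>\<omega>. norm (drift_part t \<omega>))"
proof -
  obtain R where R: "\<And>\<omega>. norm (martingale_part t \<omega>) \<le> R" using martingale_part_bounded by blast
  obtain R' where R': "\<And>\<omega>. norm (linear_part t \<omega>) \<le> R'" using linear_part_bounded by blast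
  have "norm (drift_part t \<omega>) \<le> growth t + R' + R" if "\<omega> \<in> space M" for \<omega>
  proof -
    have "norm (drift_part t \<omega>) \<le> norm (Y t \<omega>) + norm (linear_part t \<omega>) + norm (martingale_part t \<omega>)"
      unfolding drift_part_def
      by (meson add_mono norm_triangle_ineq4 order_refl order_trans)
    then show ?thesis using Y_growth[OF that, of t] R[of \<omega>] R'[of \<omega>] by linarith
  qed
  then show ?thesis by (intro integrable_const_bound[where B="growth t + R' + R"]) auto
qed

text \<open>
  This part is estimated in first rather than second moment: \<open>E |Y|\<^sup>2 = O(1/t)\<close> shows that
  \<open>E |remainder (Y t)| = o(t\<^bsup>-1/2\<^esup>)\<close>, whereas its second moment would need a bound on \<open>E |Y|\<^sup>4\<close>.
\<close>
lemma drift_part_negligible: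
  "(\<lambda>t. sqrt (real t + 1) * expectation (\<lambda>\<omega>. norm (drift_part t \<omega>))) \<longlonglongrightarrow> 0"
proof -
  obtain c where c: "real 1 / 2 < c" "\<forall>\<^sub>F t in sequentially. rate t ^ 1 \<le> 1 - c / (real t + 1)"
    by (rule rate_power_eventually[of 1]) simp
  let ?r = "\<lambda>t. expectation (\<lambda>\<omega>. norm (remainder (Y t \<omega>)))"
  let ?m = "\<lambda>t. expectation (\<lambda>\<omega>. norm (drift_part t \<omega>))"
  have "(\<lambda>t. (real t + 1) powr (1/2) * ?m t) \<longlonglongrightarrow> 0"
  proof (rule chung_tendsto_0[where c=c])
    show "(\<lambda>t. a * (sqrt (real t + 1) * ?r t)) \<longlonglongrightarrow> 0"
      using tendsto_mult_left[OF remainder_negligible, of a] by simp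
    show "\<forall>\<^sub>F t in sequentially. ?m (Suc t) \<le> (1 - c / (real t + 1)) * ?m t
        + a * (sqrt (real t + 1) * ?r t) * (real t + 1) powr (- (1/2) - 1)"
      using c(2)
    proof eventually_elim
      case (elim t)
      have "?m (Suc t) \<le> expectation (\<lambda>\<omega>. rate t * norm (drift_part t \<omega>) + a / (real t + 1) * norm (remainder (Y t \<omega>)))"
      proof (rule integral_mono[OF drift_part_integrable])
        show "integrable M (\<lambda>\<omega>. rate t * norm (drift_part t \<omega>) + a / (real t + 1) * norm (remainder (Y t \<omega>)))"
          using drift_part_integrable integrable_remainder by auto
        fix \<omega> assume "\<omega> \<in> space M"
        then have "norm (drift_part (Suc t) \<omega>) \<le> norm (contraction t (drift_part t \<omega>)) + norm ((a / (real t + 1)) *\<^sub>R remainder (Y t \<omega>))"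
          unfolding drift_part_Suc[OF \<open>\<omega> \<in> space M\<close>] by (intro norm_triangle_ineq4)
        also have "\<dots> \<le> rate t * norm (drift_part t \<omega>) + a / (real t + 1) * norm (remainder (Y t \<omega>))"
          using contraction_rate a_pos by (intro add_mono) auto
        finally show "norm (drift_part (Suc t) \<omega>) \<le> rate t * norm (drift_part t \<omega>) + a / (real t + 1) * norm (remainder (Y t \<omega>))" .
      qed
      also have "\<dots> = rate t * ?m t + a / (real t + 1) * ?r t"
        using drift_part_integrable integrable_remainder by simp
      also have "rate t * ?m t \<le> (1 - c / (real t + 1)) * ?m t"
        using elim by (intro mult_right_mono) auto
      also have "a / (real t + 1) * ?r t = a * (sqrt (real t + 1) * ?r t) * (real t + 1) powr (- (1/2) - 1)"
      proof -
        have "sqrt (real t + 1) * (real t + 1) powr (- (1/2) - 1) = 1 / (real t + 1)"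
        proof -
          have "(real t + 1) powr (1 / 2) * (real t + 1) powr (- (1/2) - 1) = (real t + 1) powr (- 1)"
            by (simp only: powr_add[symmetric]) simp
          then show ?thesis by (simp add: powr_half_sqrt powr_minus_divide)
        qed
        then have "a * ?r t * (sqrt (real t + 1) * (real t + 1) powr (- (1/2) - 1)) = a * ?r t * (1 / (real t + 1))"
          by (rule arg_cong)
        then show ?thesis by (simp only: mult_ac times_divide_eq_right times_divide_eq_left mult_1_right)
      qed
      finally show ?case by simp
    qed
  qed (use c in auto)
  then show ?thesis by (simp add: powr_half_sqrt)
qed

lemma linearisation_error:
  "(\<lambda>t. sqrt (real t + 1) * expectation (\<lambda>\<omega>. norm (Y t \<omega> - linear_part t \<omega>))) \<longlonglongrightarrow> 0"
proof (rule tendsto_sandwich[OF _ _ tendsto_const])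
  show "(\<lambda>t. sqrt (real t + 1) * expectation (\<lambda>\<omega>. norm (drift_part t \<omega>))
       + sqrt (real t + 1) * expectation (\<lambda>\<omega>. norm (martingale_part t \<omega>))) \<longlonglongrightarrow> 0"
    using tendsto_add[OF drift_part_negligible martingale_part_negligible] by simp
  show "\<forall>\<^sub>F t in sequentially. sqrt (real t + 1) * expectation (\<lambda>\<omega>. norm (Y t \<omega> - linear_part t \<omega>))
     \<le> sqrt (real t + 1) * expectation (\<lambda>\<omega>. norm (drift_part t \<omega>)) + sqrt (real t + 1) * expectation (\<lambda>\<omega>. norm (martingale_part t \<omega>))"
  proof (intro always_eventually allI)
    fix t
    have le: "norm (Y t \<omega> - linear_part t \<omega>) \<le> norm (drift_part t \<omega>) + norm (martingale_part t \<omega>)" for \<omega>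
      using norm_triangle_ineq[of "drift_part t \<omega>" "martingale_part t \<omega>"] by (simp add: drift_part_def)
    have int: "integrable M (\<lambda>\<omega>. norm (drift_part t \<omega>) + norm (martingale_part t \<omega>))"
      using drift_part_integrable martingale_part_integrable(2) by auto
    have "expectation (\<lambda>\<omega>. norm (Y t \<omega> - linear_part t \<omega>)) \<le> expectation (\<lambda>\<omega>. norm (drift_part t \<omega>) + norm (martingale_part t \<omega>))"
      by (rule integral_mono[OF Bochner_Integration.integrable_bound[OF int] int le]) (use le in auto)
    also have "\<dots> = expectation (\<lambda>\<omega>. norm (drift_part t \<omega>)) + expectation (\<lambda>\<omega>. norm (martingale_part t \<omega>))"
      using drift_part_integrable martingale_part_integrable(2) by simp
    finally show "sqrt (real t + 1) * expectation (\<lambda>\<omega>. norm (Y t \<omega> - linear_part t \<omega>))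
     \<le> sqrt (real t + 1) * expectation (\<lambda>\<omega>. norm (drift_part t \<omega>)) + sqrt (real t + 1) * expectation (\<lambda>\<omega>. norm (martingale_part t \<omega>))"
      by (simp add: distrib_left[symmetric])
  qed
qed simp

end

section \<open>Weak convergence from characteristic functions\<close>

text \<open>
  The span of the characters \<open>cis (u \<bullet> x)\<close>, on which convergence of integrals is immediate from
  convergence of characteristic functions.
\<close>
inductive trig_polynomial :: "('a::real_inner \<Rightarrow> complex) \<Rightarrow> bool" where
  wave: "trig_polynomial (\<lambda>x. cis (u \<bullet> x))"
| scale: "trig_polynomial f \<Longrightarrow> trig_polynomial (\<lambda>x. c * f x)"
| add: "trig_polynomial f \<Longrightarrow> trig_polynomial g \<Longrightarrow> trig_polynomial (\<lambda>x. f x + g x)"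

lemma trig_polynomial_const: "trig_polynomial (\<lambda>x. c)"
  using trig_polynomial.scale[OF trig_polynomial.wave[of 0], of c] by simp

lemma trig_polynomial_mult:
  assumes "trig_polynomial f" "trig_polynomial g"
  shows "trig_polynomial (\<lambda>x. f x * g x)"
  using assms(1)
proof induction
  case (wave u)
  show ?case using assms(2)
  proof induction
    case (wave v)
    then show ?case using trig_polynomial.wave[of "u + v"] by (simp add: cis_mult inner_add_left)
  next
    case (scale f c)
    then show ?case using trig_polynomial.scale[of "\<lambda>x. cis (u \<bullet> x) * f x" c] by (simp add: mult_ac)
  next
    case (add f g)
    then show ?case using trig_polynomial.add[of "\<lambda>x. cis (u \<bullet> x) * f x" "\<lambda>x. cis (u \<bullet> x) * g x"]
      by (simp add: algebra_simps)
  qed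
next
  case (scale f c)
  then show ?case using trig_polynomial.scale[of "\<lambda>x. f x * g x" c] by (simp add: mult_ac)
next
  case (add f f')
  then show ?case using trig_polynomial.add[of "\<lambda>x. f x * g x" "\<lambda>x. f' x * g x"]
    by (simp add: algebra_simps)
qed

lemma trig_polynomial_sum:
  "finite I \<Longrightarrow> (\<And>i. i \<in> I \<Longrightarrow> trig_polynomial (f i)) \<Longrightarrow> trig_polynomial (\<lambda>x. \<Sum>i\<in>I. f i x)"
proof (induction I rule: finite_induct)
  case empty
  then show ?case by (simp add: trig_polynomial_const)
next
  case (insert i I)
  then show ?case using trig_polynomial.add[of "f i" "\<lambda>x. \<Sum>i\<in>I. f i x"] by simp
qed

lemma trig_polynomial_sin: "trig_polynomial (\<lambda>x. complex_of_real (sin (u \<bullet> x)))"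
proof -
  have "complex_of_real (sin y) = (- \<i> / 2) * cis y + (\<i> / 2) * cis (- y)" for y
    by (simp add: complex_eq_iff)
  then have "(\<lambda>x. complex_of_real (sin (u \<bullet> x))) = (\<lambda>x. (- \<i> / 2) * cis (u \<bullet> x) + (\<i> / 2) * cis ((- u) \<bullet> x))"
    by (simp add: fun_eq_iff)
  then show ?thesis
    using trig_polynomial.add[OF trig_polynomial.scale[OF trig_polynomial.wave[of u], of "- \<i> / 2"]
        trig_polynomial.scale[OF trig_polynomial.wave[of "-u"], of "\<i> / 2"]] by simp
qed

text \<open>
  Trigonometric polynomials form an algebra, so a real polynomial in trigonometric coordinates is
  one of them.
\<close>
lemma trig_polynomial_of_real_polynomial:
  fixes \<tau> :: "'a::real_inner \<Rightarrow> 'b::euclidean_space"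
  assumes "real_polynomial_function p"
    and \<tau>: "\<And>i. i \<in> Basis \<Longrightarrow> trig_polynomial (\<lambda>x. complex_of_real (\<tau> x \<bullet> i))"
  shows "trig_polynomial (\<lambda>x. complex_of_real (p (\<tau> x)))"
  using assms(1)
proof induction
  case (linear f)
  have "f (\<tau> x) = (\<Sum>i\<in>Basis. f i * (\<tau> x \<bullet> i))" for x
  proof -
    have "f (\<tau> x) = f (\<Sum>i\<in>Basis. (\<tau> x \<bullet> i) *\<^sub>R i)" by (simp add: euclidean_representation)
    also have "\<dots> = (\<Sum>i\<in>Basis. f i * (\<tau> x \<bullet> i))"
      using linear by (simp add: linear_sum[OF bounded_linear.linear] linear_cmul[OF bounded_linear.linear] mult.commute)
    finally show ?thesis .
  qed
  then have eq: "(\<lambda>x. complex_of_real (f (\<tau> x))) = (\<lambda>x. \<Sum>i\<in>Basis. complex_of_real (f i) * complex_of_real (\<tau> x \<bullet> i))"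
    by (simp add: fun_eq_iff)
  show ?case unfolding eq
    by (intro trig_polynomial_sum trig_polynomial.scale \<tau>) auto
next
  case (const c)
  then show ?case by (rule trig_polynomial_const)
next
  case (add f g)
  then show ?case using trig_polynomial.add by fastforce
next
  case (mult f g)
  then show ?case using trig_polynomial_mult by fastforce
qed

lemma trig_polynomial_bounded_measurable:
  fixes f :: "'a::euclidean_space \<Rightarrow> complex"
  assumes "trig_polynomial f"
  shows "f \<in> borel_measurable borel \<and> (\<exists>K. \<forall>x. norm (f x) \<le> K)"
  using assms
proof induction
  case (wave u)
  have "continuous_on UNIV (\<lambda>x. cis (u \<bullet> x))" by (intro continuous_intros)
  then show ?case by (auto intro: borel_measurable_continuous_onI)
next
  case (scale f c)
  then obtain K where "\<And>x. norm (f x) \<le> K" by blast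
  then have "\<And>x. norm (c * f x) \<le> norm c * K" by (simp add: norm_mult mult_left_mono)
  then show ?case using scale by auto
next
  case (add f g)
  then obtain K K' where "\<And>x. norm (f x) \<le> K" "\<And>x. norm (g x) \<le> K'" by blast
  then have "\<And>x. norm (f x + g x) \<le> K + K'" by (meson add_mono norm_triangle_ineq order_trans)
  then show ?case using add by auto
qed

lemma trig_polynomial_integrable:
  fixes f :: "'a::euclidean_space \<Rightarrow> complex"
  assumes "trig_polynomial f" "prob_space \<mu>" "sets \<mu> = sets borel"
  shows "integrable \<mu> f"
proof -
  interpret prob_space \<mu> by fact
  from trig_polynomial_bounded_measurable[OF assms(1)] obtain K where
    "f \<in> borel_measurable borel" "\<And>x. norm (f x) \<le> K" by blast
  then show ?thesis using assms(3)
    by (intro integrable_const_bound[where B=K]) (simp_all add: measurable_cong_sets[OF assms(3) refl])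
qed

lemma trig_polynomial_integral_tendsto:
  fixes f :: "'a::euclidean_space \<Rightarrow> complex"
  assumes "trig_polynomial f"
    and \<mu>: "\<And>t. prob_space (\<mu> t)" "\<And>t. sets (\<mu> t) = sets borel"
    and \<nu>: "prob_space \<nu>" "sets \<nu> = sets borel"
    and char: "\<And>u. (\<lambda>t. \<integral>x. cis (u \<bullet> x) \<partial>\<mu> t) \<longlonglongrightarrow> (\<integral>x. cis (u \<bullet> x) \<partial>\<nu>)"
  shows "(\<lambda>t. \<integral>x. f x \<partial>\<mu> t) \<longlonglongrightarrow> (\<integral>x. f x \<partial>\<nu>)"
  using assms(1)
proof induction
  case (wave u)
  then show ?case by (rule char)
next
  case (scale f c)
  then show ?case using tendsto_mult_left[OF scale.IH, of c] by simp
next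
  case (add f g)
  have "integrable (\<mu> t) f" "integrable (\<mu> t) g" "integrable \<nu> f" "integrable \<nu> g" for t
    using add \<mu> \<nu> by (auto intro: trig_polynomial_integrable)
  then have "(\<integral>x. f x + g x \<partial>\<mu> t) = (\<integral>x. f x \<partial>\<mu> t) + (\<integral>x. g x \<partial>\<mu> t)"
    "(\<integral>x. f x + g x \<partial>\<nu>) = (\<integral>x. f x \<partial>\<nu>) + (\<integral>x. g x \<partial>\<nu>)" for t
    by simp_all
  then show ?case using tendsto_add[OF add.IH] by simp
qed

text \<open>
  Two bounded functions that agree up to \<open>e\<close> off an unlikely event have close integrals. This
  localises the approximation below to a ball.
\<close>
lemma (in prob_space) integral_close_off_set:
  fixes f g :: "'a \<Rightarrow> real"
  assumes [measurable]: "f \<in> borel_measurable M" "g \<in> borel_measurable M" "A \<in> sets M"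
    and A: "prob A \<le> \<delta>" and f: "\<And>x. \<bar>f x\<bar> \<le> K" and g: "\<And>x. \<bar>g x\<bar> \<le> K"
    and close: "\<And>x. x \<in> space M \<Longrightarrow> x \<notin> A \<Longrightarrow> \<bar>f x - g x\<bar> \<le> e"
    and K: "0 \<le> K" "0 \<le> e"
  shows "\<bar>expectation f - expectation g\<bar> \<le> e + 2 * K * \<delta>"
proof -
  have [simp]: "integrable M f" "integrable M g"
    using f g by (auto intro: integrable_const_bound[where B=K])
  have [simp]: "integrable M (indicat_real A)" by (intro integrable_const_bound[where B=1]) auto
  have "\<bar>expectation f - expectation g\<bar> = \<bar>expectation (\<lambda>x. f x - g x)\<bar>" by simp
  also have "\<dots> \<le> expectation (\<lambda>x. \<bar>f x - g x\<bar>)" by (rule integral_abs_bound)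
  also have "\<dots> \<le> expectation (\<lambda>x. e + 2 * K * indicator A x)"
  proof (rule integral_mono)
    fix x assume "x \<in> space M"
    then show "\<bar>f x - g x\<bar> \<le> e + 2 * K * indicator A x"
      using close[of x] f[of x] g[of x] K by (auto simp: indicator_def)
  qed (auto intro!: integrable_const_bound[where B="e + 2 * K"] simp: indicator_def K)
  also have "\<dots> = e + 2 * K * prob A"
    by (subst Bochner_Integration.integral_add) (auto simp: prob_space)
  also have "\<dots> \<le> e + 2 * K * \<delta>" using A K by (simp add: mult_left_mono)
  finally show ?thesis .
qed

text \<open>
  A bounded continuous \<open>f\<close> cannot be approximated uniformly by trigonometric polynomials on the whole
  space. Let \<open>\<tau> x\<close> have coordinates \<open>sin (x \<bullet> i / R)\<close> and \<open>\<rho>\<close> be its inverse by \<open>arcsin\<close>. Then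
  \<open>f (\<rho> (\<tau> x))\<close> equals \<open>f x\<close> for \<open>|x| < R\<close>, is bounded by the same constant, and depends on \<open>x\<close> only
  through the point \<open>\<tau> x\<close> of a compact cube; there \<open>f \<circ> \<rho>\<close> is uniformly close to a polynomial \<open>p\<close>,
  and \<open>p \<circ> \<tau>\<close> is a trigonometric polynomial. Tightness takes care of \<open>|x| \<ge> R\<close>.
\<close>
theorem weakly_converges_characteristic:
  fixes \<mu> :: "nat \<Rightarrow> 'a::euclidean_space measure"
  assumes \<mu>: "\<And>t. prob_space (\<mu> t)" "\<And>t. sets (\<mu> t) = sets borel"
    and \<nu>: "prob_space \<nu>" "sets \<nu> = sets borel"
    and char: "\<And>u. (\<lambda>t. \<integral>x. cis (u \<bullet> x) \<partial>\<mu> t) \<longlonglongrightarrow> (\<integral>x. cis (u \<bullet> x) \<partial>\<nu>)"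
    and tight: "\<And>e. 0 < e \<Longrightarrow> \<exists>R. \<forall>t. measure (\<mu> t) {x. R \<le> norm x} \<le> e"
  shows "weakly_converges \<mu> \<nu>"
  unfolding weakly_converges_def
proof (intro allI impI, elim conjE)
  fix f :: "'a \<Rightarrow> real"
  assume cont: "continuous_on UNIV f" and bnd: "bounded (range f)"
  interpret \<nu>: prob_space \<nu> by fact
  obtain K where K: "\<And>x. \<bar>f x\<bar> \<le> K" "0 \<le> K"
    using bnd by (auto simp: bounded_iff) (meson abs_ge_zero order_trans)
  note [measurable_cong] = \<mu>(2) \<nu>(2)
  have fm[measurable]: "f \<in> borel_measurable borel" using cont by (rule borel_measurable_continuous_onI)
  show "(\<lambda>t. \<integral>x. f x \<partial>\<mu> t) \<longlonglongrightarrow> (\<integral>x. f x \<partial>\<nu>)"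
  proof (rule tendstoI)
    fix \<epsilon> :: real assume \<epsilon>: "0 < \<epsilon>"
    \<comment> \<open>the total error is \<open>2 (e + 2 (K + e) e) + e \<le> (4 K + 7) e\<close>\<close>
    define e where "e = min 1 (\<epsilon> / (8 * (K + 1)))"
    have e: "0 < e" "e \<le> 1" using \<epsilon> K(2) by (auto simp: e_def)
    have "e \<le> \<epsilon> / (8 * (K + 1))" by (simp add: e_def)
    then have eK: "e * (8 * (K + 1)) \<le> \<epsilon>" using K(2) by (simp add: field_simps)
    obtain R1 where R1: "\<And>t. measure (\<mu> t) {x. R1 \<le> norm x} \<le> e" using tight[OF e(1)] by blast
    obtain R2 where R2: "measure \<nu> {x. R2 \<le> norm x} \<le> e"
    proof -
      have "(\<lambda>n. measure \<nu> {x. real n \<le> norm x}) \<longlonglongrightarrow> measure \<nu> (\<Inter>n. {x. real n \<le> norm x})"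
        by (rule \<nu>.finite_Lim_measure_decseq) (auto simp: decseq_def)
      also have "(\<Inter>n. {x::'a. real n \<le> norm x}) = {}"
      proof -
        have "\<exists>n. norm x < real n" for x :: 'a by (rule reals_Archimedean2)
        then show ?thesis by (simp add: set_eq_iff not_le)
      qed
      finally have "\<forall>\<^sub>F n in sequentially. measure \<nu> {x. real n \<le> norm x} < e"
        using e(1) by (intro order_tendstoD(2)) auto
      then show ?thesis using that by (auto simp: eventually_sequentially intro: less_imp_le)
    qed
    define R where "R = max 1 (max R1 R2)"
    have R: "0 < R" "R1 \<le> R" "R2 \<le> R" by (auto simp: R_def)
    have m1: "measure (\<mu> t) {x. R \<le> norm x} \<le> e" for t
    proof -
      interpret prob_space "\<mu> t" by (rule \<mu>)
      have "measure (\<mu> t) {x. R \<le> norm x} \<le> measure (\<mu> t) {x. R1 \<le> norm x}"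
        using R by (intro finite_measure_mono) auto
      then show ?thesis using R1[of t] by simp
    qed
    have m2: "measure \<nu> {x. R \<le> norm x} \<le> e"
    proof -
      have "measure \<nu> {x. R \<le> norm x} \<le> measure \<nu> {x. R2 \<le> norm x}"
        using R by (intro \<nu>.finite_measure_mono) auto
      then show ?thesis using R2 by simp
    qed
    define \<tau> :: "'a \<Rightarrow> 'a" where "\<tau> x = (\<Sum>i\<in>Basis. sin (x \<bullet> i / R) *\<^sub>R i)" for x
    define \<rho> :: "'a \<Rightarrow> 'a" where "\<rho> z = (\<Sum>i\<in>Basis. (R * arcsin (z \<bullet> i)) *\<^sub>R i)" for z
    have tb: "\<tau> x \<in> cbox (- One) One" for x
      by (auto simp: \<tau>_def mem_box inner_sum_left inner_Basis if_distrib cong: if_cong)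
    have ct: "continuous_on (cbox (- One) One) (\<lambda>z. f (\<rho> z))"
      unfolding \<rho>_def
      by (rule continuous_on_compose2[OF cont])
        (auto intro!: continuous_intros simp: mem_box)
    obtain p where p: "real_polynomial_function p" "\<And>z. z \<in> cbox (- One) One \<Longrightarrow> \<bar>f (\<rho> z) - p z\<bar> < e"
      using Stone_Weierstrass_real_polynomial_function[OF compact_cbox ct e(1)] by blast
    have \<rho>\<tau>: "\<rho> (\<tau> x) = x" if "norm x < R" for x
    proof (rule euclidean_eqI)
      fix i :: 'a assume i: "i \<in> Basis"
      have "\<bar>x \<bullet> i / R\<bar> < 1" using Basis_le_norm[OF i, of x] that R by (simp add: field_simps)
      then have "- (pi / 2) \<le> x \<bullet> i / R" "x \<bullet> i / R \<le> pi / 2" using pi_ge_two by linarith+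
      then have "arcsin (sin (x \<bullet> i / R)) = x \<bullet> i / R" by (intro arcsin_sin)
      then show "\<rho> (\<tau> x) \<bullet> i = x \<bullet> i"
        using i R by (simp add: \<rho>_def \<tau>_def inner_sum_left inner_Basis if_distrib cong: if_cong)
    qed
    have P: "trig_polynomial (\<lambda>x. complex_of_real (p (\<tau> x)))"
    proof (rule trig_polynomial_of_real_polynomial[OF p(1)])
      fix i :: 'a assume i: "i \<in> Basis"
      have "\<tau> x \<bullet> i = sin ((i /\<^sub>R R) \<bullet> x)" for x
      proof -
        have "\<tau> x \<bullet> i = sin (x \<bullet> i / R)"
          using i by (simp add: \<tau>_def inner_sum_left inner_Basis if_distrib cong: if_cong)
        then show ?thesis by (simp add: inner_commute divide_inverse mult.commute)
      qed
      then show "trig_polynomial (\<lambda>x. complex_of_real (\<tau> x \<bullet> i))"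
        by (simp add: trig_polynomial_sin del: inner_scaleR_left)
    qed
    have "(\<lambda>t. Re (\<integral>x. complex_of_real (p (\<tau> x)) \<partial>\<mu> t)) \<longlonglongrightarrow> Re (\<integral>x. complex_of_real (p (\<tau> x)) \<partial>\<nu>)"
      by (intro tendsto_Re trig_polynomial_integral_tendsto[OF P \<mu> \<nu> char])
    then have lim: "(\<lambda>t. \<integral>x. p (\<tau> x) \<partial>\<mu> t) \<longlonglongrightarrow> (\<integral>x. p (\<tau> x) \<partial>\<nu>)"
      by (simp add: integral_complex_of_real)
    have pm[measurable]: "(\<lambda>x. p (\<tau> x)) \<in> borel_measurable borel"
    proof -
      from trig_polynomial_bounded_measurable[OF P]
      have "(\<lambda>x. complex_of_real (p (\<tau> x))) \<in> borel_measurable borel" by (rule conjunct1)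
      then show ?thesis by (simp add: borel_measurable_complex_iff)
    qed
    have pK: "\<bar>p (\<tau> x)\<bar> \<le> K + e" for x using p(2)[OF tb[of x]] K(1)[of "\<rho> (\<tau> x)"] by linarith
    have fK: "\<bar>f x\<bar> \<le> K + e" for x using K(1)[of x] e by linarith
    have app: "\<bar>(\<integral>x. f x \<partial>\<mu>') - (\<integral>x. p (\<tau> x) \<partial>\<mu>')\<bar> \<le> e + 2 * (K + e) * e"
      if "prob_space \<mu>'" and [measurable_cong]: "sets \<mu>' = sets borel" and "measure \<mu>' {x. R \<le> norm x} \<le> e" for \<mu>'
    proof -
      interpret m: prob_space \<mu>' by fact
      show ?thesis
      proof (rule m.integral_close_off_set[where A="{x. R \<le> norm x}"])
        show "{x. R \<le> norm x} \<in> sets \<mu>'" unfolding that(2) by simp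
        show "\<bar>f x - p (\<tau> x)\<bar> \<le> e" if "x \<notin> {x. R \<le> norm x}" for x
          using p(2)[OF tb[of x]] \<rho>\<tau>[of x] that by simp
      qed (use that fK pK e K in auto)
    qed
    have "e * e \<le> e" using e by (simp add: mult_left_le)
    have "2 * (e + 2 * (K + e) * e) + e = 3 * e + 4 * (K * e) + 4 * (e * e)"
      by (simp add: algebra_simps)
    also have "\<dots> < 8 * (K * e) + 8 * e"
      using \<open>e * e \<le> e\<close> e(1) mult_nonneg_nonneg[OF K(2) less_imp_le[OF e(1)]] by linarith
    also have "\<dots> = e * (8 * (K + 1))" by (simp add: algebra_simps)
    also have "\<dots> \<le> \<epsilon>" by (rule eK)
    finally have small: "2 * (e + 2 * (K + e) * e) + e < \<epsilon>" .
    have "\<forall>\<^sub>F t in sequentially. \<bar>(\<integral>x. p (\<tau> x) \<partial>\<mu> t) - (\<integral>x. p (\<tau> x) \<partial>\<nu>)\<bar> < e"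
      using tendstoD[OF lim e(1)] by (simp add: dist_real_def)
    then show "\<forall>\<^sub>F t in sequentially. dist (\<integral>x. f x \<partial>\<mu> t) (\<integral>x. f x \<partial>\<nu>) < \<epsilon>"
    proof eventually_elim
      case (elim t)
      show ?case
        using elim app[OF \<mu>(1) \<mu>(2) m1[of t]] app[OF \<nu> m2] small by (simp add: dist_real_def)
    qed
  qed
qed

section \<open>Gaussian laws with prescribed covariance\<close>

lemma psd_cauchy_schwarz:
  fixes S :: "'a::real_inner \<Rightarrow> 'a"
  assumes lin: "linear S" and sym: "\<And>x y. x \<bullet> S y = S x \<bullet> y" and psd: "\<And>x. 0 \<le> x \<bullet> S x"
  shows "(x \<bullet> S y)\<^sup>2 \<le> (x \<bullet> S x) * (y \<bullet> S y)"
proof -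
  have sc: "S (c *\<^sub>R x) = c *\<^sub>R S x" for c x by (rule linear_cmul[OF lin])
  have ad: "S (x + y) = S x + S y" for x y by (rule linear_add[OF lin])
  have yx: "y \<bullet> S x = x \<bullet> S y" by (metis sym inner_commute)
  have q: "0 \<le> x \<bullet> S x + 2 * c * (x \<bullet> S y) + c\<^sup>2 * (y \<bullet> S y)" for c
    using psd[of "x + c *\<^sub>R y"] yx
    by (simp add: ad sc inner_add_left inner_add_right power2_eq_square algebra_simps)
  show ?thesis
  proof (cases "y \<bullet> S y = 0")
    case False
    then have "0 < y \<bullet> S y" using psd[of y] by simp
    then show ?thesis using q[of "- (x \<bullet> S y) / (y \<bullet> S y)"]
      by (simp add: field_simps power2_eq_square)
  next
    case True
    have "x \<bullet> S y = 0"
    proof (rule ccontr)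
      assume n: "x \<bullet> S y \<noteq> 0"
      define c where "c = - (x \<bullet> S x + 1) / (2 * (x \<bullet> S y))"
      have "2 * c * (x \<bullet> S y) = - (x \<bullet> S x + 1)" using n by (simp add: c_def)
      then show False using q[of c] True by simp
    qed
    then show ?thesis using True by simp
  qed
qed

text \<open>
  Gaussian elimination: subtracting \<open>(S k)(S k)\<^sup>T / (k \<bullet> S k)\<close> kills the basis vector \<open>k\<close>, keeps the vectors
  killed before, and preserves positivity by the Cauchy--Schwarz inequality for \<open>S\<close>.
  If \<open>k \<bullet> S k = 0\<close> then \<open>S k = 0\<close> and, as division by zero gives zero, nothing is subtracted.
\<close>
lemma psd_sum_of_squares:
  fixes S :: "'a::euclidean_space \<Rightarrow> 'a"
  assumes "finite A" "linear S" "\<And>x y. x \<bullet> S y = S x \<bullet> y" "\<And>x. 0 \<le> x \<bullet> S x"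
    and "A \<subseteq> Basis" "\<And>i. i \<in> Basis - A \<Longrightarrow> S i = 0"
  shows "\<exists>v :: 'a \<Rightarrow> 'a. \<forall>x. x \<bullet> S x = (\<Sum>i\<in>A. (x \<bullet> v i)\<^sup>2)"
  using assms
proof (induction A arbitrary: S rule: finite_induct)
  case empty
  have "S x = 0" for x
  proof -
    have "S x = S (\<Sum>i\<in>Basis. (x \<bullet> i) *\<^sub>R i)" by (simp add: euclidean_representation)
    also have "\<dots> = (\<Sum>i\<in>Basis. (x \<bullet> i) *\<^sub>R S i)"
      by (simp add: linear_sum[OF empty(1)] linear_cmul[OF empty(1)])
    also have "\<dots> = 0" using empty(5) by simp
    finally show ?thesis .
  qed
  then show ?case by simp
next
  case (insert k A)
  note lin = insert.prems(1) and sym = insert.prems(2) and psd = insert.prems(3)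
  define c where "c = k \<bullet> S k"
  have c0: "0 \<le> c" using psd by (simp add: c_def)
  have Sk: "S k = 0" if "c = 0"
  proof -
    have "(S k \<bullet> S k)\<^sup>2 \<le> (S k \<bullet> S (S k)) * (k \<bullet> S k)"
      by (rule psd_cauchy_schwarz[OF lin sym psd])
    then show ?thesis using that by (simp add: c_def)
  qed
  define w where "w = (1 / sqrt c) *\<^sub>R S k"
  define T where "T x = S x - (w \<bullet> x) *\<^sub>R w" for x
  have wx: "(w \<bullet> x)\<^sup>2 * c = (x \<bullet> S k)\<^sup>2" for x
    using c0 Sk by (cases "c = 0") (auto simp: w_def power_mult_distrib power_divide inner_commute)
  have linT: "linear T"
    unfolding T_def by (intro linearI) (auto simp: linear_add[OF lin] linear_cmul[OF lin] inner_add_right algebra_simps)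
  have "\<exists>v :: 'a \<Rightarrow> 'a. \<forall>x. x \<bullet> T x = (\<Sum>i\<in>A. (x \<bullet> v i)\<^sup>2)"
  proof (rule insert.IH[OF linT])
    show "x \<bullet> T y = T x \<bullet> y" for x y
    proof -
      have "x \<bullet> T y = x \<bullet> S y - (w \<bullet> y) * (x \<bullet> w)" by (simp add: T_def inner_diff_right)
      moreover have "T x \<bullet> y = S x \<bullet> y - (w \<bullet> x) * (w \<bullet> y)" by (simp add: T_def inner_diff_left)
      ultimately show ?thesis using sym[of x y] inner_commute[of x w] by simp
    qed
    show "0 \<le> x \<bullet> T x" for x
    proof (cases "c = 0")
      case True
      then show ?thesis using psd by (simp add: T_def w_def)
    next
      case False
      then have "0 < c" using c0 by simp
      have "(w \<bullet> x)\<^sup>2 * c \<le> (x \<bullet> S x) * c"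
        unfolding wx unfolding c_def by (rule psd_cauchy_schwarz[OF lin sym psd])
      then have "(w \<bullet> x)\<^sup>2 \<le> x \<bullet> S x" using \<open>0 < c\<close> by simp
      then show ?thesis by (simp add: T_def inner_diff_right power2_eq_square inner_commute)
    qed
    show "A \<subseteq> Basis" using insert.prems by auto
    show "T i = 0" if "i \<in> Basis - A" for i
    proof (cases "i = k")
      case True
      have "S k - (w \<bullet> k) *\<^sub>R w = 0"
      proof (cases "c = 0")
        case False
        then have "0 < c" using c0 by simp
        then show ?thesis by (simp add: w_def c_def inner_commute field_simps real_sqrt_mult_self)
      qed (use Sk in \<open>simp add: w_def\<close>)
      then show ?thesis using True by (simp add: T_def)
    next
      case False
      then have Si: "S i = 0" using insert.prems that by auto
      have "S k \<bullet> i = 0" using sym[of k i] Si by simp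
      then show ?thesis by (simp add: T_def Si w_def)
    qed
  qed
  then obtain v where v: "\<And>x. x \<bullet> T x = (\<Sum>i\<in>A. (x \<bullet> v i)\<^sup>2)" by blast
  have "x \<bullet> S x = (\<Sum>i\<in>insert k A. (x \<bullet> (v(k := w)) i)\<^sup>2)" for x
  proof -
    have "(\<Sum>i\<in>A. (x \<bullet> (v(k := w)) i)\<^sup>2) = (\<Sum>i\<in>A. (x \<bullet> v i)\<^sup>2)"
      using insert.hyps by (intro sum.cong) auto
    then have "(\<Sum>i\<in>insert k A. (x \<bullet> (v(k := w)) i)\<^sup>2) = (x \<bullet> w)\<^sup>2 + x \<bullet> T x"
      using insert.hyps by (simp add: v)
    then show ?thesis by (simp add: T_def inner_diff_right power2_eq_square inner_commute)
  qed
  then show ?case by blast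
qed

text \<open>
  The law of \<open>\<Sum>i. z i v i\<close> for independent standard normal \<open>z i\<close>, where \<open>S\<close> is the sum of the
  \<open>(v i)(v i)\<^sup>T\<close>. It exists for singular \<open>S\<close> as well.
\<close>
lemma gaussian_exists:
  fixes S :: "'a::euclidean_space \<Rightarrow> 'a"
  assumes "linear S" "\<And>x y. x \<bullet> S y = S x \<bullet> y" "\<And>x. 0 \<le> x \<bullet> S x"
  shows "\<exists>N. prob_space N \<and> sets N = sets borel \<and>
    (\<forall>u. (\<integral>x. cis (u \<bullet> x) \<partial>N) = exp (- complex_of_real (u \<bullet> S u) / 2))"
proof -
  obtain v :: "'a \<Rightarrow> 'a" where v: "\<And>x. x \<bullet> S x = (\<Sum>i\<in>Basis. (x \<bullet> v i)\<^sup>2)"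
    using psd_sum_of_squares[of Basis S] assms by auto
  interpret n: real_distribution std_normal_distribution by (rule real_dist_normal_dist)
  interpret P: product_prob_space "\<lambda>_::'a. std_normal_distribution" "Basis :: 'a set" ..
  let ?P = "Pi\<^sub>M (Basis :: 'a set) (\<lambda>_. std_normal_distribution)"
  have Pp: "prob_space ?P" by (rule P.P.prob_space_axioms)
  define f :: "('a \<Rightarrow> real) \<Rightarrow> 'a" where "f z = (\<Sum>i\<in>Basis. z i *\<^sub>R v i)" for z
  have fm[measurable]: "f \<in> borel_measurable ?P"
    unfolding f_def by measurable
  show ?thesis
  proof (intro exI conjI allI)
    show "prob_space (distr ?P borel f)" by (rule prob_space.prob_space_distr[OF Pp fm])
    show "sets (distr ?P borel f) = sets borel" by simp
    fix u :: 'a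
    have c: "continuous_on UNIV (\<lambda>x. cis (u \<bullet> x))" by (intro continuous_intros)
    have "(\<integral>x. cis (u \<bullet> x) \<partial>distr ?P borel f) = (\<integral>z. cis (u \<bullet> f z) \<partial>?P)"
      by (rule integral_distr[OF fm]) (rule borel_measurable_continuous_onI[OF c])
    also have "\<dots> = (\<integral>z. (\<Prod>i\<in>Basis. iexp ((u \<bullet> v i) * z i)) \<partial>?P)"
    proof (rule Bochner_Integration.integral_cong[OF refl])
      fix z
      have "cis (u \<bullet> f z) = iexp (\<Sum>i\<in>Basis. (u \<bullet> v i) * z i)"
        by (simp add: f_def cis_conv_exp inner_sum_right mult.commute)
      also have "\<dots> = (\<Prod>i\<in>Basis. iexp ((u \<bullet> v i) * z i))"
        by (simp add: exp_sum sum_distrib_left)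
      finally show "cis (u \<bullet> f z) = (\<Prod>i\<in>Basis. iexp ((u \<bullet> v i) * z i))" .
    qed
    also have "\<dots> = (\<Prod>i\<in>(Basis::'a set). (CLINT x|std_normal_distribution. iexp ((u \<bullet> v i) * x)))"
      by (rule P.product_integral_prod) (auto intro!: n.integrable_iexp)
    also have "\<dots> = (\<Prod>i\<in>(Basis::'a set). complex_of_real (exp (- ((u \<bullet> v i)\<^sup>2) / 2)))"
      using char_std_normal_distribution by (simp add: char_def fun_eq_iff)
    also have "\<dots> = complex_of_real (exp (\<Sum>i\<in>Basis. - ((u \<bullet> v i)\<^sup>2) / 2))"
      by (simp add: exp_sum)
    also have "(\<Sum>i\<in>Basis. - ((u \<bullet> v i)\<^sup>2) / 2) = - (u \<bullet> S u) / 2"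
      by (simp add: v sum_negf sum_divide_distrib)
    finally show "(\<integral>x. cis (u \<bullet> x) \<partial>distr ?P borel f) = exp (- complex_of_real (u \<bullet> S u) / 2)"
      by (simp add: exp_of_real[symmetric])
  qed
qed

section \<open>Asymptotic normality of the recursion\<close>

context linearised_robbins_monro
begin

definition noise_quadratic :: "'a \<Rightarrow> real" where
  "noise_quadratic u = (\<integral>v. (u \<bullet> G 0 v)\<^sup>2 \<partial>law)"

definition noise_char :: "'a \<Rightarrow> complex" where
  "noise_char u = (\<integral>v. cis (u \<bullet> G 0 v) \<partial>law)"

definition linear_char :: "nat \<Rightarrow> 'a \<Rightarrow> complex" where
  "linear_char t u = expectation (\<lambda>\<omega>. cis (u \<bullet> linear_part t \<omega>))"

text \<open>
  The variance of \<open>u \<bullet> linear_part t\<close>, computed by pushing \<open>u\<close> backwards through the contractions.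
\<close>
primrec linear_quadratic :: "nat \<Rightarrow> 'a \<Rightarrow> real" where
  "linear_quadratic 0 u = 0"
| "linear_quadratic (Suc t) u = linear_quadratic t (contraction t u)
     + (a / (real t + 1))\<^sup>2 * noise_quadratic u"

lemma inner_G_bound: "\<bar>u \<bullet> G y v\<bar> \<le> norm u * C"
  using Cauchy_Schwarz_ineq2[of u "G y v"] mult_left_mono[OF G_bound[of y v] norm_ge_zero[of u]] by linarith

lemma noise_quadratic_integrable: "integrable law (\<lambda>v. (u \<bullet> G 0 v)\<^sup>2)"
proof (rule law.integrable_const_bound[where B="(norm u * C)\<^sup>2"])
  have "(u \<bullet> G 0 v)\<^sup>2 \<le> (norm u * C)\<^sup>2" for v
    using inner_G_bound[of u 0 v] by (metis abs_ge_zero power2_abs power_mono)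
  then show "AE v in law. norm ((u \<bullet> G 0 v)\<^sup>2) \<le> (norm u * C)\<^sup>2"
    by (intro AE_I2) (simp only: real_norm_def abs_power2)
qed simp

lemma noise_quadratic_nonneg: "0 \<le> noise_quadratic u"
  unfolding noise_quadratic_def by (rule integral_nonneg_AE) simp

lemma noise_quadratic_bound: "noise_quadratic u \<le> (norm u * C)\<^sup>2"
proof -
  have "(u \<bullet> G 0 v)\<^sup>2 \<le> (norm u * C)\<^sup>2" for v
    using inner_G_bound[of u 0 v] by (metis abs_ge_zero power2_abs power_mono)
  then have "noise_quadratic u \<le> (\<integral>v. (norm u * C)\<^sup>2 \<partial>law)"
    unfolding noise_quadratic_def by (intro integral_mono noise_quadratic_integrable) auto
  then show ?thesis using law.prob_space by simp
qed

lemma noise_quadratic_scaleR: "noise_quadratic (c *\<^sub>R u) = c\<^sup>2 * noise_quadratic u"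
  by (simp add: noise_quadratic_def power_mult_distrib)

lemma linear_quadratic_nonneg: "0 \<le> linear_quadratic t u"
  by (induction t arbitrary: u) (simp_all add: noise_quadratic_nonneg)

lemma cis_inner_integrable:
  assumes [measurable]: "X \<in> borel_measurable M"
  shows "integrable M (\<lambda>\<omega>. cis (u \<bullet> X \<omega>))"
proof (rule integrable_const_bound[where B=1])
  have c: "continuous_on UNIV (\<lambda>x. cis (u \<bullet> x))" by (intro continuous_intros)
  show "(\<lambda>\<omega>. cis (u \<bullet> X \<omega>)) \<in> borel_measurable M"
    by (rule measurable_compose[OF _ borel_measurable_continuous_onI[OF c]]) simp
qed simp

lemma cis_measurable [measurable]: "cis \<in> borel_measurable borel"
  by (intro borel_measurable_continuous_onI continuous_intros)

lemma norm_integral_cis_le_1: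
  fixes f :: "'c \<Rightarrow> real"
  assumes "prob_space L"
  shows "norm (\<integral>x. cis (f x) \<partial>L) \<le> 1"
proof -
  interpret L: prob_space L by fact
  have "norm (\<integral>x. cis (f x) \<partial>L) \<le> (\<integral>x. norm (cis (f x)) \<partial>L)" by (rule integral_norm_bound)
  then show ?thesis by (simp add: L.prob_space)
qed

text \<open>
  Taylor expansion of both sides, valid for \<open>|u| \<le> 1\<close>; for larger \<open>u\<close> both functions have modulus at most \<open>1\<close>.
  The summand \<open>2\<close> of the constant is for the second case.
\<close>
lemma noise_char_approx:
  "norm (noise_char u - exp (- complex_of_real (noise_quadratic u) / 2)) \<le> (C ^ 3 / 6 + C ^ 4 + 2) * norm u ^ 3"
proof (cases "norm u \<le> 1")
  case False
  then have "1 \<le> norm u ^ 3" by (simp add: one_le_power)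
  have "norm (noise_char u - exp (- complex_of_real (noise_quadratic u) / 2)) \<le> norm (noise_char u) + norm (exp (- complex_of_real (noise_quadratic u) / 2))"
    by (rule norm_triangle_ineq4)
  also have "\<dots> \<le> 1 + 1"
    using noise_quadratic_nonneg[of u] unfolding noise_char_def
    by (intro add_mono norm_integral_cis_le_1 law.prob_space_axioms) simp
  also have "\<dots> \<le> 2 * norm u ^ 3" using \<open>1 \<le> norm u ^ 3\<close> by simp
  also have "\<dots> \<le> (C ^ 3 / 6 + C ^ 4 + 2) * norm u ^ 3" using C_nonneg by (intro mult_right_mono) auto
  finally show ?thesis .
next
  case True
  define q where "q = noise_quadratic u"
  have q: "0 \<le> q" "q \<le> (norm u * C)\<^sup>2" using noise_quadratic_nonneg noise_quadratic_bound by (auto simp: q_def)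
  have cm: "(\<lambda>v. cis (u \<bullet> G 0 v)) \<in> borel_measurable law" by measurable
  have ci: "integrable law (\<lambda>v. cis (u \<bullet> G 0 v))"
    by (rule law.integrable_const_bound[where B=1]) (use cm in auto)
  have mean0: "(\<integral>v. u \<bullet> G 0 v \<partial>law) = 0"
    using mean_field_0 by (simp add: mean_field_def)
  define T where "T v = 1 + \<i> * complex_of_real (u \<bullet> G 0 v) - complex_of_real ((u \<bullet> G 0 v)\<^sup>2) / 2" for v
  have Ti: "integrable law T" unfolding T_def using noise_quadratic_integrable by (intro Bochner_Integration.integrable_diff Bochner_Integration.integrable_add integrable_mult_right integrable_divide integrable_of_real) auto
  have ET: "(\<integral>v. T v \<partial>law) = 1 - complex_of_real q / 2"
    unfolding T_def q_def noise_quadratic_def using noise_quadratic_integrable[of u] mean0 law.prob_space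
    by (simp add: integral_complex_of_real del: of_real_power)
  have Tb: "norm (cis (u \<bullet> G 0 v) - T v) \<le> (C ^ 3 / 6) * norm u ^ 3" for v
  proof -
    have "norm (iexp (u \<bullet> G 0 v) - (\<Sum>k\<le>2. (\<i> * (u \<bullet> G 0 v)) ^ k / fact k)) \<le> \<bar>u \<bullet> G 0 v\<bar> ^ Suc 2 / fact (Suc 2)"
      by (rule iexp_approx1)
    moreover have "(\<Sum>k\<le>2. (\<i> * complex_of_real (u \<bullet> G 0 v)) ^ k / fact k) = T v"
      by (simp add: T_def numeral_2_eq_2 power_mult_distrib)
    moreover have "\<bar>u \<bullet> G 0 v\<bar> ^ Suc 2 / fact (Suc 2) \<le> (norm u * C) ^ 3 / 6"
      using power_mono[OF inner_G_bound[of u 0 v] abs_ge_zero, of 3] by (simp add: fact_numeral eval_nat_numeral)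
    ultimately show ?thesis by (simp add: cis_conv_exp power_mult_distrib mult.commute)
  qed
  have 1: "norm (noise_char u - (1 - complex_of_real q / 2)) \<le> (C ^ 3 / 6) * norm u ^ 3"
  proof -
    have "noise_char u - (1 - complex_of_real q / 2) = (\<integral>v. cis (u \<bullet> G 0 v) - T v \<partial>law)"
      using ci Ti by (simp add: noise_char_def ET)
    also have "norm \<dots> \<le> (\<integral>v. norm (cis (u \<bullet> G 0 v) - T v) \<partial>law)" by (rule integral_norm_bound)
    also have "\<dots> \<le> (\<integral>v. (C ^ 3 / 6) * norm u ^ 3 \<partial>law)"
      by (rule integral_mono[OF _ _ Tb]) (use ci Ti in auto)
    also have "\<dots> = (C ^ 3 / 6) * norm u ^ 3" using law.prob_space by simp
    finally show ?thesis .
  qed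
  have 2: "norm ((1 - complex_of_real q / 2) - exp (- complex_of_real q / 2)) \<le> C ^ 4 * norm u ^ 3"
  proof -
    have "(1 - complex_of_real q / 2) - exp (- complex_of_real q / 2) = complex_of_real ((1 - q / 2) - exp (- (q / 2)))"
      by (simp add: exp_of_real[symmetric])
    then have "norm ((1 - complex_of_real q / 2) - exp (- complex_of_real q / 2)) = \<bar>(1 - q / 2) - exp (- (q / 2))\<bar>"
      by (simp only: norm_of_real)
    also have "\<dots> \<le> (q / 2)\<^sup>2"
    proof -
      have low: "1 - q / 2 \<le> exp (- (q / 2))" using exp_ge_add_one_self[of "- (q / 2)"] by simp
      have "exp (- (q / 2)) \<le> 1 - q / 2 + (q / 2)\<^sup>2"
      proof (cases "q / 2 \<le> 1")
        case True
        then show ?thesis using exp_le_quadratic[of "- (q / 2)"] q(1) by simp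
      next
        case False
        then have "q / 2 \<le> (q / 2)\<^sup>2" by (simp add: power2_eq_square)
        moreover have "exp (- (q / 2)) \<le> 1" using q(1) by simp
        ultimately show ?thesis by linarith
      qed
      then show ?thesis using low by linarith
    qed
    also have "\<dots> \<le> q\<^sup>2" using q(1) by (intro power_mono) auto
    also have "\<dots> \<le> ((norm u * C)\<^sup>2)\<^sup>2" using q by (intro power_mono) auto
    also have "\<dots> = C ^ 4 * (norm u ^ 3 * norm u)" by (simp add: power_mult_distrib power_mult[symmetric] eval_nat_numeral)
    also have "\<dots> \<le> C ^ 4 * (norm u ^ 3 * 1)" using True by (intro mult_left_mono) auto
    finally show ?thesis by simp
  qed
  have "norm (noise_char u - exp (- complex_of_real q / 2)) \<le> norm (noise_char u - (1 - complex_of_real q / 2)) + norm ((1 - complex_of_real q / 2) - exp (- complex_of_real q / 2))"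
    using norm_triangle_ineq[of "noise_char u - (1 - complex_of_real q / 2)"] by (metis diff_add_cancel add_diff_eq)
  also have "\<dots> \<le> (C ^ 3 / 6) * norm u ^ 3 + C ^ 4 * norm u ^ 3" by (rule add_mono[OF 1 2])
  also have "\<dots> \<le> (C ^ 3 / 6 + C ^ 4 + 2) * norm u ^ 3" by (simp add: algebra_simps)
  finally show ?thesis by (simp add: q_def)
qed

text \<open>
  The present noise is independent of the linear part, and symmetry of \<open>B\<close> moves the
  contraction to the argument of the characteristic function.
\<close>
lemma linear_char_Suc:
  assumes sym: "\<And>x y. x \<bullet> B y = B x \<bullet> y"
  shows "linear_char (Suc t) u = linear_char t (contraction t u) * noise_char (- (a / (real t + 1)) *\<^sub>R u)"
proof -
  define F where "F w v = cis (contraction t u \<bullet> w) * cis ((- (a / (real t + 1)) *\<^sub>R u) \<bullet> G 0 v)" for w v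
  have \<Phi>m: "case_prod (\<lambda>w v. contraction t w - (a / (real t + 1)) *\<^sub>R G 0 v) \<in> borel \<Otimes>\<^sub>M N \<rightarrow>\<^sub>M borel" for t
    by measurable
  note ind = recursion_independent[where Z="linear_part" and zi=0 and Q=borel, OF \<Phi>m]
  have ind2: "distr M (borel \<Otimes>\<^sub>M N) (\<lambda>\<omega>. (linear_part t \<omega>, \<nu> t \<omega>)) = distr M borel (linear_part t) \<Otimes>\<^sub>M law"
    by (rule ind(2)) simp_all
  have Fm: "case_prod F \<in> borel \<Otimes>\<^sub>M N \<rightarrow>\<^sub>M borel" unfolding F_def by measurable
  have step: "cis (u \<bullet> linear_part (Suc t) \<omega>) = F (linear_part t \<omega>) (\<nu> t \<omega>)" for \<omega>
  proof -
    have "u \<bullet> contraction t (linear_part t \<omega>) = contraction t u \<bullet> linear_part t \<omega>"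
      by (simp add: contraction_def inner_diff_left inner_diff_right sym)
    then show ?thesis by (simp add: F_def cis_mult inner_diff_right)
  qed
  have Fi: "integrable M (\<lambda>\<omega>. F (linear_part t \<omega>) (\<nu> t \<omega>))"
    unfolding step[symmetric] by (rule cis_inner_integrable) (rule linear_part_measurable)
  have "linear_char (Suc t) u = expectation (\<lambda>\<omega>. F (linear_part t \<omega>) (\<nu> t \<omega>))"
    unfolding linear_char_def step ..
  also have "\<dots> = expectation (\<lambda>\<omega>. \<integral>v. F (linear_part t \<omega>) v \<partial>law)"
    by (rule expectation_fresh_noise(1)[OF linear_part_measurable ind2 Fm Fi])
  also have "\<dots> = expectation (\<lambda>\<omega>. cis (contraction t u \<bullet> linear_part t \<omega>) * noise_char (- (a / (real t + 1)) *\<^sub>R u))"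
    unfolding F_def noise_char_def by simp
  also have "\<dots> = linear_char t (contraction t u) * noise_char (- (a / (real t + 1)) *\<^sub>R u)"
    unfolding linear_char_def by simp
  finally show ?thesis .
qed

text \<open>
  The error is kept in the form \<open>R t |u|\<^sup>3\<close>: one step multiplies \<open>R\<close> by the cube of the contraction
  rate and adds \<open>O(t\<^bsup>-3\<^esup>)\<close>. As the cube damps faster than \<open>t\<^bsup>-3/2\<^esup>\<close>, the error at
  \<open>sqrt (t + 1) u\<close> tends to \<open>0\<close>. No product over the whole past is ever expanded.
\<close>
lemma linear_char_gaussian:
  assumes sym: "\<And>x y. x \<bullet> B y = B x \<bullet> y"
  obtains R where "\<And>t u. norm (linear_char t u - exp (- complex_of_real (linear_quadratic t u) / 2)) \<le> R t * norm u ^ 3"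
    "(\<lambda>t. (real t + 1) powr (3/2) * R t) \<longlonglongrightarrow> 0"
proof -
  define K where "K = C ^ 3 / 6 + C ^ 4 + 2"
  have K: "0 \<le> K" using C_nonneg by (simp add: K_def)
  define R where "R = rec_nat 0 (\<lambda>t r. rate t ^ 3 * r + K * (a / (real t + 1)) ^ 3)"
  have RS: "R (Suc t) = rate t ^ 3 * R t + K * (a / (real t + 1)) ^ 3" and R0: "R 0 = 0" for t
    by (simp_all add: R_def)
  have Rn: "0 \<le> R t" for t
    by (induction t) (use rate_nonneg K a_pos in \<open>auto simp: R0 RS\<close>)
  have bound: "norm (linear_char t u - exp (- complex_of_real (linear_quadratic t u) / 2)) \<le> R t * norm u ^ 3" for t u
  proof (induction t arbitrary: u)
    case 0
    then show ?case by (simp add: linear_char_def R0 prob_space)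
  next
    case (Suc t)
    define \<alpha> where "\<alpha> = a / (real t + 1)"
    have \<alpha>: "0 < \<alpha>" using a_pos by (simp add: \<alpha>_def)
    let ?L = "contraction t u" and ?v = "- \<alpha> *\<^sub>R u"
    let ?g = "exp (- complex_of_real (linear_quadratic t ?L) / 2)" and ?h = "exp (- complex_of_real (noise_quadratic ?v) / 2)"
    have g: "norm ?g \<le> 1" using linear_quadratic_nonneg[of t ?L] by simp
    have n: "norm (noise_char ?v) \<le> 1" unfolding noise_char_def by (rule norm_integral_cis_le_1) (rule law.prob_space_axioms)
    have eq: "exp (- complex_of_real (linear_quadratic (Suc t) u) / 2) = ?g * ?h"
      unfolding noise_quadratic_scaleR by (simp add: exp_add[symmetric] \<alpha>_def add_divide_distrib diff_divide_distrib)
    have split: "linear_char t ?L * noise_char ?v - ?g * ?h = (linear_char t ?L - ?g) * noise_char ?v + ?g * (noise_char ?v - ?h)"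
      by (simp add: algebra_simps)
    have "norm (linear_char (Suc t) u - exp (- complex_of_real (linear_quadratic (Suc t) u) / 2))
       \<le> norm (linear_char t ?L - ?g) * norm (noise_char ?v) + norm ?g * norm (noise_char ?v - ?h)"
      unfolding linear_char_Suc[OF sym] \<alpha>_def[symmetric] eq split norm_mult[symmetric] by (rule norm_triangle_ineq)
    also have "\<dots> \<le> norm (linear_char t ?L - ?g) * 1 + 1 * norm (noise_char ?v - ?h)"
      using g n by (intro add_mono mult_left_mono mult_right_mono) auto
    also have "\<dots> \<le> R t * norm ?L ^ 3 + K * norm ?v ^ 3"
      unfolding mult_1_left mult_1_right K_def by (rule add_mono[OF Suc noise_char_approx])
    also have "\<dots> \<le> R t * (rate t * norm u) ^ 3 + K * (\<alpha> * norm u) ^ 3"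
      using contraction_rate[of t u] Rn K \<alpha> by (intro add_mono mult_left_mono power_mono) auto
    also have "\<dots> = R (Suc t) * norm u ^ 3" 
      by (simp only: RS \<alpha>_def[symmetric]) (simp add: power_mult_distrib algebra_simps)
    finally show ?case .
  qed
  obtain c where c: "real 3 / 2 < c" "\<forall>\<^sub>F t in sequentially. rate t ^ 3 \<le> 1 - c / (real t + 1)"
    by (rule rate_power_eventually[of 3]) simp
  have "(\<lambda>t. (real t + 1) powr (3/2) * R t) \<longlonglongrightarrow> 0"
  proof (rule chung_tendsto_0[where c=c])
    show "(\<lambda>t. K * a ^ 3 * (real t + 1) powr (- (1/2))) \<longlonglongrightarrow> 0" by real_asymp
    show "\<forall>\<^sub>F t in sequentially. R (Suc t) \<le> (1 - c / (real t + 1)) * R t + K * a ^ 3 * (real t + 1) powr (- (1/2)) * (real t + 1) powr (- (3/2) - 1)"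
      using c(2)
    proof eventually_elim
      case (elim t)
      have "(real t + 1) powr (- (1/2)) * (real t + 1) powr (- (3/2) - 1) = (real t + 1) powr (- 3)"
        by (simp only: powr_add[symmetric]) simp
      also have "\<dots> = 1 / (real t + 1) ^ 3" by (simp add: powr_minus_divide powr_numeral)
      finally have eq: "K * a ^ 3 * (real t + 1) powr (- (1/2)) * (real t + 1) powr (- (3/2) - 1) = K * (a / (real t + 1)) ^ 3"
        by (simp add: mult.assoc power_divide)
      show ?case unfolding eq RS using elim Rn by (intro add_right_mono mult_right_mono) auto
    qed
  qed (use c Rn in auto)
  with bound show ?thesis using that by blast
qed

text \<open>
  The ansatz \<open>u \<bullet> S u / (t + 1)\<close> satisfies the covariance recursion up to \<open>O(t\<^bsup>-3\<^esup>) |u|\<^sup>2\<close>: with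
  \<open>\<tau> = t + 1\<close> the terms of order \<open>\<tau>\<^bsup>-2\<^esup>\<close> cancel by the Lyapunov equation, because \<open>1/\<tau> - 1/(\<tau> + 1)\<close>
  differs from \<open>1/\<tau>\<^sup>2\<close> only by \<open>1/(\<tau>\<^sup>2 (\<tau> + 1))\<close>. The difference is damped by the square of the
  contraction rate, faster than \<open>1/t\<close>.
\<close>
lemma linear_quadratic_lyapunov:
  fixes S :: "'a \<Rightarrow> 'a"
  assumes S: "linear S" and S_sym: "\<And>x y. x \<bullet> S y = S x \<bullet> y"
    and lyapunov: "\<And>u. a\<^sup>2 * noise_quadratic u = 2 * a * (S u \<bullet> B u) - u \<bullet> S u"
  obtains R where "\<And>t u. \<bar>linear_quadratic t u - (u \<bullet> S u) / (real t + 1)\<bar> \<le> R t * (norm u)\<^sup>2"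
    "(\<lambda>t. (real t + 1) * R t) \<longlonglongrightarrow> 0"
proof -
  have bS: "bounded_linear S" using S by (simp add: linear_conv_bounded_linear)
  obtain s where s: "\<And>v. norm (S v) \<le> norm v * s" "0 \<le> s" using bounded_linear.nonneg_bounded[OF bS] by blast
  obtain L where L: "\<And>v. norm (B v) \<le> norm v * L" "0 \<le> L"
    using bounded_linear.nonneg_bounded[OF B_bounded_linear] by blast
  have Sb: "\<bar>u \<bullet> S u\<bar> \<le> s * (norm u)\<^sup>2" for u
    using Cauchy_Schwarz_ineq2[of u "S u"] mult_left_mono[OF s(1)[of u] norm_ge_zero[of u]]
    by (simp add: power2_eq_square mult_ac)
  have Bb: "\<bar>B u \<bullet> S (B u)\<bar> \<le> s * L\<^sup>2 * (norm u)\<^sup>2" for u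
  proof -
    have "(norm (B u))\<^sup>2 \<le> (norm u * L)\<^sup>2" using L by (intro power_mono) auto
    then have "s * (norm (B u))\<^sup>2 \<le> s * (norm u * L)\<^sup>2" using s by (intro mult_left_mono)
    then show ?thesis using Sb[of "B u"] by (simp add: power_mult_distrib mult_ac)
  qed
  define K where "K = s + a\<^sup>2 * (s * L\<^sup>2)"
  have K: "0 \<le> K" using s by (simp add: K_def)
  define R where "R = rec_nat s (\<lambda>t r. rate t ^ 2 * r + K / (real t + 1) ^ 3)"
  have RS: "R (Suc t) = rate t ^ 2 * R t + K / (real t + 1) ^ 3" and R0: "R 0 = s" for t
    by (simp_all add: R_def)
  have Rn: "0 \<le> R t" for t
    by (induction t) (use rate_nonneg K s in \<open>auto simp: R0 RS\<close>)
  have bound: "\<bar>linear_quadratic t u - (u \<bullet> S u) / (real t + 1)\<bar> \<le> R t * (norm u)\<^sup>2" for t u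
  proof (induction t arbitrary: u)
    case 0
    then show ?case using Sb[of u] by (simp add: R0)
  next
    case (Suc t)
    define \<tau> where "\<tau> = real t + 1"
    have \<tau>: "1 \<le> \<tau>" by (simp add: \<tau>_def)
    let ?v = "contraction t u"
    have q: "?v \<bullet> S ?v = u \<bullet> S u - 2 * (a / \<tau>) * (S u \<bullet> B u) + (a / \<tau>)\<^sup>2 * (B u \<bullet> S (B u))"
    proof -
      have "u \<bullet> S (B u) = S u \<bullet> B u" by (rule S_sym)
      moreover have "B u \<bullet> S u = S u \<bullet> B u" by (rule inner_commute)
      ultimately show ?thesis
        by (simp add: contraction_def \<tau>_def linear_diff[OF S] linear_cmul[OF S] inner_diff_left inner_diff_right power2_eq_square algebra_simps)
    qed
    have ly: "(a / \<tau>)\<^sup>2 * noise_quadratic u = (2 * a * (S u \<bullet> B u) - u \<bullet> S u) / \<tau>\<^sup>2"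
      using lyapunov[of u] by (simp add: power_divide)
    have "linear_quadratic (Suc t) u - (u \<bullet> S u) / (real (Suc t) + 1) =
       (linear_quadratic t ?v - (?v \<bullet> S ?v) / \<tau>) + (u \<bullet> S u) * (1 / \<tau> - 1 / \<tau>\<^sup>2 - 1 / (\<tau> + 1))
       + a\<^sup>2 * (B u \<bullet> S (B u)) / \<tau> ^ 3"
    proof -
      have "linear_quadratic (Suc t) u - (u \<bullet> S u) / (real (Suc t) + 1)
        = linear_quadratic t ?v + (2 * a * (S u \<bullet> B u) - u \<bullet> S u) / \<tau>\<^sup>2 - (u \<bullet> S u) / (\<tau> + 1)"
      proof -
        have "real (Suc t) + 1 = \<tau> + 1" by (simp add: \<tau>_def)
        then show ?thesis unfolding linear_quadratic.simps \<tau>_def[symmetric] ly by simp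
      qed
      also have "\<dots> = (linear_quadratic t ?v - (?v \<bullet> S ?v) / \<tau>) + ((?v \<bullet> S ?v) / \<tau> + (2 * a * (S u \<bullet> B u) - u \<bullet> S u) / \<tau>\<^sup>2 - (u \<bullet> S u) / (\<tau> + 1))"
        by simp
      also have "(?v \<bullet> S ?v) / \<tau> + (2 * a * (S u \<bullet> B u) - u \<bullet> S u) / \<tau>\<^sup>2 - (u \<bullet> S u) / (\<tau> + 1)
        = (u \<bullet> S u) * (1 / \<tau> - 1 / \<tau>\<^sup>2 - 1 / (\<tau> + 1)) + a\<^sup>2 * (B u \<bullet> S (B u)) / \<tau> ^ 3"
        unfolding q using \<tau>
        by (simp add: add_divide_distrib diff_divide_distrib power_divide power2_eq_square power3_eq_cube algebra_simps)
      finally show ?thesis by simp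
    qed
    then have "\<bar>linear_quadratic (Suc t) u - (u \<bullet> S u) / (real (Suc t) + 1)\<bar> \<le>
       \<bar>linear_quadratic t ?v - (?v \<bullet> S ?v) / \<tau>\<bar> + \<bar>(u \<bullet> S u) * (1 / \<tau> - 1 / \<tau>\<^sup>2 - 1 / (\<tau> + 1))\<bar>
       + \<bar>a\<^sup>2 * (B u \<bullet> S (B u)) / \<tau> ^ 3\<bar>" by linarith
    also have "\<bar>linear_quadratic t ?v - (?v \<bullet> S ?v) / \<tau>\<bar> \<le> R t * (norm ?v)\<^sup>2" unfolding \<tau>_def by (rule Suc)
    also have "R t * (norm ?v)\<^sup>2 \<le> R t * (rate t * norm u)\<^sup>2"
      using contraction_rate[of t u] Rn by (intro mult_left_mono power_mono) auto
    also have "\<bar>(u \<bullet> S u) * (1 / \<tau> - 1 / \<tau>\<^sup>2 - 1 / (\<tau> + 1))\<bar> \<le> s * (norm u)\<^sup>2 * (1 / \<tau> ^ 3)"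
    proof -
      have "1 / \<tau> - 1 / \<tau>\<^sup>2 - 1 / (\<tau> + 1) = - (1 / (\<tau>\<^sup>2 * (\<tau> + 1)))"
        using \<tau> by (simp add: field_simps power2_eq_square)
      moreover have "1 / (\<tau>\<^sup>2 * (\<tau> + 1)) \<le> 1 / \<tau> ^ 3"
        using \<tau> by (intro divide_left_mono) (auto simp: power2_eq_square power3_eq_cube mult_left_mono)
      moreover have "0 \<le> 1 / (\<tau>\<^sup>2 * (\<tau> + 1))" using \<tau> by simp
      ultimately have "\<bar>1 / \<tau> - 1 / \<tau>\<^sup>2 - 1 / (\<tau> + 1)\<bar> \<le> 1 / \<tau> ^ 3" by simp
      then show ?thesis unfolding abs_mult using Sb[of u] s by (intro mult_mono) auto
    qed
    also have "\<bar>a\<^sup>2 * (B u \<bullet> S (B u)) / \<tau> ^ 3\<bar> \<le> a\<^sup>2 * (s * L\<^sup>2 * (norm u)\<^sup>2) / \<tau> ^ 3"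
      using Bb[of u] \<tau> by (simp add: abs_mult abs_divide) (intro divide_right_mono mult_left_mono, auto)
    finally have "\<bar>linear_quadratic (Suc t) u - (u \<bullet> S u) / (real (Suc t) + 1)\<bar> \<le>
      R t * (rate t * norm u)\<^sup>2 + s * (norm u)\<^sup>2 * (1 / \<tau> ^ 3) + a\<^sup>2 * (s * L\<^sup>2 * (norm u)\<^sup>2) / \<tau> ^ 3"
      by simp
    also have "\<dots> = R (Suc t) * (norm u)\<^sup>2"
      by (simp add: RS K_def \<tau>_def power_mult_distrib add_divide_distrib algebra_simps)
    finally show ?case .
  qed
  obtain c where c: "real 2 / 2 < c" "\<forall>\<^sub>F t in sequentially. rate t ^ 2 \<le> 1 - c / (real t + 1)"
    by (rule rate_power_eventually[of 2]) simp
  have "(\<lambda>t. (real t + 1) powr 1 * R t) \<longlonglongrightarrow> 0"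
  proof (rule chung_tendsto_0[where c=c])
    show "(\<lambda>t. K / (real t + 1)) \<longlonglongrightarrow> 0" by real_asymp
    show "\<forall>\<^sub>F t in sequentially. R (Suc t) \<le> (1 - c / (real t + 1)) * R t + K / (real t + 1) * (real t + 1) powr (- 1 - 1)"
      using c(2)
    proof eventually_elim
      case (elim t)
      have eq: "K / (real t + 1) * (real t + 1) powr (- 1 - 1) = K / (real t + 1) ^ 3"
        by (simp add: powr_minus_divide powr_numeral power3_eq_cube power2_eq_square)
      show ?case unfolding eq RS using elim Rn by (intro add_right_mono mult_right_mono) auto
    qed
  qed (use c Rn in auto)
  then have "(\<lambda>t. (real t + 1) * R t) \<longlonglongrightarrow> 0" by simp
  with bound show ?thesis using that by blast
qed

text \<open>
  Positivity of \<open>S\<close> comes for free, as \<open>u \<bullet> S u\<close> is a limit of variances. Tightness is Markov's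
  inequality for the second moments.
\<close>
theorem asymptotic_normality:
  fixes S :: "'a \<Rightarrow> 'a"
  assumes B_sym: "\<And>x y. x \<bullet> B y = B x \<bullet> y"
    and S: "linear S" and S_sym: "\<And>x y. x \<bullet> S y = S x \<bullet> y"
    and lyapunov: "\<And>u. a\<^sup>2 * noise_quadratic u = 2 * a * (S u \<bullet> B u) - u \<bullet> S u"
  shows "\<exists>\<mu>. prob_space \<mu> \<and> sets \<mu> = sets borel \<and>
      (\<forall>u. (\<integral>x. cis (u \<bullet> x) \<partial>\<mu>) = exp (- complex_of_real (u \<bullet> S u) / 2)) \<and>
      weakly_converges (\<lambda>t. distr M borel (\<lambda>\<omega>. sqrt (real t + 1) *\<^sub>R Y t \<omega>)) \<mu>"
proof -
  let ?v = "\<lambda>(t::nat) (u::'a). sqrt (real t + 1) *\<^sub>R u"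
  obtain R where R: "\<And>t u. norm (linear_char t u - exp (- complex_of_real (linear_quadratic t u) / 2)) \<le> R t * norm u ^ 3"
    "(\<lambda>t. (real t + 1) powr (3/2) * R t) \<longlonglongrightarrow> 0"
    using linear_char_gaussian[OF B_sym] by blast
  obtain Q where Q: "\<And>t u. \<bar>linear_quadratic t u - (u \<bullet> S u) / (real t + 1)\<bar> \<le> Q t * (norm u)\<^sup>2"
    "(\<lambda>t. (real t + 1) * Q t) \<longlonglongrightarrow> 0"
    using linear_quadratic_lyapunov[OF S S_sym lyapunov] by blast
  have qlim: "(\<lambda>t. linear_quadratic t (?v t u)) \<longlonglongrightarrow> u \<bullet> S u" for u
  proof (rule LIM_zero_cancel, rule tendsto_0_le[where K=1])
    show "(\<lambda>t. (real t + 1) * Q t * (norm u)\<^sup>2) \<longlonglongrightarrow> 0"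
      using tendsto_mult_right[OF Q(2), of "(norm u)\<^sup>2"] by simp
    show "\<forall>\<^sub>F t in sequentially. norm (linear_quadratic t (?v t u) - u \<bullet> S u)
        \<le> norm ((real t + 1) * Q t * (norm u)\<^sup>2) * 1"
    proof (intro always_eventually allI)
      fix t
      have "(?v t u) \<bullet> S (?v t u) / (real t + 1) = u \<bullet> S u"
        by (simp add: linear_cmul[OF S] mult.assoc[symmetric])
      then have "\<bar>linear_quadratic t (?v t u) - u \<bullet> S u\<bar> \<le> Q t * (norm (?v t u))\<^sup>2"
        using Q(1)[of t "?v t u"] by simp
      also have "\<dots> = (real t + 1) * Q t * (norm u)\<^sup>2" by (simp add: power_mult_distrib)
      finally show "norm (linear_quadratic t (?v t u) - u \<bullet> S u)
        \<le> norm ((real t + 1) * Q t * (norm u)\<^sup>2) * 1" by simp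
    qed
  qed
  have psd: "0 \<le> u \<bullet> S u" for u
    by (rule tendsto_lowerbound[OF qlim]) (simp_all add: linear_quadratic_nonneg)
  obtain \<mu> where \<mu>: "prob_space \<mu>" "sets \<mu> = sets borel"
    "\<And>u. (\<integral>x. cis (u \<bullet> x) \<partial>\<mu>) = exp (- complex_of_real (u \<bullet> S u) / 2)"
    using gaussian_exists[OF S S_sym psd] by blast
  define X where "X t \<omega> = sqrt (real t + 1) *\<^sub>R Y t \<omega>" for t \<omega>
  have Xm[measurable]: "X t \<in> borel_measurable M" for t unfolding X_def by measurable
  have charW: "(\<lambda>t. linear_char t (?v t u)) \<longlonglongrightarrow> exp (- complex_of_real (u \<bullet> S u) / 2)" for u
  proof (rule Lim_transform)
    show "(\<lambda>t. exp (- complex_of_real (linear_quadratic t (?v t u)) / 2)) \<longlonglongrightarrow> exp (- complex_of_real (u \<bullet> S u) / 2)"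
      by (intro tendsto_intros qlim) simp
    show "(\<lambda>t. linear_char t (?v t u) - exp (- complex_of_real (linear_quadratic t (?v t u)) / 2)) \<longlonglongrightarrow> 0"
    proof (rule tendsto_0_le[where K=1])
      show "(\<lambda>t. (real t + 1) powr (3/2) * R t * norm u ^ 3) \<longlonglongrightarrow> 0"
        using tendsto_mult_right[OF R(2), of "norm u ^ 3"] by simp
      show "\<forall>\<^sub>F t in sequentially. norm (linear_char t (?v t u) - exp (- complex_of_real (linear_quadratic t (?v t u)) / 2))
        \<le> norm ((real t + 1) powr (3/2) * R t * norm u ^ 3) * 1"
      proof (intro always_eventually allI)
        fix t
        have "sqrt (real t + 1) ^ 3 = (real t + 1) powr (3/2)"
          by (simp add: powr_half_sqrt[symmetric] powr_power)
        then show "norm (linear_char t (?v t u) - exp (- complex_of_real (linear_quadratic t (?v t u)) / 2))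
        \<le> norm ((real t + 1) powr (3/2) * R t * norm u ^ 3) * 1"
          using R(1)[of t "?v t u"] by (simp add: norm_minus_commute power_mult_distrib mult_ac)
      qed
    qed
  qed
  have charX: "(\<lambda>t. expectation (\<lambda>\<omega>. cis (u \<bullet> X t \<omega>))) \<longlonglongrightarrow> exp (- complex_of_real (u \<bullet> S u) / 2)" for u
  proof (rule Lim_transform[OF charW[of u]])
    show "(\<lambda>t. expectation (\<lambda>\<omega>. cis (u \<bullet> X t \<omega>)) - linear_char t (?v t u)) \<longlonglongrightarrow> 0"
    proof (rule tendsto_0_le[where K=1])
      show "(\<lambda>t. norm u * (sqrt (real t + 1) * expectation (\<lambda>\<omega>. norm (Y t \<omega> - linear_part t \<omega>)))) \<longlonglongrightarrow> 0"
        using tendsto_mult_left[OF linearisation_error, of "norm u"] by simp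
      show "\<forall>\<^sub>F t in sequentially. norm (expectation (\<lambda>\<omega>. cis (u \<bullet> X t \<omega>)) - linear_char t (?v t u))
        \<le> norm (norm u * (sqrt (real t + 1) * expectation (\<lambda>\<omega>. norm (Y t \<omega> - linear_part t \<omega>)))) * 1"
      proof (intro always_eventually allI)
        fix t
        have lip: "norm (cis x - cis y) \<le> \<bar>x - y\<bar>" for x y
        proof -
          have "cis x - cis y = cis y * (cis (x - y) - 1)" by (simp add: algebra_simps cis_mult)
          then have "norm (cis x - cis y) = norm (iexp (x - y) - 1)" by (simp add: norm_mult cis_conv_exp)
          also have "\<dots> \<le> \<bar>x - y\<bar>" using iexp_approx1[of "x - y" 0] by simp
          finally show ?thesis .
        qed
        have i1: "integrable M (\<lambda>\<omega>. cis ((?v t u) \<bullet> linear_part t \<omega>))" "integrable M (\<lambda>\<omega>. cis (u \<bullet> X t \<omega>))"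
          by (intro cis_inner_integrable linear_part_measurable Xm)+
        obtain R' where R': "\<And>\<omega>. norm (linear_part t \<omega>) \<le> R'" using linear_part_bounded by blast
        have i2: "integrable M (\<lambda>\<omega>. norm (Y t \<omega> - linear_part t \<omega>))"
        proof (rule integrable_const_bound[where B="growth t + R'"])
          have "norm (Y t \<omega> - linear_part t \<omega>) \<le> growth t + R'" if "\<omega> \<in> space M" for \<omega>
            using norm_triangle_ineq4[of "Y t \<omega>" "linear_part t \<omega>"] Y_growth[OF that, of t] R'[of \<omega>] by linarith
          then show "AE \<omega> in M. norm (norm (Y t \<omega> - linear_part t \<omega>)) \<le> growth t + R'" by simp
        qed simp
        have "norm (expectation (\<lambda>\<omega>. cis (u \<bullet> X t \<omega>)) - linear_char t (?v t u))
           = norm (expectation (\<lambda>\<omega>. cis ((?v t u) \<bullet> linear_part t \<omega>) - cis (u \<bullet> X t \<omega>)))"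
          unfolding linear_char_def using i1 by (simp add: norm_minus_commute)
        also have "\<dots> \<le> expectation (\<lambda>\<omega>. norm (cis ((?v t u) \<bullet> linear_part t \<omega>) - cis (u \<bullet> X t \<omega>)))"
          by (rule integral_norm_bound)
        also have "\<dots> \<le> expectation (\<lambda>\<omega>. norm u * sqrt (real t + 1) * norm (Y t \<omega> - linear_part t \<omega>))"
        proof (rule integral_mono)
          show "integrable M (\<lambda>\<omega>. norm (cis ((?v t u) \<bullet> linear_part t \<omega>) - cis (u \<bullet> X t \<omega>)))"
            using i1 by (intro integrable_norm Bochner_Integration.integrable_diff)
          fix \<omega>
          have "norm (cis ((?v t u) \<bullet> linear_part t \<omega>) - cis (u \<bullet> X t \<omega>))
             \<le> \<bar>(?v t u) \<bullet> linear_part t \<omega> - u \<bullet> X t \<omega>\<bar>" by (rule lip)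
          also have "\<dots> = \<bar>(?v t u) \<bullet> (Y t \<omega> - linear_part t \<omega>)\<bar>"
            by (simp add: X_def inner_diff_right abs_minus_commute)
          also have "\<dots> \<le> norm (?v t u) * norm (Y t \<omega> - linear_part t \<omega>)"
            by (rule Cauchy_Schwarz_ineq2)
          finally show "norm (cis ((?v t u) \<bullet> linear_part t \<omega>) - cis (u \<bullet> X t \<omega>))
             \<le> norm u * sqrt (real t + 1) * norm (Y t \<omega> - linear_part t \<omega>)" by (simp add: mult_ac)
        qed (use i2 in simp)
        finally show "norm (expectation (\<lambda>\<omega>. cis (u \<bullet> X t \<omega>)) - linear_char t (?v t u))
        \<le> norm (norm u * (sqrt (real t + 1) * expectation (\<lambda>\<omega>. norm (Y t \<omega> - linear_part t \<omega>)))) * 1"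
          by (simp add: mult_ac)
      qed
    qed
  qed
  have "weakly_converges (\<lambda>t. distr M borel (X t)) \<mu>"
  proof (rule weakly_converges_characteristic)
    show "prob_space (distr M borel (X t))" for t by (rule prob_space_distr) simp
    show "(\<lambda>t. \<integral>x. cis (u \<bullet> x) \<partial>distr M borel (X t)) \<longlonglongrightarrow> (\<integral>x. cis (u \<bullet> x) \<partial>\<mu>)" for u
    proof -
      have "(\<integral>x. cis (u \<bullet> x) \<partial>distr M borel (X t)) = expectation (\<lambda>\<omega>. cis (u \<bullet> X t \<omega>))" for t
        by (rule integral_distr) simp_all
      then show ?thesis using charX \<mu>(3) by simp
    qed
    fix e :: real assume e: "0 < e"
    obtain K where K: "0 \<le> K" "\<And>t. (real t + 1) * expectation (\<lambda>\<omega>. (norm (Y t \<omega>))\<^sup>2) \<le> K"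
      using second_moment[OF drift \<delta>_pos \<beta>] by blast
    \<comment> \<open>the summand \<open>1\<close> keeps the radius positive when \<open>K = 0\<close>\<close>
    define r where "r = sqrt (K / e) + 1"
    have r: "0 < r" using K e by (simp add: r_def add_nonneg_pos)
    have "K / e = (sqrt (K / e))\<^sup>2" using K e by simp
    also have "\<dots> \<le> r\<^sup>2" unfolding r_def using K e by (intro power_mono) auto
    finally have Kr: "K \<le> e * r\<^sup>2" using e by (simp add: field_simps)
    have "measure (distr M borel (X t)) {x. r \<le> norm x} \<le> e" for t
    proof -
      have "measure (distr M borel (X t)) {x. r \<le> norm x} = prob {\<omega> \<in> space M. r \<le> norm (X t \<omega>)}"
        by (subst measure_distr) (auto intro!: arg_cong[where f=prob])
      also have "{\<omega> \<in> space M. r \<le> norm (X t \<omega>)} = {\<omega> \<in> space M. r\<^sup>2 \<le> (norm (X t \<omega>))\<^sup>2}"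
        using r by (auto simp: abs_le_square_iff[symmetric])
      also have "prob \<dots> \<le> expectation (\<lambda>\<omega>. (norm (X t \<omega>))\<^sup>2) / r\<^sup>2"
        by (rule integral_Markov_inequality_measure[where A="{}"])
          (use integrable_norm_Y r in \<open>auto simp: X_def power_mult_distrib\<close>)
      also have "expectation (\<lambda>\<omega>. (norm (X t \<omega>))\<^sup>2) = (real t + 1) * expectation (\<lambda>\<omega>. (norm (Y t \<omega>))\<^sup>2)"
        by (simp add: X_def power_mult_distrib)
      also have "\<dots> / r\<^sup>2 \<le> K / r\<^sup>2" using K by (intro divide_right_mono) auto
      also have "\<dots> \<le> e" using Kr r by (simp add: field_simps)
      finally show ?thesis .
    qed
    then show "\<exists>R. \<forall>t. measure (distr M borel (X t)) {x. R \<le> norm x} \<le> e" by blast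
  qed (use \<mu> in auto)
  with \<mu> show ?thesis unfolding X_def by blast
qed

end

section \<open>Symmetric matrices, the matrix exponential and the Lyapunov equation\<close>

lemma symmetric_matrix_inner:
  fixes A :: "real^'k^'k"
  assumes "transpose A = A"
  shows "x \<bullet> (A *v y) = (A *v x) \<bullet> y"
  by (metis assms dot_lmul_matrix vector_transpose_matrix)

lemma complex_eigenvalue_of_real:
  fixes A :: "real^'k^'k"
  assumes "A *v v = \<mu> *\<^sub>R v" "v \<noteq> 0"
  shows "complex_eigenvalue A (complex_of_real \<mu>)"
  unfolding complex_eigenvalue_def
proof (intro exI conjI)
  let ?w = "(\<chi> i. complex_of_real (v $ i)) :: complex^'k"
  show "?w \<noteq> 0" using assms(2) by (simp add: vec_eq_iff)
  have "(\<Sum>j\<in>UNIV. A $ i $ j * v $ j) = \<mu> * v $ i" for i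
    using arg_cong[OF assms(1), of "\<lambda>w. w $ i"] by (simp add: matrix_vector_mult_def)
  then have "(\<Sum>j\<in>UNIV. complex_of_real (A $ i $ j) * complex_of_real (v $ j)) = complex_of_real \<mu> * complex_of_real (v $ i)" for i
    by (metis (mono_tags, lifting) of_real_mult of_real_sum sum.cong)
  then show "(\<chi> i j. complex_of_real (A $ i $ j)) *v ?w = complex_of_real \<mu> *s ?w"
    by (simp add: vec_eq_iff matrix_vector_mult_def vector_scalar_mult_def)
qed

text \<open>
  The quadratic form attains its maximum over the unit sphere, at \<open>v\<close> say, with value \<open>\<mu>\<close>. Then
  \<open>\<mu> - A\<close> is positive semidefinite and its form vanishes at \<open>v\<close>, so \<open>A v = \<mu> v\<close> by Cauchy--Schwarz.
  Thus \<open>\<mu>\<close> is an eigenvalue and stability makes it negative.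
\<close>
lemma stable_symmetric_negative:
  fixes A :: "real^'k^'k"
  assumes sym: "transpose A = A" and stable: "stable_matrix A"
  obtains e where "0 < e" "\<And>u. u \<bullet> (A *v u) \<le> - e * (norm u)\<^sup>2"
proof -
  have cont: "continuous_on (sphere 0 1) (\<lambda>u::real^'k. u \<bullet> (A *v u))"
    by (intro continuous_intros matrix_vector_mult_linear_continuous_on)
  have "axis undefined 1 \<in> sphere (0 :: real^'k) 1" by simp
  then have "sphere (0 :: real^'k) 1 \<noteq> {}" by blast
  from continuous_attains_sup[OF compact_sphere this cont]
  obtain v where v: "norm v = 1" "\<And>u. norm u = 1 \<Longrightarrow> u \<bullet> (A *v u) \<le> v \<bullet> (A *v v)" by auto
  define \<mu> where "\<mu> = v \<bullet> (A *v v)"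
  have le: "u \<bullet> (A *v u) \<le> \<mu> * (norm u)\<^sup>2" for u
  proof (cases "u = 0")
    case False
    define w where "w = (1 / norm u) *\<^sub>R u"
    have "norm w = 1" using False by (simp add: w_def)
    moreover have "u = norm u *\<^sub>R w" using False by (simp add: w_def)
    then have "u \<bullet> (A *v u) = (norm u)\<^sup>2 * (w \<bullet> (A *v w))"
      by (metis inner_scaleR_left inner_scaleR_right matrix_vector_mult_scaleR mult.assoc power2_eq_square)
    ultimately show ?thesis using mult_right_mono[OF v(2)[of w], of "(norm u)\<^sup>2"]
      by (simp add: \<mu>_def mult.commute)
  qed simp
  \<comment> \<open>positive semidefinite with \<open>v \<bullet> T v = 0\<close>\<close>
  define T where "T u = \<mu> *\<^sub>R u - A *v u" for u
  have "linear T" unfolding T_def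
    by (intro linearI) (simp_all add: matrix_vector_right_distrib algebra_simps)
  moreover have "x \<bullet> T y = T x \<bullet> y" for x y
    by (simp add: T_def inner_diff_left inner_diff_right symmetric_matrix_inner[OF sym])
  moreover have "0 \<le> x \<bullet> T x" for x
    using le[of x] by (simp add: T_def inner_diff_right power2_norm_eq_inner)
  ultimately have "(T v \<bullet> T v)\<^sup>2 \<le> (T v \<bullet> T (T v)) * (v \<bullet> T v)"
    by (rule psd_cauchy_schwarz)
  moreover have "v \<bullet> T v = 0"
    using v(1) by (simp add: T_def inner_diff_right \<mu>_def power2_norm_eq_inner[symmetric])
  ultimately have "T v = 0" by simp
  then have "A *v v = \<mu> *\<^sub>R v" by (simp add: T_def)
  moreover have "v \<noteq> 0" using v(1) by auto
  ultimately have "complex_eigenvalue A (complex_of_real \<mu>)" by (rule complex_eigenvalue_of_real)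
  then have "\<mu> < 0" using stable by (auto simp: stable_matrix_def)
  then show ?thesis using that[of "- \<mu>"] le by simp
qed

lemma matrix_power_vec_bound:
  fixes A :: "real^'k^'k"
  shows "norm (matrix_power A k *v u) \<le> onorm ((*v) A) ^ k * norm u"
proof (induction k)
  case (Suc k)
  have "norm (matrix_power A (Suc k) *v u) = norm (A *v (matrix_power A k *v u))"
    by (simp add: matrix_vector_mul_assoc)
  also have "\<dots> \<le> onorm ((*v) A) * norm (matrix_power A k *v u)"
    by (rule onorm[OF matrix_vector_mul_bounded_linear])
  also have "\<dots> \<le> onorm ((*v) A) * (onorm ((*v) A) ^ k * norm u)"
    by (rule mult_left_mono[OF Suc onorm_pos_le[OF matrix_vector_mul_bounded_linear]])
  finally show ?case by (simp add: mult.assoc)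
qed simp

lemma matrix_power_scaleR:
  fixes A :: "real^'k^'k"
  shows "matrix_power (c *\<^sub>R A) k = c ^ k *\<^sub>R matrix_power A k"
  by (induction k) (simp_all add: scalar_matrix_assoc matrix_scalar_ac mult.commute)

lemma matrix_power_commute:
  fixes A :: "real^'k^'k"
  shows "A ** matrix_power A k = matrix_power A k ** A"
  by (induction k) (simp_all add: matrix_mul_assoc)

lemma norm_matrix_le_entries:
  fixes A :: "real^'k^'k"
  shows "norm A \<le> (\<Sum>i\<in>UNIV. \<Sum>j\<in>UNIV. \<bar>A $ i $ j\<bar>)"
proof -
  have "norm A \<le> (\<Sum>i\<in>UNIV. norm (A $ i))"
    by (subst norm_vec_def) (rule L2_set_le_sum, simp)
  also have "\<dots> \<le> (\<Sum>i\<in>UNIV. \<Sum>j\<in>UNIV. \<bar>A $ i $ j\<bar>)"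
    by (intro sum_mono norm_le_l1_cart)
  finally show ?thesis .
qed

lemma matrix_entry_inner:
  fixes A :: "real^'k^'k"
  shows "A $ i $ j = axis i 1 \<bullet> (A *v axis j 1)"
  by (simp add: inner_axis' matrix_vector_mult_basis column_def)

text \<open>
  Applied to a vector, the exponential becomes a power series in \<open>v\<close>; all facts about
  it below are read off from this series.
\<close>
lemma matrix_exp_vec_sums:
  fixes A :: "real^'k^'k"
  shows "(\<lambda>k. (v ^ k / fact k) *\<^sub>R (matrix_power A k *v u)) sums (matrix_exp (v *\<^sub>R A) *v u)"
proof -
  define L where "L = onorm ((*v) A)"
  have entry: "\<bar>matrix_power A k $ i $ j\<bar> \<le> L ^ k" for k i j
  proof -
    have "\<bar>matrix_power A k $ i $ j\<bar> \<le> norm (axis i 1 :: real^'k) * norm (matrix_power A k *v axis j 1)"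
      unfolding matrix_entry_inner by (rule Cauchy_Schwarz_ineq2)
    also have "\<dots> \<le> L ^ k" using matrix_power_vec_bound[of A k "axis j 1"] by (simp add: L_def)
    finally show ?thesis .
  qed
  have nb: "norm (matrix_power A k) \<le> (real CARD('k))\<^sup>2 * L ^ k" for k
  proof -
    have "norm (matrix_power A k) \<le> (\<Sum>i\<in>(UNIV::'k set). \<Sum>j\<in>(UNIV::'k set). L ^ k)"
      by (rule order_trans[OF norm_matrix_le_entries]) (intro sum_mono entry)
    then show ?thesis by (simp add: power2_eq_square mult.assoc)
  qed
  have "summable (\<lambda>k. (1 / fact k) *\<^sub>R matrix_power (v *\<^sub>R A) k)"
  proof (rule summable_comparison_test')
    show "summable (\<lambda>k. (real CARD('k))\<^sup>2 * (inverse (fact k) * (\<bar>v\<bar> * L) ^ k))"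
      by (intro summable_mult summable_exp)
    fix k
    have "norm ((1 / fact k) *\<^sub>R matrix_power (v *\<^sub>R A) k) = inverse (fact k) * (\<bar>v\<bar> ^ k * norm (matrix_power A k))"
      by (simp add: matrix_power_scaleR abs_mult power_abs divide_inverse)
    also have "\<dots> \<le> inverse (fact k) * (\<bar>v\<bar> ^ k * ((real CARD('k))\<^sup>2 * L ^ k))"
      by (intro mult_left_mono nb) auto
    finally show "norm ((1 / fact k) *\<^sub>R matrix_power (v *\<^sub>R A) k) \<le> (real CARD('k))\<^sup>2 * (inverse (fact k) * (\<bar>v\<bar> * L) ^ k)"
      by (simp add: power_mult_distrib mult_ac)
  qed
  then have s: "(\<lambda>k. (1 / fact k) *\<^sub>R matrix_power (v *\<^sub>R A) k) sums matrix_exp (v *\<^sub>R A)"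
    unfolding matrix_exp_def by (rule summable_sums)
  have bl: "bounded_linear (\<lambda>M::real^'k^'k. M *v u)"
    by (intro linear_conv_bounded_linear[THEN iffD1] linearI)
      (simp_all add: matrix_vector_mult_add_rdistrib scaleR_matrix_vector_assoc)
  have "(\<lambda>k. ((1 / fact k) *\<^sub>R matrix_power (v *\<^sub>R A) k) *v u) sums (matrix_exp (v *\<^sub>R A) *v u)"
    by (rule bounded_linear.sums[OF bl s])
  then show ?thesis
    by (simp add: matrix_power_scaleR scaleR_matrix_vector_assoc[symmetric])
qed

lemma matrix_exp_zero_vec:
  fixes A :: "real^'k^'k"
  shows "matrix_exp (0 *\<^sub>R A) *v u = u"
proof -
  have "(\<lambda>k. (0 ^ k / fact k) *\<^sub>R (matrix_power A k *v u)) sums (\<Sum>k\<in>{0}. (0 ^ k / fact k) *\<^sub>R (matrix_power A k *v u))"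
    by (rule sums_finite) auto
  then show ?thesis using matrix_exp_vec_sums[of 0 A u] by (simp add: sums_unique2)
qed

lemma matrix_exp_vec_commute:
  fixes A :: "real^'k^'k"
  shows "A *v (matrix_exp (v *\<^sub>R A) *v u) = matrix_exp (v *\<^sub>R A) *v (A *v u)"
proof -
  have "(\<lambda>k. A *v ((v ^ k / fact k) *\<^sub>R (matrix_power A k *v u))) sums (A *v (matrix_exp (v *\<^sub>R A) *v u))"
    by (rule bounded_linear.sums[OF matrix_vector_mul_bounded_linear matrix_exp_vec_sums])
  moreover have "A *v ((v ^ k / fact k) *\<^sub>R (matrix_power A k *v u)) = (v ^ k / fact k) *\<^sub>R (matrix_power A k *v (A *v u))" for k
    by (simp add: matrix_vector_mult_scaleR matrix_vector_mul_assoc matrix_power_commute)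
  ultimately show ?thesis using matrix_exp_vec_sums[of v A "A *v u"] by (simp add: sums_unique2)
qed

lemma matrix_exp_symmetric_inner:
  fixes A :: "real^'k^'k"
  assumes sym: "transpose A = A"
  shows "x \<bullet> (matrix_exp (v *\<^sub>R A) *v y) = (matrix_exp (v *\<^sub>R A) *v x) \<bullet> y"
proof -
  have p: "x \<bullet> (matrix_power A k *v y) = (matrix_power A k *v x) \<bullet> y" for k x y
  proof (induction k arbitrary: x y)
    case (Suc k)
    have "x \<bullet> (matrix_power A (Suc k) *v y) = (A *v x) \<bullet> (matrix_power A k *v y)"
      using symmetric_matrix_inner[OF sym, of x "matrix_power A k *v y"] by (simp add: matrix_vector_mul_assoc)
    also have "\<dots> = (matrix_power A k *v (A *v x)) \<bullet> y" by (rule Suc)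
    also have "matrix_power A k *v (A *v x) = matrix_power A (Suc k) *v x"
      by (simp add: matrix_vector_mul_assoc matrix_power_commute)
    finally show ?case .
  qed simp
  have "(\<lambda>k. x \<bullet> ((v ^ k / fact k) *\<^sub>R (matrix_power A k *v y))) sums (x \<bullet> (matrix_exp (v *\<^sub>R A) *v y))"
    by (rule bounded_linear.sums[OF bounded_linear_inner_right matrix_exp_vec_sums])
  moreover have "(\<lambda>k. ((v ^ k / fact k) *\<^sub>R (matrix_power A k *v x)) \<bullet> y) sums ((matrix_exp (v *\<^sub>R A) *v x) \<bullet> y)"
    by (rule bounded_linear.sums[OF bounded_linear_inner_left matrix_exp_vec_sums])
  ultimately show ?thesis by (simp add: p sums_unique2)
qed

lemma matrix_exp_vec_derivative:
  fixes A :: "real^'k^'k"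
  shows "((\<lambda>v. matrix_exp (v *\<^sub>R A) *v u) has_vector_derivative matrix_exp (v *\<^sub>R A) *v (A *v u)) (at v)"
proof -
  have entry: "(\<lambda>k. (matrix_power A k *v w) $ i / fact k * y ^ k) sums ((matrix_exp (y *\<^sub>R A) *v w) $ i)" for w y i
    using bounded_linear.sums[OF bounded_linear_vec_nth matrix_exp_vec_sums[of y A w], of i]
    by (simp add: mult.commute)
  have "((\<lambda>v. (matrix_exp (v *\<^sub>R A) *v u) $ i) has_field_derivative (matrix_exp (v *\<^sub>R A) *v (A *v u)) $ i) (at v)" for i
  proof -
    let ?c = "\<lambda>k. (matrix_power A k *v u) $ i / fact k"
    have "((\<lambda>x. \<Sum>n. ?c n * x ^ n) has_field_derivative (\<Sum>n. diffs ?c n * v ^ n)) (at v)"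
      by (rule termdiffs_strong_converges_everywhere) (rule sums_summable[OF entry])
    moreover have "(\<Sum>n. ?c n * x ^ n) = (matrix_exp (x *\<^sub>R A) *v u) $ i" for x
      by (rule sums_unique[OF entry, symmetric])
    moreover have "diffs ?c n = (matrix_power A n *v (A *v u)) $ i / fact n" for n
    proof -
      have "matrix_power A (Suc n) *v u = matrix_power A n *v (A *v u)"
        by (simp add: matrix_vector_mul_assoc matrix_power_commute)
      then show ?thesis unfolding diffs_def fact_Suc by (simp del: of_nat_Suc matrix_power.simps)
    qed
    then have "(\<Sum>n. diffs ?c n * v ^ n) = (matrix_exp (v *\<^sub>R A) *v (A *v u)) $ i"
      using sums_unique[OF entry[of "A *v u" i v], symmetric] by simp
    ultimately show ?thesis by simp
  qed
  then have "((\<lambda>v. (matrix_exp (v *\<^sub>R A) *v u) $ i) has_vector_derivative (matrix_exp (v *\<^sub>R A) *v (A *v u)) $ i) (at v)" for i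
    by (simp add: has_real_derivative_iff_has_vector_derivative)
  then show ?thesis
    unfolding has_vector_derivative_def
    by (subst has_derivative_componentwise_within)
      (auto simp: Basis_vec_def inner_axis)
qed

text \<open>
  \<open>|exp (v A) u|\<^sup>2 exp (2 e v)\<close> has nonpositive derivative.
\<close>
lemma matrix_exp_vec_decay:
  fixes A :: "real^'k^'k"
  assumes neg: "\<And>u. u \<bullet> (A *v u) \<le> - e * (norm u)\<^sup>2" and v: "0 \<le> v"
  shows "norm (matrix_exp (v *\<^sub>R A) *v u) \<le> exp (- e * v) * norm u"
proof -
  define Z where "Z v = matrix_exp (v *\<^sub>R A) *v u" for v
  have dZ: "(Z has_vector_derivative A *v Z v) (at v)" for v
    using matrix_exp_vec_derivative[of A u v] by (simp add: Z_def[abs_def] matrix_exp_vec_commute)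
  define \<phi> where "\<phi> v = (Z v \<bullet> Z v) * exp (2 * e * v)" for v
  have d1: "(\<phi> has_real_derivative (2 * (Z v \<bullet> (A *v Z v)) + 2 * e * (Z v \<bullet> Z v)) * exp (2 * e * v)) (at v)" for v
  proof -
    have "((\<lambda>v. Z v \<bullet> Z v) has_real_derivative (Z v \<bullet> (A *v Z v) + (A *v Z v) \<bullet> Z v)) (at v)"
      unfolding has_real_derivative_iff_has_vector_derivative
      by (rule bounded_bilinear.has_vector_derivative[OF bounded_bilinear_inner dZ dZ])
    from DERIV_mult[OF this, of "\<lambda>v. exp (2 * e * v)" "exp (2 * e * v) * (2 * e)"]
    show ?thesis unfolding \<phi>_def
      by (rule back_subst[where P="\<lambda>d. DERIV _ _ :> d"]) 
        (auto intro!: derivative_eq_intros simp: inner_commute algebra_simps)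
  qed
  have d2: "(2 * (Z v \<bullet> (A *v Z v)) + 2 * e * (Z v \<bullet> Z v)) * exp (2 * e * v) \<le> 0" for v
    using neg[of "Z v"] by (intro mult_nonpos_nonneg) (auto simp: power2_norm_eq_inner)
  have "\<phi> v \<le> \<phi> 0"
  proof (rule DERIV_nonpos_imp_nonincreasing[OF v])
    fix x
    show "\<exists>y. DERIV \<phi> x :> y \<and> y \<le> 0" by (rule exI, rule conjI, rule d1, rule d2)
  qed
  then have "(norm (Z v))\<^sup>2 * exp (2 * e * v) \<le> (norm u)\<^sup>2"
    by (simp add: \<phi>_def power2_norm_eq_inner Z_def matrix_exp_zero_vec[unfolded scaleR_zero_left])
  then have "(norm (Z v) * exp (e * v))\<^sup>2 \<le> (norm u)\<^sup>2"
    by (simp add: power_mult_distrib exp_double[symmetric] mult.assoc)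
  then have "norm (Z v) * exp (e * v) \<le> norm u" by (rule power2_le_imp_le) simp
  then show ?thesis by (simp add: Z_def exp_minus field_simps)
qed

lemma exp_set_integrable:
  assumes "0 < (c::real)"
  shows "set_integrable lborel {0..} (\<lambda>x::real. exp (- c * x))"
proof -
  have "(\<lambda>x. exp (- c * x)) absolutely_integrable_on {0..}"
    by (rule nonnegative_absolutely_integrable_1[OF integrable_on_exp_minus_to_infinity[OF assms]]) simp
  then show ?thesis unfolding set_integrable_def
    by (subst (asm) integrable_completion) auto
qed

text \<open>
  With \<open>F v = exp (v A) Q exp (v A)\<close>, the function \<open>u \<bullet> F v u\<close> has derivative \<open>2 (A u \<bullet> F v u)\<close>, equals
  \<open>u \<bullet> Q u\<close> at \<open>0\<close> and decays exponentially; integrate over the half-line. The second claim is the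
  Lyapunov equation \<open>A I + I A = - Q\<close> as an identity of quadratic forms.
\<close>
theorem lyapunov_integral:
  fixes A Q :: "real^'k^'k"
  assumes sym: "transpose A = A" and stable: "stable_matrix A" and Qsym: "transpose Q = Q"
  defines "I \<equiv> (LBINT v:{0..}. matrix_exp (v *\<^sub>R A) ** Q ** matrix_exp (v *\<^sub>R transpose A))"
  shows "x \<bullet> (I *v y) = (I *v x) \<bullet> y"
    and "2 * ((A *v u) \<bullet> (I *v u)) = - (u \<bullet> (Q *v u))"
proof -
  obtain e where e: "0 < e" "\<And>u. u \<bullet> (A *v u) \<le> - e * (norm u)\<^sup>2"
    using stable_symmetric_negative[OF sym stable] by blast
  define Z where "Z u v = matrix_exp (v *\<^sub>R A) *v u" for u v
  define F where "F v = matrix_exp (v *\<^sub>R A) ** Q ** matrix_exp (v *\<^sub>R A)" for v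
  have FZ: "x \<bullet> (F v *v y) = Z x v \<bullet> (Q *v Z y v)" for x y v
    by (simp add: F_def Z_def matrix_vector_mul_assoc[symmetric] matrix_exp_symmetric_inner[OF sym])
  have dZ: "(Z u has_vector_derivative Z (A *v u) v) (at v)" for u v
    unfolding Z_def by (rule matrix_exp_vec_derivative)
  have cZ: "continuous_on UNIV (Z u)" for u
    by (meson dZ continuous_at_imp_continuous_on has_vector_derivative_continuous)
  have cFZ: "continuous_on UNIV (\<lambda>v. x \<bullet> (F v *v y))" for x y
    unfolding FZ by (intro continuous_intros cZ continuous_on_compose2[OF matrix_vector_mult_linear_continuous_on[of UNIV]]) auto
  have eqF: "F = (\<lambda>v. \<chi> i j. axis i 1 \<bullet> (F v *v axis j 1))"
    by (simp add: fun_eq_iff vec_eq_iff matrix_entry_inner)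
  have "continuous_on UNIV (\<lambda>v. \<chi> i j. axis i 1 \<bullet> (F v *v axis j 1))"
    by (intro continuous_on_vec_lambda cFZ)
  then have "continuous_on UNIV F" by (subst eqF)
  then have Fm[measurable]: "F \<in> borel_measurable borel" by (rule borel_measurable_continuous_onI)
  obtain q where q: "0 \<le> q" "\<And>w. norm (Q *v w) \<le> norm w * q"
    using bounded_linear.nonneg_bounded[OF matrix_vector_mul_bounded_linear, of Q] by blast
  have Fb: "\<bar>x \<bullet> (F v *v y)\<bar> \<le> (norm x * norm y * q) * exp (- (2 * e) * v)" if "0 \<le> v" for x y v
  proof -
    have d: "norm (Z w v) \<le> exp (- e * v) * norm w" for w
      unfolding Z_def by (rule matrix_exp_vec_decay[OF e(2) that])
    have "\<bar>x \<bullet> (F v *v y)\<bar> \<le> norm (Z x v) * norm (Q *v Z y v)" unfolding FZ by (rule Cauchy_Schwarz_ineq2)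
    also have "\<dots> \<le> (exp (- e * v) * norm x) * ((exp (- e * v) * norm y) * q)"
      using d q by (intro mult_mono order_trans[OF q(2)] mult_right_mono) auto
    also have "\<dots> = (norm x * norm y * q) * exp (- (2 * e) * v)"
      by (simp add: exp_add[symmetric] mult_ac)
    finally show ?thesis .
  qed
  define n where "n = real CARD('k)"
  have Fi: "set_integrable lborel {0..} F"
  proof (rule set_integrable_bound)
    show "set_integrable lborel {0..} (\<lambda>v. (n * n * q) *\<^sub>R exp (- (2 * e) * v))"
      by (intro set_integrable_scaleR_right exp_set_integrable) (use e in simp)
    show "set_borel_measurable lborel {0..} F" unfolding set_borel_measurable_def by measurable
    have "norm (F v) \<le> norm ((n * n * q) *\<^sub>R exp (- (2 * e) * v))" if "0 \<le> v" for v
    proof -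
      have "\<bar>F v $ i $ j\<bar> \<le> q * exp (- (2 * e) * v)" for i j
        using Fb[OF that, of "axis i 1" "axis j 1"] by (simp add: matrix_entry_inner)
      then have "norm (F v) \<le> (\<Sum>i\<in>(UNIV::'k set). \<Sum>j\<in>(UNIV::'k set). q * exp (- (2 * e) * v))"
        by (intro order_trans[OF norm_matrix_le_entries] sum_mono)
      also have "\<dots> = norm ((n * n * q) *\<^sub>R exp (- (2 * e) * v))" using q by (simp add: n_def abs_mult)
      finally show ?thesis .
    qed
    then show "AE v in lborel. v \<in> {0..} \<longrightarrow> norm (F v) \<le> norm ((n * n * q) *\<^sub>R exp (- (2 * e) * v))" by simp
  qed
  have IF: "I = (LBINT v:{0..}. F v)" by (simp add: I_def F_def sym)
  have bl: "bounded_linear (\<lambda>M::real^'k^'k. x \<bullet> (M *v y))" for x y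
    by (intro linear_conv_bounded_linear[THEN iffD1] linearI)
      (simp_all add: matrix_vector_mult_add_rdistrib scaleR_matrix_vector_assoc[symmetric] inner_add_right)
  have Ient: "x \<bullet> (I *v y) = (LBINT v:{0..}. x \<bullet> (F v *v y))" and
    ient: "set_integrable lborel {0..} (\<lambda>v. x \<bullet> (F v *v y))" for x y
  proof -
    have *: "x \<bullet> ((indicat_real {0..} v *\<^sub>R F v) *v y) = indicat_real {0..} v *\<^sub>R (x \<bullet> (F v *v y))" for v
      by (simp add: scaleR_matrix_vector_assoc[symmetric])
    show "x \<bullet> (I *v y) = (LBINT v:{0..}. x \<bullet> (F v *v y))"
      using integral_bounded_linear[OF bl Fi[unfolded set_integrable_def], of x y]
      unfolding IF set_lebesgue_integral_def by (simp add: *)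
    show "set_integrable lborel {0..} (\<lambda>v. x \<bullet> (F v *v y))"
      using integrable_bounded_linear[OF bl Fi[unfolded set_integrable_def], of x y]
      unfolding set_integrable_def by (simp add: *)
  qed
  have Fsym: "x \<bullet> (F v *v y) = y \<bullet> (F v *v x)" for x y v
    unfolding FZ by (metis symmetric_matrix_inner[OF Qsym] inner_commute)
  show "x \<bullet> (I *v y) = (I *v x) \<bullet> y"
  proof -
    have "x \<bullet> (I *v y) = y \<bullet> (I *v x)" unfolding Ient by (subst Fsym) (rule refl)
    then show ?thesis by (simp add: inner_commute)
  qed
  define f where "f v = 2 * ((A *v u) \<bullet> (F v *v u))" for v
  define f0 where "f0 v = u \<bullet> (F v *v u)" for v
  have df: "(f0 has_vector_derivative f v) (at v)" for v
  proof -
    have dQ: "((\<lambda>v. Q *v Z u v) has_vector_derivative Q *v Z (A *v u) v) (at v)"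
      by (rule bounded_linear.has_vector_derivative[OF matrix_vector_mul_bounded_linear dZ])
    have "((\<lambda>v. Z u v \<bullet> (Q *v Z u v)) has_vector_derivative (Z u v \<bullet> (Q *v Z (A *v u) v) + Z (A *v u) v \<bullet> (Q *v Z u v))) (at v)"
      by (rule bounded_bilinear.has_vector_derivative[OF bounded_bilinear_inner dZ dQ])
    moreover have "Z u v \<bullet> (Q *v Z (A *v u) v) = Z (A *v u) v \<bullet> (Q *v Z u v)"
      by (metis symmetric_matrix_inner[OF Qsym] inner_commute)
    ultimately show ?thesis by (simp add: f0_def[abs_def] f_def FZ)
  qed
  have "(LBINT v=0..\<infinity>. f v) = 0 - f0 0"
  proof (rule interval_integral_FTC_integrable)
    show "isCont f v" for v
      using cFZ[of "A *v u" u] unfolding f_def isCont_def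
      by (intro tendsto_mult_left) (simp add: continuous_on_eq_continuous_at isCont_def)
    have "set_integrable lborel {0..} f"
      unfolding f_def by (intro set_integrable_mult_right ient)
    then show "set_integrable lborel (einterval 0 \<infinity>) f"
      by (rule set_integrable_subset) (auto simp: einterval_def)
    have "(f0 \<longlongrightarrow> f0 0) (at_right 0)"
      using cFZ[of u u] unfolding f0_def by (auto simp: continuous_on_eq_continuous_at isCont_def intro: filterlim_at_split[THEN iffD1, THEN conjunct2])
    then show "((f0 \<circ> real_of_ereal) \<longlongrightarrow> f0 0) (at_right 0)"
      by (simp add: ereal_tendsto_simps zero_ereal_def)
    have "(f0 \<longlongrightarrow> 0) at_top"
    proof (rule Lim_null_comparison)
      show "\<forall>\<^sub>F v in at_top. norm (f0 v) \<le> (norm u * norm u * q) * exp (- (2 * e) * v)"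
        using eventually_ge_at_top[of 0] by eventually_elim (simp only: f0_def real_norm_def Fb)
      have "((\<lambda>v. exp (- (2 * e) * v)) \<longlongrightarrow> 0) at_top"
        using e(1) by real_asymp
      from tendsto_mult_left[OF this, of "norm u * norm u * q"]
      show "((\<lambda>v. (norm u * norm u * q) * exp (- (2 * e) * v)) \<longlongrightarrow> 0) at_top" by simp
    qed
    then show "((f0 \<circ> real_of_ereal) \<longlongrightarrow> 0) (at_left \<infinity>)"
      by (simp add: ereal_tendsto_simps)
  qed (use df in auto)
  moreover have "f0 0 = u \<bullet> (Q *v u)"
    using matrix_exp_zero_vec[of A] by (simp add: f0_def FZ Z_def)
  moreover have "(LBINT v=0..\<infinity>. f v) = (LBINT v:{0..}. f v)"
  proof -
    have "(LBINT v=0..\<infinity>. f v) = (LBINT v:{0<..}. f v)"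
      using interval_integral_to_infinity_eq[of lborel 0 f] by (simp add: zero_ereal_def)
    also have "\<dots> = (LBINT v:{0..}. f v)"
      unfolding set_lebesgue_integral_def
    proof (rule integral_cong_AE)
      have [measurable]: "f \<in> borel_measurable borel"
        unfolding f_def by (intro borel_measurable_times borel_measurable_const borel_measurable_continuous_onI[OF cFZ])
      show "(\<lambda>v. indicat_real {0<..} v *\<^sub>R f v) \<in> borel_measurable lborel"
        "(\<lambda>v. indicat_real {0..} v *\<^sub>R f v) \<in> borel_measurable lborel" by measurable
      show "AE v in lborel. indicat_real {0<..} v *\<^sub>R f v = indicat_real {0..} v *\<^sub>R f v"
        using AE_lborel_singleton[of "0::real"] by eventually_elim (auto simp: indicator_def)
    qed
    finally show ?thesis .
  qed
  ultimately show "2 * ((A *v u) \<bullet> (I *v u)) = - (u \<bullet> (Q *v u))"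
    by (simp add: f_def Ient)
qed

section \<open>Smoothed nonlinearities\<close>

lemma admissible_measurable: "admissible_nonlinearity \<Psi> \<Longrightarrow> \<Psi> \<in> borel_measurable borel"
  by (auto simp: admissible_nonlinearity_def intro: borel_measurable_mono)

lemma noise_pdf_measurable: "noise_pdf p \<Longrightarrow> p \<in> borel_measurable borel"
  by (simp add: noise_pdf_def)

lemma noise_pdf_integrable:
  assumes "noise_pdf p"
  shows "integrable lborel p"
  using assms by (intro integrableI_nonneg) (auto simp: noise_pdf_def)

lemma smoothed_integrable:
  assumes \<Psi>: "admissible_nonlinearity \<Psi>" and p: "noise_pdf p"
  shows "integrable lborel (\<lambda>w. \<Psi> (u + w) * p w)"
proof -
  obtain c where c: "\<And>u. \<bar>\<Psi> u\<bar> \<le> c" using \<Psi> by (auto simp: admissible_nonlinearity_def)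
  note [measurable] = admissible_measurable[OF \<Psi>] noise_pdf_measurable[OF p]
  have p0: "0 \<le> p w" for w using p by (simp add: noise_pdf_def)
  have "integrable lborel (\<lambda>w. c * p w)" using noise_pdf_integrable[OF p] by simp
  then show ?thesis
  proof (rule Bochner_Integration.integrable_bound)
    have "\<bar>\<Psi> (u + w) * p w\<bar> \<le> \<bar>c * p w\<bar>" for w
      using c[of "u + w"] p0[of w] by (auto simp: abs_mult intro!: mult_right_mono)
    then show "AE w in lborel. norm (\<Psi> (u + w) * p w) \<le> norm (c * p w)" by simp
  qed measurable
qed

lemma smoothed_odd:
  assumes \<Psi>: "admissible_nonlinearity \<Psi>" and p: "noise_pdf p"
  shows "smoothed \<Psi> p (- u) = - smoothed \<Psi> p u"
proof -
  have "smoothed \<Psi> p (- u) = (\<integral>w. \<Psi> (- u + - w) * p (- w) \<partial>lborel)"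
    unfolding smoothed_def
    using lborel_integral_real_affine[of "-1" "\<lambda>w. \<Psi> (- u + w) * p w" 0] by simp
  also have "\<dots> = (\<integral>w. - (\<Psi> (u + w) * p w) \<partial>lborel)"
  proof (rule Bochner_Integration.integral_cong[OF refl])
    fix w
    have "\<Psi> (- u + - w) = - \<Psi> (u + w)"
      using \<Psi> by (metis admissible_nonlinearity_def minus_add_distrib)
    then show "\<Psi> (- u + - w) * p (- w) = - (\<Psi> (u + w) * p w)" using p by (simp add: noise_pdf_def)
  qed
  finally show ?thesis by (simp add: smoothed_def)
qed

lemma smoothed_mono:
  assumes \<Psi>: "admissible_nonlinearity \<Psi>" and p: "noise_pdf p" and "u \<le> v"
  shows "smoothed \<Psi> p u \<le> smoothed \<Psi> p v"
  unfolding smoothed_def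
proof (rule integral_mono[OF smoothed_integrable[OF \<Psi> p] smoothed_integrable[OF \<Psi> p]])
  fix w
  have "\<Psi> (u + w) \<le> \<Psi> (v + w)" using \<Psi> assms(3) by (auto simp: admissible_nonlinearity_def mono_def)
  then show "\<Psi> (u + w) * p w \<le> \<Psi> (v + w) * p w" using p by (intro mult_right_mono) (auto simp: noise_pdf_def)
qed

lemma smoothed_zero:
  assumes "admissible_nonlinearity \<Psi>" "noise_pdf p"
  shows "smoothed \<Psi> p 0 = 0"
  using smoothed_odd[OF assms, of 0] by simp

lemma (in prob_space) expectation_shifted_nonlinearity:
  assumes \<Psi>: "admissible_nonlinearity \<Psi>" and p: "noise_pdf p" and X: "distributed M lborel X p"
  shows "expectation (\<lambda>\<omega>. \<Psi> (u + X \<omega>)) = smoothed \<Psi> p u"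
proof -
  note [measurable] = admissible_measurable[OF \<Psi>]
  have "(\<integral>w. p w * \<Psi> (u + w) \<partial>lborel) = expectation (\<lambda>\<omega>. \<Psi> (u + X \<omega>))"
    by (rule distributed_integral[OF X]) (use p in \<open>auto simp: noise_pdf_def\<close>)
  then show ?thesis by (simp add: smoothed_def mult.commute)
qed

lemma (in prob_space) expectation_nonlinearity_square:
  assumes \<Psi>: "admissible_nonlinearity \<Psi>" and p: "noise_pdf p" and X: "distributed M lborel X p"
  shows "expectation (\<lambda>\<omega>. \<Psi> (X \<omega>) * \<Psi> (X \<omega>)) = effective_variance \<Psi> p"
proof -
  note [measurable] = admissible_measurable[OF \<Psi>]
  have "(\<integral>w. p w * (\<Psi> w * \<Psi> w) \<partial>lborel) = expectation (\<lambda>\<omega>. \<Psi> (X \<omega>) * \<Psi> (X \<omega>))"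
    by (rule distributed_integral[OF X]) (use p in \<open>auto simp: noise_pdf_def\<close>)
  then show ?thesis by (simp add: effective_variance_def power2_eq_square mult.commute)
qed

text \<open>
  The discontinuities form a Lebesgue null set and the noise has a density.
\<close>
lemma (in prob_space) nonlinearity_continuous_at_noise:
  assumes \<Psi>: "admissible_nonlinearity \<Psi>" and X: "distributed M lborel X p"
  shows "AE \<omega> in M. isCont \<Psi> (X \<omega>)"
proof -
  have "AE u in lebesgue. isCont \<Psi> u"
    using \<Psi> by (intro AE_I'[where N="{u. \<not> isCont \<Psi> u}"]) (auto simp: admissible_nonlinearity_def)
  then have "AE u in lborel. isCont \<Psi> u" by (simp add: AE_completion_iff)
  then obtain Z where Z: "{u. \<not> isCont \<Psi> u} \<subseteq> Z" "Z \<in> sets borel" "emeasure lborel Z = 0"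
    by (auto elim!: AE_E)
  have "AE u in lborel. 0 < p u \<longrightarrow> u \<notin> Z"
    by (rule AE_I'[where N=Z]) (use Z in \<open>auto simp: null_sets_def\<close>)
  moreover have "Measurable.pred lborel (\<lambda>u. u \<notin> Z)" using Z(2) by measurable
  ultimately have "AE \<omega> in M. X \<omega> \<notin> Z"
    using distributed_AE2[OF X, of "\<lambda>u. u \<notin> Z"] by simp
  then show ?thesis by eventually_elim (use Z in blast)
qed

section \<open>Block structure of the network matrices\<close>

definition block :: "real^('n::finite \<times> 'm::finite) \<Rightarrow> 'n \<Rightarrow> real^'m" where
  "block y i = (\<chi> l. y $ (i, l))"

lemma sum_pairs: "(\<Sum>s\<in>UNIV. f s) = (\<Sum>i\<in>UNIV. \<Sum>l\<in>UNIV. f (i, l))"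
  for f :: "'n::finite \<times> 'm::finite \<Rightarrow> 'b::comm_monoid_add"
  by (simp add: sum.cartesian_product UNIV_Times_UNIV)

lemma kron_laplacian_mult:
  fixes E :: "'n::finite set set" and y :: "real^('n \<times> 'm::finite)"
  assumes "simple_graph E"
  shows "(kron (laplacian E) (mat 1 :: real^'m^'m) *v y) $ (i, l) = (\<Sum>j\<in>neighbours E i. y $ (i, l) - y $ (j, l))"
proof -
  have "(kron (laplacian E) (mat 1 :: real^'m^'m) *v y) $ (i, l) = (\<Sum>j\<in>UNIV. laplacian E $ i $ j * y $ (j, l))"
    by (simp add: matrix_vector_mult_def kron_def sum_pairs mat_def if_distrib if_distribR cong: if_cong)
  also have "\<dots> = (\<Sum>j\<in>UNIV. (if i = j then real (degree_of E i) * y $ (i, l) else 0) - (if {i, j} \<in> E then y $ (j, l) else 0))"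
    by (intro sum.cong) (auto simp: laplacian_def degree_matrix_def adjacency_matrix_def algebra_simps)
  also have "\<dots> = real (degree_of E i) * y $ (i, l) - (\<Sum>j\<in>neighbours E i. y $ (j, l))"
    by (simp add: sum_subtractf sum.If_cases neighbours_def)
  also have "\<dots> = (\<Sum>j\<in>neighbours E i. y $ (i, l) - y $ (j, l))"
    by (simp add: sum_subtractf degree_of_def)
  finally show ?thesis .
qed

lemma observation_matrix_mult: "(observation_matrix h *v y) $ i = h i \<bullet> block y i"
proof -
  have "(observation_matrix h *v y) $ i = (\<Sum>j\<in>UNIV. \<Sum>l\<in>UNIV. if j = i then h i $ l * y $ (i, l) else 0)"
    unfolding matrix_vector_mult_def observation_matrix_def by (auto simp: sum_pairs intro!: sum.cong)
  also have "\<dots> = (\<Sum>j\<in>UNIV. if j = i then (\<Sum>l\<in>UNIV. h i $ l * y $ (i, l)) else 0)"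
    by (intro sum.cong) auto
  finally show ?thesis by (simp add: inner_vec_def block_def)
qed

lemma observation_gram_mult:
  "((transpose (observation_matrix h) ** observation_matrix h) *v y) $ (i, l) = h i $ l * (h i \<bullet> block y i)"
proof -
  have "((transpose (observation_matrix h) ** observation_matrix h) *v y) $ (i, l)
     = (\<Sum>k\<in>UNIV. observation_matrix h $ k $ (i, l) * (observation_matrix h *v y) $ k)"
    unfolding matrix_vector_mul_assoc[symmetric]
    by (subst matrix_vector_mul_component) (simp add: inner_vec_def transpose_def)
  also have "\<dots> = (\<Sum>k\<in>UNIV. if i = k then h k $ l * (h k \<bullet> block y k) else 0)"
    by (intro sum.cong) (auto simp: observation_matrix_mult, auto simp: observation_matrix_def)
  finally show ?thesis by simp
qed

lemma neighbours_arcs: "j \<in> neighbours E i \<longleftrightarrow> (i, j) \<in> arcs_of E"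
  by (simp add: neighbours_def arcs_of_def)

lemma arcs_sym: "(i, j) \<in> arcs_of E \<longleftrightarrow> (j, i) \<in> arcs_of E"
  by (simp add: arcs_of_def insert_commute)

text \<open>
  Exchange the ends of every link: oddness turns the factor \<open>y i\<close> into \<open>- y j\<close>.
\<close>
lemma laplacian_form_symmetrised:
  fixes f :: "real \<Rightarrow> real" and y :: "'n::finite \<Rightarrow> real"
  assumes odd: "\<And>u. f (- u) = - f u"
  shows "2 * (\<Sum>i\<in>UNIV. \<Sum>j\<in>neighbours E i. y i * f (c * (y i - y j)))
    = (\<Sum>i\<in>UNIV. \<Sum>j\<in>neighbours E i. (y i - y j) * f (c * (y i - y j)))"
proof -
  let ?A = "\<lambda>i j. if (i, j) \<in> arcs_of E then 1 else (0::real)"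
  have ext: "(\<Sum>j\<in>neighbours E i. g j) = (\<Sum>j\<in>UNIV. ?A i j * g j)" for i and g :: "'n \<Rightarrow> real"
    by (subst sum.mono_neutral_left[of UNIV "neighbours E i" "\<lambda>j. ?A i j * g j", symmetric])
      (auto simp: neighbours_arcs intro!: sum.cong)
  have "(\<Sum>i\<in>UNIV. \<Sum>j\<in>UNIV. ?A i j * (y j * f (c * (y i - y j)))) = (\<Sum>j\<in>UNIV. \<Sum>i\<in>UNIV. ?A i j * (y j * f (c * (y i - y j))))"
    by (rule sum.swap)
  also have "\<dots> = (\<Sum>j\<in>UNIV. \<Sum>i\<in>UNIV. - (?A j i * (y j * f (c * (y j - y i)))))"
  proof (intro sum.cong refl)
    fix i j
    have "f (c * (y i - y j)) = - f (c * (y j - y i))"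
      using odd[of "c * (y j - y i)"] by (simp add: algebra_simps)
    then show "?A i j * (y j * f (c * (y i - y j))) = - (?A j i * (y j * f (c * (y j - y i))))"
      using arcs_sym[of i j E] by simp
  qed
  also have "\<dots> = - (\<Sum>i\<in>UNIV. \<Sum>j\<in>UNIV. ?A i j * (y i * f (c * (y i - y j))))"
    by (simp add: sum_negf)
  finally show ?thesis
    by (simp add: ext left_diff_distrib right_diff_distrib sum_subtractf)
qed

section \<open>The consensus+innovations update at one time step\<close>

text \<open>
  Here \<open>y\<close> is the stacked error, the first component of \<open>v\<close> the observation noise and the second the
  communication noise on each arc. The error of agent \<open>i\<close> enters the observation
  residual as \<open>n i - h i \<bullet> block y i\<close> and the target no longer occurs.
\<close>
definition consensus_update :: "'n::finite set set \<Rightarrow> ('n \<Rightarrow> real^'m::finite) \<Rightarrow> real \<Rightarrow> (real \<Rightarrow> real) \<Rightarrow> (real \<Rightarrow> real)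
    \<Rightarrow> real^('n \<times> 'm) \<Rightarrow> (real^'n) \<times> ('n \<times> 'n \<Rightarrow> real^'m) \<Rightarrow> real^('n \<times> 'm)" where
  "consensus_update E h r \<Psi>\<^sub>c \<Psi>\<^sub>o y v = (\<chi> s.
     r * (\<Sum>j\<in>neighbours E (fst s). \<Psi>\<^sub>c (y $ s - y $ (j, snd s) + snd v (fst s, j) $ snd s))
       - h (fst s) $ snd s * \<Psi>\<^sub>o (fst v $ fst s - h (fst s) \<bullet> block y (fst s)))"

lemma borel_measurable_vec_component:
  fixes f :: "'a \<Rightarrow> real^'k"
  assumes "f \<in> borel_measurable M"
  shows "(\<lambda>x. f x $ i) \<in> borel_measurable M"
  by (rule measurable_compose[OF assms]) (intro borel_measurable_continuous_onI continuous_intros)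

lemma borel_measurable_vec_iff:
  fixes f :: "'a \<Rightarrow> real^'k"
  assumes "\<And>i. (\<lambda>x. f x $ i) \<in> borel_measurable M"
  shows "f \<in> borel_measurable M"
  using assms by (auto simp: borel_measurable_euclidean_space[where f=f] Basis_vec_def inner_axis)

lemma consensus_update_measurable:
  assumes [measurable]: "\<Psi>\<^sub>c \<in> borel_measurable borel" "\<Psi>\<^sub>o \<in> borel_measurable borel"
  shows "case_prod (consensus_update E h r \<Psi>\<^sub>c \<Psi>\<^sub>o)
    \<in> borel \<Otimes>\<^sub>M (borel \<Otimes>\<^sub>M Pi\<^sub>M (arcs_of E) (\<lambda>_. borel)) \<rightarrow>\<^sub>M borel"
proof (rule borel_measurable_vec_iff)
  fix s :: "'a \<times> 'b"
  let ?M = "borel \<Otimes>\<^sub>M (borel \<Otimes>\<^sub>M Pi\<^sub>M (arcs_of E) (\<lambda>_. borel)) :: ((real^('a \<times> 'b)) \<times> (real^'a) \<times> ('a \<times> 'a \<Rightarrow> real^'b)) measure"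
  have y[measurable]: "(\<lambda>p. fst p $ i) \<in> borel_measurable ?M" for i
    by (rule borel_measurable_vec_component) measurable
  have n[measurable]: "(\<lambda>p. fst (snd p) $ i) \<in> borel_measurable ?M" for i
    by (rule borel_measurable_vec_component) measurable
  have x[measurable]: "(\<lambda>p. snd (snd p) (fst s, j) $ l) \<in> borel_measurable ?M" if "j \<in> neighbours E (fst s)" for j l
  proof (rule borel_measurable_vec_component)
    have arc: "(fst s, j) \<in> arcs_of E" using that by (simp add: neighbours_arcs)
    have "(\<lambda>p. snd (snd p)) \<in> ?M \<rightarrow>\<^sub>M Pi\<^sub>M (arcs_of E) (\<lambda>_. borel)"
      by (rule measurable_compose[OF measurable_snd measurable_snd])
    from measurable_compose[OF this measurable_component_singleton[OF arc]]
    show "(\<lambda>p. snd (snd p) (fst s, j)) \<in> borel_measurable ?M" .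
  qed
  have i[measurable]: "(\<lambda>p. h (fst s) \<bullet> block (fst p) (fst s)) \<in> borel_measurable ?M"
    unfolding inner_vec_def block_def by simp
  have "(\<lambda>p. r * (\<Sum>j\<in>neighbours E (fst s). \<Psi>\<^sub>c (fst p $ s - fst p $ (j, snd s) + snd (snd p) (fst s, j) $ snd s))
       - h (fst s) $ snd s * \<Psi>\<^sub>o (fst (snd p) $ fst s - h (fst s) \<bullet> block (fst p) (fst s))) \<in> borel_measurable ?M"
  proof (intro borel_measurable_diff borel_measurable_times borel_measurable_const borel_measurable_sum)
    fix j assume "j \<in> neighbours E (fst s)"
    note [measurable] = x[OF this]
    show "(\<lambda>p. \<Psi>\<^sub>c (fst p $ s - fst p $ (j, snd s) + snd (snd p) (fst s, j) $ snd s)) \<in> borel_measurable ?M"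
      by measurable
  qed measurable
  then show "(\<lambda>p. case_prod (consensus_update E h r \<Psi>\<^sub>c \<Psi>\<^sub>o) p $ s) \<in> borel_measurable ?M"
    by (simp add: consensus_update_def split_beta')
qed

lemma consensus_update_bounded:
  assumes "admissible_nonlinearity \<Psi>\<^sub>c" "admissible_nonlinearity \<Psi>\<^sub>o"
  shows "\<exists>C. \<forall>y v. norm (consensus_update E h r \<Psi>\<^sub>c \<Psi>\<^sub>o y v) \<le> C"
proof -
  obtain c d where c: "\<And>u. \<bar>\<Psi>\<^sub>c u\<bar> \<le> c" and d: "\<And>u. \<bar>\<Psi>\<^sub>o u\<bar> \<le> d"
    using assms by (auto simp: admissible_nonlinearity_def)
  define C where "C = (\<Sum>s\<in>UNIV. \<bar>r\<bar> * (\<Sum>j\<in>neighbours E (fst s). c) + \<bar>h (fst s) $ snd s\<bar> * d)"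
  have "norm (consensus_update E h r \<Psi>\<^sub>c \<Psi>\<^sub>o y v) \<le> C" for y v
  proof (rule order_trans[OF norm_le_l1_cart])
    show "(\<Sum>s\<in>UNIV. \<bar>consensus_update E h r \<Psi>\<^sub>c \<Psi>\<^sub>o y v $ s\<bar>) \<le> C"
      unfolding C_def
    proof (rule sum_mono)
      fix s :: "'a \<times> 'b"
      have "\<bar>consensus_update E h r \<Psi>\<^sub>c \<Psi>\<^sub>o y v $ s\<bar> \<le>
          \<bar>r * (\<Sum>j\<in>neighbours E (fst s). \<Psi>\<^sub>c (y $ s - y $ (j, snd s) + snd v (fst s, j) $ snd s))\<bar>
        + \<bar>h (fst s) $ snd s * \<Psi>\<^sub>o (fst v $ fst s - h (fst s) \<bullet> block y (fst s))\<bar>"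
        unfolding consensus_update_def vec_lambda_beta by (rule abs_triangle_ineq4)
      also have "\<dots> \<le> \<bar>r\<bar> * (\<Sum>j\<in>neighbours E (fst s). c) + \<bar>h (fst s) $ snd s\<bar> * d"
        unfolding abs_mult
        by (intro add_mono mult_left_mono order_trans[OF sum_abs] sum_mono c d) auto
      finally show "\<bar>consensus_update E h r \<Psi>\<^sub>c \<Psi>\<^sub>o y v $ s\<bar> \<le> \<bar>r\<bar> * (\<Sum>j\<in>neighbours E (fst s). c) + \<bar>h (fst s) $ snd s\<bar> * d" .
    qed
  qed
  then show ?thesis by blast
qed

lemma has_derivative_vec:
  fixes f :: "'a::real_normed_vector \<Rightarrow> real^'k"
  assumes "\<And>i. ((\<lambda>x. f x $ i) has_derivative (\<lambda>x. f' x $ i)) (at x)"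
  shows "(f has_derivative f') (at x)"
  using assms by (subst has_derivative_componentwise_within) (auto simp: Basis_vec_def inner_axis)

lemma has_derivative_at_zero_comp_linear:
  fixes \<phi> :: "real \<Rightarrow> real"
  assumes \<phi>: "\<phi> differentiable at 0" and L: "bounded_linear L"
  shows "((\<lambda>y. \<phi> (L y)) has_derivative (\<lambda>y. deriv \<phi> 0 * L y)) (at 0)"
proof -
  have "(\<phi> has_real_derivative deriv \<phi> 0) (at (L 0))"
    using \<phi> L by (simp add: DERIV_deriv_iff_real_differentiable linear_0 bounded_linear.linear)
  then show ?thesis
    unfolding has_field_derivative_def
    by (rule has_derivative_compose[OF bounded_linear_imp_has_derivative[OF L]])
qed

text \<open>
  The noise at a single time. Independence enters only through vanishing correlations of the
  transformed noises; observation and communication noise may be dependent.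
\<close>
locale sensor_noise = prob_space P for P :: "'w measure" +
  fixes E :: "'n::finite set set" and h :: "'n \<Rightarrow> real^'m::finite" and r :: real
    and p\<^sub>o p\<^sub>c \<Psi>\<^sub>o \<Psi>\<^sub>c :: "real \<Rightarrow> real"
    and n :: "'n \<Rightarrow> 'w \<Rightarrow> real" and \<xi> :: "'n \<Rightarrow> 'n \<Rightarrow> 'w \<Rightarrow> real^'m"
  assumes graph: "simple_graph E" and r_nonneg: "0 \<le> r"
    and pdf_o: "noise_pdf p\<^sub>o" and pdf_c: "noise_pdf p\<^sub>c"
    and nonlin_o: "admissible_nonlinearity \<Psi>\<^sub>o" and nonlin_c: "admissible_nonlinearity \<Psi>\<^sub>c"
    and n_distr: "distributed P lborel (n i) p\<^sub>o"
    and \<xi>_distr: "(i, j) \<in> arcs_of E \<Longrightarrow> distributed P lborel (\<lambda>\<omega>. \<xi> i j \<omega> $ l) p\<^sub>c"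
    and n_uncorrelated: "i \<noteq> k \<Longrightarrow> expectation (\<lambda>\<omega>. \<Psi>\<^sub>o (n i \<omega>) * \<Psi>\<^sub>o (n k \<omega>)) = 0"
    and \<xi>_uncorrelated: "(i, j) \<in> arcs_of E \<Longrightarrow> (i', j') \<in> arcs_of E \<Longrightarrow> (i, j, l) \<noteq> (i', j', l') \<Longrightarrow>
        expectation (\<lambda>\<omega>. \<Psi>\<^sub>c (\<xi> i j \<omega> $ l) * \<Psi>\<^sub>c (\<xi> i' j' \<omega> $ l')) = 0"
begin

definition noise :: "'w \<Rightarrow> (real^'n) \<times> ('n \<times> 'n \<Rightarrow> real^'m)" where
  "noise \<omega> = (\<chi> i. n i \<omega>, \<lambda>(i, j)\<in>arcs_of E. \<xi> i j \<omega>)"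

abbreviation update :: "real^('n \<times> 'm) \<Rightarrow> 'w \<Rightarrow> real^('n \<times> 'm)" where
  "update y \<omega> \<equiv> consensus_update E h r \<Psi>\<^sub>c \<Psi>\<^sub>o y (noise \<omega>)"

definition mean_update :: "real^('n \<times> 'm) \<Rightarrow> real^('n \<times> 'm)" where
  "mean_update y = expectation (\<lambda>\<omega>. update y \<omega>)"

definition jacobian :: "real^('n \<times> 'm)^('n \<times> 'm)" where
  "jacobian = (r * deriv (smoothed \<Psi>\<^sub>c p\<^sub>c) 0) *\<^sub>R kron (laplacian E) (mat 1 :: real^'m^'m)
     + deriv (smoothed \<Psi>\<^sub>o p\<^sub>o) 0 *\<^sub>R (transpose (observation_matrix h) ** observation_matrix h)"

lemma measurable_nonlinearities [measurable]: "\<Psi>\<^sub>o \<in> borel_measurable borel" "\<Psi>\<^sub>c \<in> borel_measurable borel"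
  using nonlin_o nonlin_c by (auto intro: admissible_measurable)

lemma n_measurable [measurable]: "n i \<in> borel_measurable P"
  using distributed_measurable[OF n_distr] by simp

lemma \<xi>_measurable: "(i, j) \<in> arcs_of E \<Longrightarrow> (\<lambda>\<omega>. \<xi> i j \<omega> $ l) \<in> borel_measurable P"
  using distributed_measurable[OF \<xi>_distr] by simp

lemma update_component:
  "update y \<omega> $ (i, l) = r * (\<Sum>j\<in>neighbours E i. \<Psi>\<^sub>c (y $ (i, l) - y $ (j, l) + \<xi> i j \<omega> $ l))
     - h i $ l * \<Psi>\<^sub>o (- (h i \<bullet> block y i) + n i \<omega>)"
  by (auto simp: consensus_update_def noise_def neighbours_arcs intro!: arg_cong2[where f="(-)"] arg_cong2[where f="(*)"] sum.cong)

lemma nonlinearity_measurable_bounded: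
  assumes "admissible_nonlinearity \<Psi>" "X \<in> borel_measurable P"
  shows "integrable P (\<lambda>\<omega>. \<Psi> (X \<omega>))"
proof -
  obtain c where "\<And>u. \<bar>\<Psi> u\<bar> \<le> c" using assms by (auto simp: admissible_nonlinearity_def)
  moreover note [measurable] = admissible_measurable[OF assms(1)] assms(2)
  ultimately show ?thesis by (intro integrable_const_bound[where B=c]) auto
qed

lemma nonlinearity_product_integrable:
  assumes "admissible_nonlinearity \<Psi>" "X \<in> borel_measurable P" "admissible_nonlinearity \<Psi>'" "Y \<in> borel_measurable P"
  shows "integrable P (\<lambda>\<omega>. \<Psi> (X \<omega>) * \<Psi>' (Y \<omega>))"
proof -
  obtain c d where c: "\<And>u. \<bar>\<Psi> u\<bar> \<le> c" "\<And>u. \<bar>\<Psi>' u\<bar> \<le> d"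
    using assms by (auto simp: admissible_nonlinearity_def)
  moreover note [measurable] = admissible_measurable[OF assms(1)] admissible_measurable[OF assms(3)] assms(2,4)
  moreover have "\<bar>\<Psi> (X \<omega>) * \<Psi>' (Y \<omega>)\<bar> \<le> c * d" for \<omega>
    unfolding abs_mult using c by (intro mult_mono) (auto intro: order_trans[OF abs_ge_zero])
  ultimately show ?thesis by (intro integrable_const_bound[where B="c * d"]) auto
qed

lemma update_measurable [measurable]: "update y \<in> borel_measurable P"
proof (rule borel_measurable_vec_iff)
  fix s :: "'n \<times> 'm"
  obtain i l where s: "s = (i, l)" by (cases s)
  show "(\<lambda>\<omega>. update y \<omega> $ s) \<in> borel_measurable P"
    unfolding s update_component
  proof (intro borel_measurable_diff borel_measurable_times borel_measurable_const borel_measurable_sum)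
    fix j assume "j \<in> neighbours E i"
    then have [measurable]: "(\<lambda>\<omega>. \<xi> i j \<omega> $ l) \<in> borel_measurable P" by (intro \<xi>_measurable) (simp add: neighbours_arcs)
    show "(\<lambda>\<omega>. \<Psi>\<^sub>c (y $ (i, l) - y $ (j, l) + \<xi> i j \<omega> $ l)) \<in> borel_measurable P" by measurable
  qed measurable
qed

lemma update_integrable [simp]: "integrable P (update y)"
proof -
  obtain C where "\<And>y v. norm (consensus_update E h r \<Psi>\<^sub>c \<Psi>\<^sub>o y v) \<le> C"
    using consensus_update_bounded[OF nonlin_c nonlin_o] by blast
  then show ?thesis by (intro integrable_const_bound[where B=C]) auto
qed

lemma mean_update_component:
  "mean_update y $ (i, l) = r * (\<Sum>j\<in>neighbours E i. smoothed \<Psi>\<^sub>c p\<^sub>c (y $ (i, l) - y $ (j, l)))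
     + h i $ l * smoothed \<Psi>\<^sub>o p\<^sub>o (h i \<bullet> block y i)"
proof -
  have "mean_update y $ (i, l) = expectation (\<lambda>\<omega>. update y \<omega> $ (i, l))"
    unfolding mean_update_def
    by (rule integral_bounded_linear[OF bounded_linear_vec_nth update_integrable, symmetric])
  also have "\<dots> = r * (\<Sum>j\<in>neighbours E i. expectation (\<lambda>\<omega>. \<Psi>\<^sub>c (y $ (i, l) - y $ (j, l) + \<xi> i j \<omega> $ l)))
     - h i $ l * expectation (\<lambda>\<omega>. \<Psi>\<^sub>o (- (h i \<bullet> block y i) + n i \<omega>))"
  proof -
    have c: "integrable P (\<lambda>\<omega>. \<Psi>\<^sub>c (y $ (i, l) - y $ (j, l) + \<xi> i j \<omega> $ l))" if "j \<in> neighbours E i" for j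
      using that \<xi>_measurable[of i j l]
      by (intro nonlinearity_measurable_bounded[OF nonlin_c] borel_measurable_add) (auto simp: neighbours_arcs)
    have o: "integrable P (\<lambda>\<omega>. \<Psi>\<^sub>o (- (h i \<bullet> block y i) + n i \<omega>))"
      by (intro nonlinearity_measurable_bounded[OF nonlin_o]) measurable
    show ?thesis
      unfolding update_component using c o by (simp add: Bochner_Integration.integral_sum)
  qed
  also have "(\<Sum>j\<in>neighbours E i. expectation (\<lambda>\<omega>. \<Psi>\<^sub>c (y $ (i, l) - y $ (j, l) + \<xi> i j \<omega> $ l)))
     = (\<Sum>j\<in>neighbours E i. smoothed \<Psi>\<^sub>c p\<^sub>c (y $ (i, l) - y $ (j, l)))"
    by (intro sum.cong refl expectation_shifted_nonlinearity[OF nonlin_c pdf_c \<xi>_distr]) (simp add: neighbours_arcs)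
  also have "expectation (\<lambda>\<omega>. \<Psi>\<^sub>o (- (h i \<bullet> block y i) + n i \<omega>)) = - smoothed \<Psi>\<^sub>o p\<^sub>o (h i \<bullet> block y i)"
    unfolding expectation_shifted_nonlinearity[OF nonlin_o pdf_o n_distr] by (rule smoothed_odd[OF nonlin_o pdf_o])
  finally show ?thesis by simp
qed

lemma block_zero [simp]: "block 0 i = 0"
  by (simp add: block_def vec_eq_iff)

lemma block_scaleR [simp]: "block (c *\<^sub>R y) i = c *\<^sub>R block y i"
  by (simp add: block_def vec_eq_iff)

lemma block_bounded_linear: "bounded_linear (\<lambda>y. block y i)"
  by (intro linear_conv_bounded_linear[THEN iffD1] linearI) (simp_all add: block_def vec_eq_iff)

lemma mean_update_zero: "mean_update 0 = 0"
  by (simp add: vec_eq_iff split_paired_All mean_update_component smoothed_zero[OF nonlin_c pdf_c] smoothed_zero[OF nonlin_o pdf_o])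

lemma jacobian_mult:
  "(jacobian *v y) $ (i, l) = r * (\<Sum>j\<in>neighbours E i. deriv (smoothed \<Psi>\<^sub>c p\<^sub>c) 0 * (y $ (i, l) - y $ (j, l)))
     + h i $ l * (deriv (smoothed \<Psi>\<^sub>o p\<^sub>o) 0 * (h i \<bullet> block y i))"
  by (simp add: jacobian_def matrix_vector_mult_add_rdistrib scaleR_matrix_vector_assoc[symmetric]
      kron_laplacian_mult[OF graph] observation_gram_mult sum_distrib_left[symmetric] mult_ac)

lemma mean_update_derivative:
  assumes "smoothed \<Psi>\<^sub>o p\<^sub>o differentiable at 0" "smoothed \<Psi>\<^sub>c p\<^sub>c differentiable at 0"
  shows "(mean_update has_derivative (\<lambda>y. jacobian *v y)) (at 0)"
proof (rule has_derivative_vec)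
  fix s :: "'n \<times> 'm"
  obtain i l where s: "s = (i, l)" by (cases s)
  have c: "((\<lambda>y. smoothed \<Psi>\<^sub>c p\<^sub>c (y $ (i, l) - y $ (j, l))) has_derivative
      (\<lambda>y. deriv (smoothed \<Psi>\<^sub>c p\<^sub>c) 0 * (y $ (i, l) - y $ (j, l)))) (at 0)" for j
    by (rule has_derivative_at_zero_comp_linear[OF assms(2)]) (intro bounded_linear_sub bounded_linear_vec_nth)
  have o: "((\<lambda>y. smoothed \<Psi>\<^sub>o p\<^sub>o (h i \<bullet> block y i)) has_derivative
      (\<lambda>y. deriv (smoothed \<Psi>\<^sub>o p\<^sub>o) 0 * (h i \<bullet> block y i))) (at 0)"
    by (rule has_derivative_at_zero_comp_linear[OF assms(1)])
      (rule bounded_linear_compose[OF bounded_linear_inner_right block_bounded_linear])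
  show "((\<lambda>y. mean_update y $ s) has_derivative (\<lambda>y. (jacobian *v y) $ s)) (at 0)"
    unfolding s mean_update_component jacobian_mult
    by (intro has_derivative_add has_derivative_mult_right has_derivative_sum c o)
qed

text \<open>
  For either sign of \<open>u\<close>, moving \<open>u\<close> towards \<open>0\<close> moves \<open>f u\<close> in the direction opposite to the sign of \<open>u\<close>.
\<close>
lemma nondecreasing_odd_ray:
  fixes f :: "real \<Rightarrow> real"
  assumes mono: "\<And>u v. u \<le> v \<Longrightarrow> f u \<le> f v" and c: "0 \<le> c" "c \<le> 1"
  shows "u * f (c * u) \<le> u * f u"
proof (cases "0 \<le> u")
  case True
  then have "c * u \<le> u" using c by (simp add: mult_left_le_one_le)
  then show ?thesis using True mono by (intro mult_left_mono) auto
next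
  case False
  then have "u \<le> c * u" using c by (simp add: mult_le_cancel_right1)
  then show ?thesis using False mono by (intro mult_left_mono_neg) auto
qed

text \<open>
  By symmetrisation over the links, \<open>y \<bullet> mean_update (c y)\<close> is a nonnegative combination of
  terms \<open>w \<phi> (c w)\<close> with \<open>\<phi>\<close> a smoothed nonlinearity, and each is nondecreasing in \<open>c\<close>.
\<close>
lemma mean_update_ray:
  assumes c: "0 \<le> c" "c \<le> 1"
  shows "y \<bullet> mean_update (c *\<^sub>R y) \<le> y \<bullet> mean_update y"
proof -
  let ?c = "smoothed \<Psi>\<^sub>c p\<^sub>c" and ?o = "smoothed \<Psi>\<^sub>o p\<^sub>o"
  have form: "y \<bullet> mean_update (c *\<^sub>R y) = r / 2 * (\<Sum>l\<in>UNIV. \<Sum>i\<in>UNIV. \<Sum>j\<in>neighbours E i. (y $ (i, l) - y $ (j, l)) * ?c (c * (y $ (i, l) - y $ (j, l))))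
     + (\<Sum>i\<in>UNIV. (h i \<bullet> block y i) * ?o (c * (h i \<bullet> block y i)))" for c
  proof -
    have "y \<bullet> mean_update (c *\<^sub>R y) = (\<Sum>i\<in>UNIV. \<Sum>l\<in>UNIV. y $ (i, l) * mean_update (c *\<^sub>R y) $ (i, l))"
      by (simp add: inner_vec_def sum_pairs)
    also have "\<dots> = (\<Sum>i\<in>UNIV. \<Sum>l\<in>UNIV. r * (\<Sum>j\<in>neighbours E i. y $ (i, l) * ?c (c * (y $ (i, l) - y $ (j, l)))))
      + (\<Sum>i\<in>UNIV. \<Sum>l\<in>UNIV. (h i $ l * y $ (i, l)) * ?o (c * (h i \<bullet> block y i)))"
      unfolding mean_update_component
      by (simp add: sum.distrib[symmetric] sum_distrib_left algebra_simps)
    also have "(\<Sum>i\<in>UNIV. \<Sum>l\<in>UNIV. (h i $ l * y $ (i, l)) * ?o (c * (h i \<bullet> block y i))) = (\<Sum>i\<in>UNIV. (h i \<bullet> block y i) * ?o (c * (h i \<bullet> block y i)))"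
      by (simp add: sum_distrib_right[symmetric]) (simp add: inner_vec_def block_def)
    also have "(\<Sum>i\<in>UNIV. \<Sum>l\<in>UNIV. r * (\<Sum>j\<in>neighbours E i. y $ (i, l) * ?c (c * (y $ (i, l) - y $ (j, l)))))
      = (\<Sum>l\<in>UNIV. r / 2 * (2 * (\<Sum>i\<in>UNIV. \<Sum>j\<in>neighbours E i. y $ (i, l) * ?c (c * (y $ (i, l) - y $ (j, l))))))"
      by (subst sum.swap) (simp add: sum_distrib_left)
    also have "\<dots> = (\<Sum>l\<in>UNIV. r / 2 * (\<Sum>i\<in>UNIV. \<Sum>j\<in>neighbours E i. (y $ (i, l) - y $ (j, l)) * ?c (c * (y $ (i, l) - y $ (j, l)))))"
    proof (rule sum.cong[OF refl])
      fix l
      note laplacian_form_symmetrised[where f="?c" and y="\<lambda>i. y $ (i, l)" and E=E and c=c]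
      from this[OF smoothed_odd[OF nonlin_c pdf_c]]
      show "r / 2 * (2 * (\<Sum>i\<in>UNIV. \<Sum>j\<in>neighbours E i. y $ (i, l) * ?c (c * (y $ (i, l) - y $ (j, l)))))
        = r / 2 * (\<Sum>i\<in>UNIV. \<Sum>j\<in>neighbours E i. (y $ (i, l) - y $ (j, l)) * ?c (c * (y $ (i, l) - y $ (j, l))))"
        by (simp only:)
    qed
    also have "\<dots> = r / 2 * (\<Sum>l\<in>UNIV. \<Sum>i\<in>UNIV. \<Sum>j\<in>neighbours E i. (y $ (i, l) - y $ (j, l)) * ?c (c * (y $ (i, l) - y $ (j, l))))"
      by (rule sum_distrib_left[symmetric])
    finally show ?thesis .
  qed
  have "y \<bullet> mean_update (c *\<^sub>R y) \<le> y \<bullet> mean_update (1 *\<^sub>R y)"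
    unfolding form mult_1_left
  proof (rule add_mono[OF mult_left_mono])
    show "0 \<le> r / 2" using r_nonneg by simp
    show "(\<Sum>l\<in>UNIV. \<Sum>i\<in>UNIV. \<Sum>j\<in>neighbours E i. (y $ (i, l) - y $ (j, l)) * ?c (c * (y $ (i, l) - y $ (j, l))))
      \<le> (\<Sum>l\<in>UNIV. \<Sum>i\<in>UNIV. \<Sum>j\<in>neighbours E i. (y $ (i, l) - y $ (j, l)) * ?c (y $ (i, l) - y $ (j, l)))"
      by (intro sum_mono nondecreasing_odd_ray[where f="?c", OF smoothed_mono[OF nonlin_c pdf_c] c])
    show "(\<Sum>i\<in>UNIV. (h i \<bullet> block y i) * ?o (c * (h i \<bullet> block y i))) \<le> (\<Sum>i\<in>UNIV. (h i \<bullet> block y i) * ?o (h i \<bullet> block y i))"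
      by (intro sum_mono nondecreasing_odd_ray[where f="?o", OF smoothed_mono[OF nonlin_o pdf_o] c])
  qed
  then show ?thesis by simp
qed

text \<open>
  Dominated convergence along sequences: almost surely every nonlinearity is continuous at
  its own noise value.
\<close>
lemma update_continuous_in_mean_square:
  "((\<lambda>y. expectation (\<lambda>\<omega>. (norm (update y \<omega> - update 0 \<omega>))\<^sup>2)) \<longlongrightarrow> 0) (at 0)"
  unfolding tendsto_at_iff_sequentially comp_def
proof (intro allI impI)
  fix Y :: "nat \<Rightarrow> real^('n \<times> 'm)" assume Y: "Y \<longlonglongrightarrow> 0"
  obtain C where C: "\<And>y v. norm (consensus_update E h r \<Psi>\<^sub>c \<Psi>\<^sub>o y v) \<le> C"
    using consensus_update_bounded[OF nonlin_c nonlin_o] by blast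
  have co: "AE \<omega> in P. \<forall>i. isCont \<Psi>\<^sub>o (n i \<omega>)"
    by (simp add: AE_all_countable nonlinearity_continuous_at_noise[OF nonlin_o n_distr])
  have cc: "AE \<omega> in P. \<forall>i j l. (i, j) \<in> arcs_of E \<longrightarrow> isCont \<Psi>\<^sub>c (\<xi> i j \<omega> $ l)"
    by (simp add: AE_all_countable) (auto intro: nonlinearity_continuous_at_noise[OF nonlin_c \<xi>_distr])
  have "(\<lambda>k. expectation (\<lambda>\<omega>. (norm (update (Y k) \<omega> - update 0 \<omega>))\<^sup>2)) \<longlonglongrightarrow> expectation (\<lambda>\<omega>. 0)"
  proof (rule integral_dominated_convergence[where w="\<lambda>_. (2 * C)\<^sup>2"])
    show "AE \<omega> in P. (\<lambda>k. (norm (update (Y k) \<omega> - update 0 \<omega>))\<^sup>2) \<longlonglongrightarrow> 0"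
      using co cc
    proof eventually_elim
      case (elim \<omega>)
      have "(\<lambda>k. update (Y k) \<omega>) \<longlonglongrightarrow> update 0 \<omega>"
      proof (rule vec_tendstoI)
        fix s :: "'n \<times> 'm"
        obtain i l where s: "s = (i, l)" by (cases s)
        have comp: "(\<lambda>k. Y k $ q) \<longlonglongrightarrow> 0" for q using tendsto_vec_nth[OF Y, of q] by simp
        have cl: "(\<lambda>k. \<Psi>\<^sub>c (Y k $ (i, l) - Y k $ (j, l) + \<xi> i j \<omega> $ l)) \<longlonglongrightarrow> \<Psi>\<^sub>c (\<xi> i j \<omega> $ l)"
          if "j \<in> neighbours E i" for j
        proof (rule isCont_tendsto_compose[of "\<xi> i j \<omega> $ l" \<Psi>\<^sub>c])
          show "isCont \<Psi>\<^sub>c (\<xi> i j \<omega> $ l)" using elim(2) that by (simp add: neighbours_arcs)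
          show "(\<lambda>k. Y k $ (i, l) - Y k $ (j, l) + \<xi> i j \<omega> $ l) \<longlonglongrightarrow> \<xi> i j \<omega> $ l"
            using tendsto_add[OF tendsto_diff[OF comp comp] tendsto_const] by fastforce
        qed
        have ol: "(\<lambda>k. \<Psi>\<^sub>o (- (h i \<bullet> block (Y k) i) + n i \<omega>)) \<longlonglongrightarrow> \<Psi>\<^sub>o (n i \<omega>)"
        proof (rule isCont_tendsto_compose[of "n i \<omega>" \<Psi>\<^sub>o])
          show "isCont \<Psi>\<^sub>o (n i \<omega>)" using elim(1) by simp
          have "(\<lambda>k. block (Y k) i) \<longlonglongrightarrow> block 0 i"
            by (rule bounded_linear.tendsto[OF block_bounded_linear Y])
          then have "(\<lambda>k. - (h i \<bullet> block (Y k) i) + n i \<omega>) \<longlonglongrightarrow> - (h i \<bullet> block 0 i) + n i \<omega>"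
            by (intro tendsto_intros)
          then show "(\<lambda>k. - (h i \<bullet> block (Y k) i) + n i \<omega>) \<longlonglongrightarrow> n i \<omega>" by simp
        qed
        have "(\<lambda>k. r * (\<Sum>j\<in>neighbours E i. \<Psi>\<^sub>c (Y k $ (i, l) - Y k $ (j, l) + \<xi> i j \<omega> $ l)) - h i $ l * \<Psi>\<^sub>o (- (h i \<bullet> block (Y k) i) + n i \<omega>))
          \<longlonglongrightarrow> r * (\<Sum>j\<in>neighbours E i. \<Psi>\<^sub>c (\<xi> i j \<omega> $ l)) - h i $ l * \<Psi>\<^sub>o (n i \<omega>)"
          by (intro tendsto_diff tendsto_mult_left tendsto_sum cl ol)
        then show "(\<lambda>k. update (Y k) \<omega> $ s) \<longlonglongrightarrow> update 0 \<omega> $ s"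
          unfolding s update_component by simp
      qed
      then have "(\<lambda>k. (norm (update (Y k) \<omega> - update 0 \<omega>))\<^sup>2) \<longlonglongrightarrow> (norm (update 0 \<omega> - update 0 \<omega>))\<^sup>2"
        by (intro tendsto_intros)
      then show ?case by simp
    qed
    have "norm (update y \<omega> - update 0 \<omega>) \<le> 2 * C" for y \<omega>
      using norm_triangle_ineq4[of "update y \<omega>" "update 0 \<omega>"] C[of y "noise \<omega>"] C[of 0 "noise \<omega>"] by linarith
    then have "(norm (update y \<omega> - update 0 \<omega>))\<^sup>2 \<le> (2 * C)\<^sup>2" for y \<omega> by (intro power_mono) auto
    then show "AE \<omega> in P. norm ((norm (update (Y k) \<omega> - update 0 \<omega>))\<^sup>2) \<le> (2 * C)\<^sup>2" for k
      by (intro AE_I2) (simp only: real_norm_def abs_power2)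
  qed auto
  then show "(\<lambda>k. expectation (\<lambda>\<omega>. (norm (update (Y k) \<omega> - update 0 \<omega>))\<^sup>2)) \<longlonglongrightarrow> 0" by simp
qed

definition cross_cov :: "real^'n^('n \<times> 'm)" where
  "cross_cov = (\<chi> s k. \<Sum>j\<in>neighbours E (fst s). expectation (\<lambda>\<omega>. \<Psi>\<^sub>c (\<xi> (fst s) j \<omega> $ snd s) * \<Psi>\<^sub>o (n k \<omega>)))"

definition noise_cov :: "real^('n \<times> 'm)^('n \<times> 'm)" where
  "noise_cov = (r\<^sup>2 * effective_variance \<Psi>\<^sub>c p\<^sub>c) *\<^sub>R block_diag (\<lambda>i. mat (real (degree_of E i)))
     - r *\<^sub>R (cross_cov ** observation_matrix h)
     - r *\<^sub>R (transpose (observation_matrix h) ** transpose cross_cov)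
     + effective_variance \<Psi>\<^sub>o p\<^sub>o *\<^sub>R (transpose (observation_matrix h) ** observation_matrix h)"

lemma update_zero_component: "update 0 \<omega> $ (i, l) = r * (\<Sum>j\<in>neighbours E i. \<Psi>\<^sub>c (\<xi> i j \<omega> $ l)) - h i $ l * \<Psi>\<^sub>o (n i \<omega>)"
  by (simp add: update_component)

text \<open>
  Distinct triples of arc and entry are uncorrelated, so only the diagonal pairs of neighbours survive.
\<close>
lemma link_noise_covariance:
  "expectation (\<lambda>\<omega>. (\<Sum>j\<in>neighbours E i. \<Psi>\<^sub>c (\<xi> i j \<omega> $ l)) * (\<Sum>j\<in>neighbours E i'. \<Psi>\<^sub>c (\<xi> i' j \<omega> $ l')))
    = (if (i, l) = (i', l') then real (degree_of E i) * effective_variance \<Psi>\<^sub>c p\<^sub>c else 0)"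
proof -
  have int: "integrable P (\<lambda>\<omega>. \<Psi>\<^sub>c (\<xi> i j \<omega> $ l) * \<Psi>\<^sub>c (\<xi> i' j' \<omega> $ l'))" if "j \<in> neighbours E i" "j' \<in> neighbours E i'" for j j'
    using that by (intro nonlinearity_product_integrable nonlin_c \<xi>_measurable) (auto simp: neighbours_arcs)
  have "expectation (\<lambda>\<omega>. (\<Sum>j\<in>neighbours E i. \<Psi>\<^sub>c (\<xi> i j \<omega> $ l)) * (\<Sum>j\<in>neighbours E i'. \<Psi>\<^sub>c (\<xi> i' j \<omega> $ l')))
    = (\<Sum>j\<in>neighbours E i. \<Sum>j'\<in>neighbours E i'. expectation (\<lambda>\<omega>. \<Psi>\<^sub>c (\<xi> i j \<omega> $ l) * \<Psi>\<^sub>c (\<xi> i' j' \<omega> $ l')))"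
    unfolding sum_product using int by (simp add: Bochner_Integration.integral_sum Bochner_Integration.integrable_sum)
  also have "\<dots> = (\<Sum>j\<in>neighbours E i. \<Sum>j'\<in>neighbours E i'. if (i, l) = (i', l') \<and> j = j' then effective_variance \<Psi>\<^sub>c p\<^sub>c else 0)"
  proof (intro sum.cong refl)
    fix j j' assume "j \<in> neighbours E i" "j' \<in> neighbours E i'"
    then have arcs: "(i, j) \<in> arcs_of E" "(i', j') \<in> arcs_of E" by (simp_all add: neighbours_arcs)
    show "expectation (\<lambda>\<omega>. \<Psi>\<^sub>c (\<xi> i j \<omega> $ l) * \<Psi>\<^sub>c (\<xi> i' j' \<omega> $ l')) = (if (i, l) = (i', l') \<and> j = j' then effective_variance \<Psi>\<^sub>c p\<^sub>c else 0)"
    proof (cases "(i, j, l) = (i', j', l')")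
      case True
      then show ?thesis using expectation_nonlinearity_square[OF nonlin_c pdf_c \<xi>_distr[OF arcs(1)]] by simp
    next
      case False
      then show ?thesis using \<xi>_uncorrelated[OF arcs False] by auto
    qed
  qed
  also have "\<dots> = (if (i, l) = (i', l') then real (degree_of E i) * effective_variance \<Psi>\<^sub>c p\<^sub>c else 0)"
    by (auto simp: degree_of_def)
  finally show ?thesis .
qed

lemma update_covariance: "expectation (\<lambda>\<omega>. update 0 \<omega> $ s * update 0 \<omega> $ s') = noise_cov $ s $ s'"
proof -
  obtain i l where s: "s = (i, l)" by (cases s)
  obtain i' l' where s': "s' = (i', l')" by (cases s')
  define A where "A i l \<omega> = (\<Sum>j\<in>neighbours E i. \<Psi>\<^sub>c (\<xi> i j \<omega> $ l))" for i l \<omega>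
  have AA: "integrable P (\<lambda>\<omega>. A i l \<omega> * A i' l' \<omega>)" for i l i' l'
    unfolding A_def sum_product
    by (intro Bochner_Integration.integrable_sum nonlinearity_product_integrable nonlin_c \<xi>_measurable) (auto simp: neighbours_arcs)
  have AO: "integrable P (\<lambda>\<omega>. A i l \<omega> * \<Psi>\<^sub>o (n k \<omega>))" for i l k
    unfolding A_def sum_distrib_right
    by (intro Bochner_Integration.integrable_sum nonlinearity_product_integrable nonlin_c nonlin_o \<xi>_measurable n_measurable) (auto simp: neighbours_arcs)
  have OO: "integrable P (\<lambda>\<omega>. \<Psi>\<^sub>o (n i \<omega>) * \<Psi>\<^sub>o (n k \<omega>))" for i k
    by (intro nonlinearity_product_integrable nonlin_o n_measurable)
  have EAO: "expectation (\<lambda>\<omega>. A i l \<omega> * \<Psi>\<^sub>o (n k \<omega>)) = cross_cov $ (i, l) $ k" for i l k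
  proof -
    have "integrable P (\<lambda>\<omega>. \<Psi>\<^sub>c (\<xi> i j \<omega> $ l) * \<Psi>\<^sub>o (n k \<omega>))" if "j \<in> neighbours E i" for j
      using that by (intro nonlinearity_product_integrable nonlin_c nonlin_o \<xi>_measurable n_measurable) (simp add: neighbours_arcs)
    then show ?thesis unfolding A_def sum_distrib_right cross_cov_def
      by (simp add: Bochner_Integration.integral_sum)
  qed
  have EOO: "expectation (\<lambda>\<omega>. \<Psi>\<^sub>o (n i \<omega>) * \<Psi>\<^sub>o (n k \<omega>)) = (if i = k then effective_variance \<Psi>\<^sub>o p\<^sub>o else 0)" for i k
    using n_uncorrelated expectation_nonlinearity_square[OF nonlin_o pdf_o n_distr] by auto
  have "update 0 \<omega> $ s * update 0 \<omega> $ s' = r\<^sup>2 * (A i l \<omega> * A i' l' \<omega>) - r * h i' $ l' * (A i l \<omega> * \<Psi>\<^sub>o (n i' \<omega>))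
     - r * h i $ l * (A i' l' \<omega> * \<Psi>\<^sub>o (n i \<omega>)) + h i $ l * h i' $ l' * (\<Psi>\<^sub>o (n i \<omega>) * \<Psi>\<^sub>o (n i' \<omega>))" for \<omega>
    unfolding s s' update_zero_component A_def[symmetric] by (simp add: algebra_simps power2_eq_square)
  then have "expectation (\<lambda>\<omega>. update 0 \<omega> $ s * update 0 \<omega> $ s') = r\<^sup>2 * expectation (\<lambda>\<omega>. A i l \<omega> * A i' l' \<omega>)
     - r * h i' $ l' * expectation (\<lambda>\<omega>. A i l \<omega> * \<Psi>\<^sub>o (n i' \<omega>))
     - r * h i $ l * expectation (\<lambda>\<omega>. A i' l' \<omega> * \<Psi>\<^sub>o (n i \<omega>)) + h i $ l * h i' $ l' * expectation (\<lambda>\<omega>. \<Psi>\<^sub>o (n i \<omega>) * \<Psi>\<^sub>o (n i' \<omega>))"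
    using AA[of i l i' l'] AO[of i l i'] AO[of i' l' i] OO[of i i'] by simp
  also have "\<dots> = r\<^sup>2 * (if (i, l) = (i', l') then real (degree_of E i) * effective_variance \<Psi>\<^sub>c p\<^sub>c else 0)
     - r * h i' $ l' * cross_cov $ (i, l) $ i' - r * h i $ l * cross_cov $ (i', l') $ i
     + h i $ l * h i' $ l' * (if i = i' then effective_variance \<Psi>\<^sub>o p\<^sub>o else 0)"
    unfolding EAO EOO by (simp only: A_def link_noise_covariance)
  also have "\<dots> = noise_cov $ s $ s'"
  proof -
    have 1: "(cross_cov ** observation_matrix h) $ s $ s' = cross_cov $ (i, l) $ i' * h i' $ l'"
      by (simp add: s s' matrix_matrix_mult_def observation_matrix_def if_distrib cong: if_cong)
    have 2: "(transpose (observation_matrix h) ** transpose cross_cov) $ s $ s' = h i $ l * cross_cov $ (i', l') $ i"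
      by (simp add: s s' matrix_matrix_mult_def observation_matrix_def transpose_def if_distrib if_distribR cong: if_cong)
    have 3: "(transpose (observation_matrix h) ** observation_matrix h) $ s $ s' = (if i = i' then h i $ l * h i' $ l' else 0)"
    proof -
      have "(transpose (observation_matrix h) ** observation_matrix h) $ s $ s'
         = (\<Sum>k\<in>UNIV. observation_matrix h $ k $ s * observation_matrix h $ k $ s')"
        by (simp add: matrix_matrix_mult_def transpose_def)
      also have "\<dots> = (\<Sum>k\<in>UNIV. if i = k then (if i = i' then h i $ l * h i' $ l' else 0) else 0)"
        by (intro sum.cong) (auto simp: s s' observation_matrix_def)
      finally show ?thesis by simp
    qed
    have 4: "block_diag (\<lambda>i. mat (real (degree_of E i)) :: real^'m^'m) $ s $ s' = (if (i, l) = (i', l') then real (degree_of E i) else 0)"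
      by (simp add: s s' block_diag_def mat_def)
    show ?thesis unfolding noise_cov_def by (simp add: 1 2 3 4 algebra_simps)
  qed
  finally show ?thesis .
qed

lemma noise_cov_symmetric: "transpose noise_cov = noise_cov"
  by (simp add: vec_eq_iff transpose_def update_covariance[symmetric] mult.commute)

lemma noise_cov_quadratic: "expectation (\<lambda>\<omega>. (u \<bullet> update 0 \<omega>)\<^sup>2) = u \<bullet> (noise_cov *v u)"
proof -
  have int: "integrable P (\<lambda>\<omega>. update 0 \<omega> $ s * update 0 \<omega> $ s')" for s s'
  proof -
    obtain C where C: "\<And>y v. norm (consensus_update E h r \<Psi>\<^sub>c \<Psi>\<^sub>o y v) \<le> C"
      using consensus_update_bounded[OF nonlin_c nonlin_o] by blast
    have b: "\<bar>update 0 \<omega> $ s\<bar> \<le> C" for \<omega> s using component_le_norm_cart order_trans C by blast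
    have [measurable]: "(\<lambda>\<omega>. update 0 \<omega> $ s) \<in> borel_measurable P" for s
      by (rule borel_measurable_vec_component) measurable
    have "\<bar>update 0 \<omega> $ s * update 0 \<omega> $ s'\<bar> \<le> C * C" for \<omega>
      unfolding abs_mult by (intro mult_mono b) (auto intro: order_trans[OF abs_ge_zero b])
    then show ?thesis by (intro integrable_const_bound[where B="C * C"]) auto
  qed
  have "(u \<bullet> update 0 \<omega>)\<^sup>2 = (\<Sum>s\<in>UNIV. \<Sum>s'\<in>UNIV. (u $ s * u $ s') * (update 0 \<omega> $ s * update 0 \<omega> $ s'))" for \<omega>
    unfolding power2_eq_square inner_vec_def sum_product by (simp add: mult_ac)
  then have "expectation (\<lambda>\<omega>. (u \<bullet> update 0 \<omega>)\<^sup>2) = (\<Sum>s\<in>UNIV. \<Sum>s'\<in>UNIV. (u $ s * u $ s') * noise_cov $ s $ s')"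
    using int by (simp add: Bochner_Integration.integral_sum Bochner_Integration.integrable_sum update_covariance)
  also have "\<dots> = u \<bullet> (noise_cov *v u)"
    by (simp add: inner_vec_def matrix_vector_mult_def sum_distrib_left mult_ac)
  finally show ?thesis .
qed

lemma jacobian_symmetric: "transpose jacobian = jacobian"
proof -
  have "adjacency_matrix E $ i $ j = adjacency_matrix E $ j $ i" for i j
    by (simp add: adjacency_matrix_def insert_commute)
  moreover have "degree_matrix E $ i $ j = degree_matrix E $ j $ i" for i j
    by (simp add: degree_matrix_def)
  ultimately have L: "laplacian E $ i $ j = laplacian E $ j $ i" for i j
    by (simp add: laplacian_def)
  have M: "(mat 1 :: real^'m^'m) $ i $ j = (mat 1 :: real^'m^'m) $ j $ i" for i j
    by (simp add: mat_def)
  have "jacobian $ s $ s' = jacobian $ s' $ s" for s s'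
    unfolding jacobian_def kron_def matrix_matrix_mult_def transpose_def
    by (simp add: L[of "fst s"] M[of "snd s"] mult.commute)
  then show ?thesis by (simp add: vec_eq_iff transpose_def)
qed

end

section \<open>Asymptotic normality of the network iterates\<close>

text \<open>
  An admissible nonlinearity of a symmetric noise has mean zero.
\<close>
lemma (in prob_space) nonlinearity_uncorrelated:
  assumes ind: "indep_vars (\<lambda>_. borel) X I" and ik: "i \<in> I" "k \<in> I" "i \<noteq> k"
    and \<Psi>: "admissible_nonlinearity \<Psi>" and p: "noise_pdf p"
    and X: "distributed M lborel (X i) p" "distributed M lborel (X k) p"
  shows "expectation (\<lambda>\<omega>. \<Psi> (X i \<omega>) * \<Psi> (X k \<omega>)) = 0"
proof -
  note [measurable] = admissible_measurable[OF \<Psi>]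
  obtain c where c: "\<And>u. \<bar>\<Psi> u\<bar> \<le> c" using \<Psi> by (auto simp: admissible_nonlinearity_def)
  have ind': "indep_vars (\<lambda>_. borel) (\<lambda>q \<omega>. \<Psi> (X q \<omega>)) {i, k}"
    by (rule indep_vars_compose2[OF indep_vars_subset[OF ind]]) (use ik in auto)
  have m: "(\<lambda>\<omega>. \<Psi> (X q \<omega>)) \<in> borel_measurable M" if "q \<in> {i, k}" for q
    using ind' that by (auto simp: indep_vars_def)
  have int: "integrable M (\<lambda>\<omega>. \<Psi> (X q \<omega>))" if "q \<in> {i, k}" for q
    by (rule integrable_const_bound[where B=c]) (use c m[OF that] in auto)
  have "expectation (\<lambda>\<omega>. \<Prod>q\<in>{i, k}. \<Psi> (X q \<omega>)) = (\<Prod>q\<in>{i, k}. expectation (\<lambda>\<omega>. \<Psi> (X q \<omega>)))"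
    by (rule indep_vars_lebesgue_integral[OF _ ind' int]) simp_all
  moreover have "expectation (\<lambda>\<omega>. \<Psi> (X i \<omega>)) = 0"
    using expectation_shifted_nonlinearity[OF \<Psi> p X(1), of 0] smoothed_zero[OF \<Psi> p] by simp
  ultimately show ?thesis using ik by simp
qed

theorem theorem2:
  fixes P :: "'w measure"
    and E :: "'n::finite set set"
    and h :: "'n \<Rightarrow> real^'m::finite"
    and \<theta> :: "real^'m"
    and n z :: "'n \<Rightarrow> nat \<Rightarrow> 'w \<Rightarrow> real"
    and \<xi> :: "'n \<Rightarrow> 'n \<Rightarrow> nat \<Rightarrow> 'w \<Rightarrow> real^'m"
    and p\<^sub>o p\<^sub>c \<Psi>\<^sub>o \<Psi>\<^sub>c :: "real \<Rightarrow> real"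
    and a b :: real and \<alpha> :: "nat \<Rightarrow> real"
    and x\<^sub>0 :: "'n \<Rightarrow> real^'m" and x :: "'n \<Rightarrow> nat \<Rightarrow> 'w \<Rightarrow> real^'m"
    and \<Phi> :: "'n \<Rightarrow> 'n \<Rightarrow> 'n \<Rightarrow> 'm \<Rightarrow> (real \<times> real) measure"
    and H :: "real^('n \<times> 'm)^'n" and K :: "real^'n^('n \<times> 'm)"
    and \<Sigma> S\<^sub>0 S :: "real^('n \<times> 'm)^('n \<times> 'm)"
  assumes prob: "prob_space P"
    \<comment> \<open>network\<close>
    and card: "2 \<le> CARD('n)"
    and graph: "simple_graph E" "connected_graph E"
    \<comment> \<open>observation model\<close>
    and h_nonzero: "\<And>i. h i \<noteq> 0"
    and observable: "invertible (\<Sum>i\<in>UNIV. columnvector (h i) ** rowvector (h i))"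
    and z: "\<And>i t \<omega>. \<omega> \<in> space P \<Longrightarrow> z i t \<omega> = h i \<bullet> \<theta> + n i t \<omega>"
    \<comment> \<open>observation noise\<close>
    and pdf_o: "noise_pdf p\<^sub>o"
    and n_indep: "prob_space.indep_vars P (\<lambda>_. borel) (\<lambda>(i, t). n i t) UNIV"
    and n_distr: "\<And>i t. distributed P lborel (n i t) p\<^sub>o"
    \<comment> \<open>communication noise\<close>
    and pdf_c: "noise_pdf p\<^sub>c"
    and \<xi>_iid: "\<And>i j. (i, j) \<in> arcs_of E \<Longrightarrow> prob_space.iid_seq P borel (\<xi> i j)"
    and \<xi>_indep_arcs: "prob_space.indep_vars P (\<lambda>_. Pi\<^sub>M UNIV (\<lambda>_. borel))
                      (\<lambda>(i, j) \<omega> t. \<xi> i j t \<omega>) (arcs_of E)"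
    and \<xi>_indep_entries: "\<And>i j t. (i, j) \<in> arcs_of E \<Longrightarrow>
                      prob_space.indep_vars P (\<lambda>_. borel) (\<lambda>l \<omega>. \<xi> i j t \<omega> $ l) UNIV"
    and \<xi>_distr: "\<And>i j t l. (i, j) \<in> arcs_of E \<Longrightarrow> distributed P lborel (\<lambda>\<omega>. \<xi> i j t \<omega> $ l) p\<^sub>c"
    \<comment> \<open>joint noise\<close>
    and joint_iid: "prob_space.iid_seq P (borel \<Otimes>\<^sub>M Pi\<^sub>M (arcs_of E) (\<lambda>_. borel))
                      (\<lambda>t \<omega>. (\<chi> i. n i t \<omega>, \<lambda>(i, j)\<in>arcs_of E. \<xi> i j t \<omega>))"
    and \<Phi>: "\<And>k i j l t. (i, j) \<in> arcs_of E \<Longrightarrow>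
              \<Phi> k i j l = distr P (borel \<Otimes>\<^sub>M borel) (\<lambda>\<omega>. (\<xi> i j t \<omega> $ l, n k t \<omega>))"
    \<comment> \<open>nonlinearities\<close>
    and nonlin: "admissible_nonlinearity \<Psi>\<^sub>o" "admissible_nonlinearity \<Psi>\<^sub>c"
    and smooth_o: "smoothed \<Psi>\<^sub>o p\<^sub>o differentiable at 0" "0 < deriv (smoothed \<Psi>\<^sub>o p\<^sub>o) 0"
    and smooth_c: "smoothed \<Psi>\<^sub>c p\<^sub>c differentiable at 0" "0 < deriv (smoothed \<Psi>\<^sub>c p\<^sub>c) 0"
    \<comment> \<open>algorithm\<close>
    and ab: "0 < a" "0 < b"
    and \<alpha>: "\<And>t. \<alpha> t = a / (real t + 1)"
    and x_init: "\<And>i \<omega>. \<omega> \<in> space P \<Longrightarrow> x i 0 \<omega> = x\<^sub>0 i"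
    and x_step: "\<And>i t \<omega>. \<omega> \<in> space P \<Longrightarrow> x i (Suc t) \<omega> =
              x i t \<omega> - \<alpha> t *\<^sub>R
                ((b / a) *\<^sub>R (\<Sum>j\<in>neighbours E i. componentwise \<Psi>\<^sub>c (x i t \<omega> - x j t \<omega> + \<xi> i j t \<omega>))
                 - \<Psi>\<^sub>o (z i t \<omega> - h i \<bullet> x i t \<omega>) *\<^sub>R h i)"
    \<comment> \<open>limiting covariance\<close>
    and H: "H = observation_matrix h"
    and \<Sigma>: "\<Sigma> = (1 / 2) *\<^sub>R mat 1 - a *\<^sub>R
              (((b / a) * deriv (smoothed \<Psi>\<^sub>c p\<^sub>c) 0) *\<^sub>R kron (laplacian E) (mat 1 :: real^'m^'m)
               + deriv (smoothed \<Psi>\<^sub>o p\<^sub>o) 0 *\<^sub>R (transpose H ** H))"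
    and stable: "stable_matrix \<Sigma>"
    and K: "K = effective_cross_cov E \<Psi>\<^sub>c \<Psi>\<^sub>o \<Phi>"
    and S\<^sub>0: "S\<^sub>0 = (b\<^sup>2 / a\<^sup>2 * effective_variance \<Psi>\<^sub>c p\<^sub>c) *\<^sub>R block_diag (\<lambda>i. mat (real (degree_of E i)))
               - (b / a) *\<^sub>R (K ** H)
               - (b / a) *\<^sub>R (transpose H ** transpose K)
               + effective_variance \<Psi>\<^sub>o p\<^sub>o *\<^sub>R (transpose H ** H)"
    and S: "S = a\<^sup>2 *\<^sub>R (LBINT v:{0..}. matrix_exp (v *\<^sub>R \<Sigma>) ** S\<^sub>0 ** matrix_exp (v *\<^sub>R transpose \<Sigma>))"
  shows "\<exists>N. multivariate_normal 0 S N \<and>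
           weakly_converges
             (\<lambda>t. distr P borel (\<lambda>\<omega>. sqrt (real t + 1) *\<^sub>R (stack (\<lambda>i. x i t \<omega>) - kron_vec 1 \<theta>)))
             N"
proof -
  interpret prob_space P by (rule prob)
  define NN :: "((real^'n) \<times> ('n \<times> 'n \<Rightarrow> real^'m)) measure"
    where "NN = borel \<Otimes>\<^sub>M Pi\<^sub>M (arcs_of E) (\<lambda>_. borel)"
  define \<nu> where "\<nu> t \<omega> = (\<chi> i. n i t \<omega>, \<lambda>(i, j)\<in>arcs_of E. \<xi> i j t \<omega>)" for t \<omega>
  have n_uncorr: "expectation (\<lambda>\<omega>. \<Psi>\<^sub>o (n i 0 \<omega>) * \<Psi>\<^sub>o (n k 0 \<omega>)) = 0" if "i \<noteq> k" for i k
    using nonlinearity_uncorrelated[OF n_indep, of "(i, 0)" "(k, 0)" \<Psi>\<^sub>o p\<^sub>o] that nonlin(1) pdf_o n_distr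
    by simp
  have \<xi>_uncorr: "expectation (\<lambda>\<omega>. \<Psi>\<^sub>c (\<xi> i j 0 \<omega> $ l) * \<Psi>\<^sub>c (\<xi> i' j' 0 \<omega> $ l')) = 0"
    if arcs: "(i, j) \<in> arcs_of E" "(i', j') \<in> arcs_of E" and ne: "(i, j, l) \<noteq> (i', j', l')" for i j i' j' l l'
  proof (cases "(i, j) = (i', j')")
    case True
    then show ?thesis
      using nonlinearity_uncorrelated[OF \<xi>_indep_entries[OF arcs(1), of 0], of l l' \<Psi>\<^sub>c p\<^sub>c] ne nonlin(2) pdf_c
        \<xi>_distr[OF arcs(1)] by simp
  next
    case False
    define X where "X q \<omega> = \<xi> (fst q) (snd q) 0 \<omega> $ (if q = (i, j) then l else l')" for q \<omega>
    define c where "c q f = f (0::nat) $ (if q = (i, j) then l else l')" for q and f :: "nat \<Rightarrow> real^'m"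
    have "c q \<in> borel_measurable (Pi\<^sub>M UNIV (\<lambda>_. borel))" for q
      unfolding c_def by (rule borel_measurable_vec_component) (rule measurable_component_singleton, simp)
    from indep_vars_compose2[OF \<xi>_indep_arcs this]
    have "indep_vars (\<lambda>_. borel) (\<lambda>q \<omega>. c q ((case q of (i, j) \<Rightarrow> \<lambda>\<omega> t. \<xi> i j t \<omega>) \<omega>)) (arcs_of E)" .
    moreover have "(\<lambda>q \<omega>. c q ((case q of (i, j) \<Rightarrow> \<lambda>\<omega> t. \<xi> i j t \<omega>) \<omega>)) = X"
      by (auto simp: fun_eq_iff c_def X_def)
    ultimately have "indep_vars (\<lambda>_. borel) X (arcs_of E)" by simp
    note uncorr = nonlinearity_uncorrelated[OF this arcs False nonlin(2) pdf_c]
    have "X (i, j) = (\<lambda>\<omega>. \<xi> i j 0 \<omega> $ l)" "X (i', j') = (\<lambda>\<omega>. \<xi> i' j' 0 \<omega> $ l')"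
      using False by (auto simp: X_def fun_eq_iff)
    then show ?thesis using uncorr \<xi>_distr[OF arcs(1)] \<xi>_distr[OF arcs(2)] by simp
  qed
  interpret net: sensor_noise P E h "b / a" p\<^sub>o p\<^sub>c \<Psi>\<^sub>o \<Psi>\<^sub>c "\<lambda>i. n i 0" "\<lambda>i j. \<xi> i j 0"
    by unfold_locales (use graph(1) ab pdf_o pdf_c nonlin n_distr \<xi>_distr n_uncorr \<xi>_uncorr in auto)
  let ?G = "consensus_update E h (b / a) \<Psi>\<^sub>c \<Psi>\<^sub>o"
  define Y where "Y t \<omega> = stack (\<lambda>i. x i t \<omega>) - kron_vec 1 \<theta>" for t \<omega>
  define y0 where "y0 = stack x\<^sub>0 - kron_vec 1 \<theta>"
  have noise_0: "net.noise = \<nu> 0" by (simp add: fun_eq_iff net.noise_def \<nu>_def)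
  have iid: "iid_seq NN \<nu>" using joint_iid by (simp add: NN_def \<nu>_def[abs_def])
  have Y_step: "Y (Suc t) \<omega> = Y t \<omega> - (a / (real t + 1)) *\<^sub>R ?G (Y t \<omega>) (\<nu> t \<omega>)" if \<omega>: "\<omega> \<in> space P" for t \<omega>
  proof -
    have Yc: "Y t \<omega> $ (i, l) = x i t \<omega> $ l - \<theta> $ l" for t i l
      by (simp add: Y_def stack_def kron_vec_def)
    have blk: "block (Y t \<omega>) i = x i t \<omega> - \<theta>" for i by (simp add: vec_eq_iff block_def Yc)
    have "Y (Suc t) \<omega> $ (i, l) = (Y t \<omega> - (a / (real t + 1)) *\<^sub>R ?G (Y t \<omega>) (\<nu> t \<omega>)) $ (i, l)" for i l
    proof -
      have "?G (Y t \<omega>) (\<nu> t \<omega>) $ (i, l) =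
          b / a * (\<Sum>j\<in>neighbours E i. \<Psi>\<^sub>c (x i t \<omega> $ l - x j t \<omega> $ l + \<xi> i j t \<omega> $ l))
          - h i $ l * \<Psi>\<^sub>o (n i t \<omega> - h i \<bullet> (x i t \<omega> - \<theta>))"
        by (auto simp: consensus_update_def \<nu>_def Yc blk neighbours_arcs intro!: sum.cong arg_cong2[where f="(-)"] arg_cong2[where f="(*)"])
      moreover have "z i t \<omega> - h i \<bullet> x i t \<omega> = n i t \<omega> - h i \<bullet> (x i t \<omega> - \<theta>)"
        using z[OF \<omega>] by (simp add: inner_diff_right)
      ultimately show ?thesis
        using x_step[OF \<omega>, of i t] by (simp add: Yc \<alpha> componentwise_def sum_component mult.commute)
    qed
    then show ?thesis by (simp add: vec_eq_iff split_paired_All)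
  qed
  obtain C where C: "\<And>y v. norm (?G y v) \<le> C"
    using consensus_update_bounded[OF nonlin(2) nonlin(1)] by blast
  interpret rm: bounded_robbins_monro P NN \<nu> ?G C a y0 Y
  proof unfold_locales
    show "iid_seq NN \<nu>" by (rule iid)
    show "case_prod ?G \<in> borel \<Otimes>\<^sub>M NN \<rightarrow>\<^sub>M borel"
      unfolding NN_def by (rule consensus_update_measurable) (rule net.measurable_nonlinearities)+
    show "Y 0 \<omega> = y0" if "\<omega> \<in> space P" for \<omega>
      using x_init[OF that] by (simp add: Y_def y0_def)
  qed (use C ab Y_step in auto)
  have law_integral: "(\<integral>v. f v \<partial>rm.law) = expectation (\<lambda>\<omega>. f (net.noise \<omega>))"
    if "f \<in> borel_measurable NN" for f :: "_ \<Rightarrow> 'z::{banach, second_countable_topology}"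
    unfolding rm.law_def noise_0 by (rule integral_distr[OF rm.noise_measurable that])
  have G_meas: "?G y \<in> borel_measurable NN" for y
    using rm.G_measurable_noise by (simp add: measurable_cong_sets[OF rm.sets_law refl])
  have mean: "rm.mean_field = net.mean_update"
    unfolding rm.mean_field_def[abs_def] net.mean_update_def[abs_def] by (simp add: law_integral[OF G_meas])
  let ?J = "net.jacobian"
  have \<Sigma>J: "\<Sigma> = (1 / 2) *\<^sub>R mat 1 - a *\<^sub>R ?J"
    by (simp add: \<Sigma> H net.jacobian_def)
  have \<Sigma>v: "\<Sigma> *v u = (1 / 2) *\<^sub>R u - a *\<^sub>R (?J *v u)" for u
    by (simp add: \<Sigma>J matrix_vector_mult_diff_rdistrib scaleR_matrix_vector_assoc[symmetric])
  have \<Sigma>sym: "transpose \<Sigma> = \<Sigma>"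
  proof -
    have J: "?J $ j $ i = ?J $ i $ j" for i j
      using arg_cong[OF net.jacobian_symmetric, of "\<lambda>A. A $ i $ j"] by (simp add: transpose_def)
    have "transpose \<Sigma> $ i $ j = \<Sigma> $ i $ j" for i j
      using J[of j i] by (simp add: \<Sigma>J transpose_def mat_def)
    then show ?thesis by (simp add: vec_eq_iff)
  qed
  obtain e where e: "0 < e" "\<And>u. u \<bullet> (\<Sigma> *v u) \<le> - e * (norm u)\<^sup>2"
    using stable_symmetric_negative[OF \<Sigma>sym stable] by blast
  have lower: "(1 / 2 + e) / a * (norm u)\<^sup>2 \<le> u \<bullet> (?J *v u)" for u
    using e(2)[of u] ab(1) by (simp add: \<Sigma>v inner_diff_right power2_norm_eq_inner field_simps)
  have deriv: "(net.mean_update has_derivative (\<lambda>y. ?J *v y)) (at 0)"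
    by (rule net.mean_update_derivative[OF smooth_o(1) smooth_c(1)])
  \<comment> \<open>half of the stability margin \<open>e\<close> pays for the nonlinearity near \<open>0\<close>\<close>
  define \<beta> where "\<beta> = (1 / 2 + e / 2) / a"
  have \<beta>: "0 \<le> \<beta>" "\<beta> < (1 / 2 + e) / a" "1 < 2 * a * \<beta>"
    using ab(1) e(1) by (auto simp: \<beta>_def intro: divide_strict_right_mono)
  obtain \<delta> where \<delta>: "0 < \<delta>" "\<And>y. \<beta> * min ((norm y)\<^sup>2) (\<delta>\<^sup>2) \<le> y \<bullet> net.mean_update y"
    using drift_from_linearisation[OF deriv net.mean_update_zero lower \<beta>(1,2) net.mean_update_ray] by blast
  interpret rm: linearised_robbins_monro P NN \<nu> ?G C a y0 Y "(*v) ?J" \<beta> \<delta>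
  proof (rule linearised_robbins_monro.intro[OF rm.bounded_robbins_monro_axioms],
      rule linearised_robbins_monro_axioms.intro)
    show "linear ((*v) ?J)" by (rule matrix_vector_mul_linear)
    show "\<beta> * (norm v)\<^sup>2 \<le> v \<bullet> (?J *v v)" for v
      using lower[of v] mult_right_mono[OF less_imp_le[OF \<beta>(2)], of "(norm v)\<^sup>2"] by simp
    have "(\<lambda>v. (norm (?G y v - ?G 0 v))\<^sup>2) \<in> borel_measurable NN" for y
      using G_meas[of y] G_meas[of 0] by measurable
    then have "(\<integral>v. (norm (?G y v - ?G 0 v))\<^sup>2 \<partial>rm.law) = expectation (\<lambda>\<omega>. (norm (?G y (net.noise \<omega>) - ?G 0 (net.noise \<omega>)))\<^sup>2)" for y
      by (rule law_integral)
    then show "((\<lambda>y. \<integral>v. (norm (?G y v - ?G 0 v))\<^sup>2 \<partial>rm.law) \<longlongrightarrow> 0) (at 0)"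
      using net.update_continuous_in_mean_square by simp
  qed (use \<delta> \<beta> deriv net.mean_update_zero in \<open>simp_all add: mean\<close>)
  have KJ: "K = net.cross_cov"
  proof -
    have "(\<integral>w. \<Psi>\<^sub>c (fst w) * \<Psi>\<^sub>o (snd w) \<partial>\<Phi> k i j l) = expectation (\<lambda>\<omega>. \<Psi>\<^sub>c (\<xi> i j 0 \<omega> $ l) * \<Psi>\<^sub>o (n k 0 \<omega>))"
      if "j \<in> neighbours E i" for i j k l
    proof -
      have arc: "(i, j) \<in> arcs_of E" using that by (simp add: neighbours_arcs)
      note [measurable] = net.\<xi>_measurable[OF arc, of l]
      show ?thesis unfolding \<Phi>[OF arc, of k l 0] by (subst integral_distr) auto
    qed
    then show ?thesis
      unfolding K effective_cross_cov_def net.cross_cov_def by (simp add: vec_eq_iff)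
  qed
  have S0J: "S\<^sub>0 = net.noise_cov"
    by (simp add: S\<^sub>0 KJ H net.noise_cov_def power_divide)
  define I where "I = (LBINT v:{0..}. matrix_exp (v *\<^sub>R \<Sigma>) ** S\<^sub>0 ** matrix_exp (v *\<^sub>R transpose \<Sigma>))"
  have SI: "S *v u = a\<^sup>2 *\<^sub>R (I *v u)" for u
    by (simp add: S I_def scaleR_matrix_vector_assoc[symmetric])
  have S0sym: "transpose S\<^sub>0 = S\<^sub>0" unfolding S0J by (rule net.noise_cov_symmetric)
  note lyap = lyapunov_integral[OF \<Sigma>sym stable S0sym, folded I_def]
  have nq: "rm.noise_quadratic u = u \<bullet> (S\<^sub>0 *v u)" for u
  proof -
    have "(\<lambda>v. (u \<bullet> ?G 0 v)\<^sup>2) \<in> borel_measurable NN"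
      using G_meas[of 0] by measurable
    from law_integral[OF this] show ?thesis
      unfolding rm.noise_quadratic_def S0J net.noise_cov_quadratic[symmetric] .
  qed
  have lyapunov: "a\<^sup>2 * rm.noise_quadratic u = 2 * a * ((S *v u) \<bullet> (?J *v u)) - u \<bullet> (S *v u)" for u
  proof -
    have "u \<bullet> (I *v u) - 2 * a * ((I *v u) \<bullet> (?J *v u)) = - (u \<bullet> (S\<^sub>0 *v u))"
      using lyap(2)[of u] by (simp add: \<Sigma>v inner_diff_left inner_diff_right inner_commute algebra_simps)
    then have "u \<bullet> (S\<^sub>0 *v u) = 2 * a * ((I *v u) \<bullet> (?J *v u)) - u \<bullet> (I *v u)" by simp
    then show ?thesis unfolding nq SI by (simp add: right_diff_distrib)
  qed
  have "\<exists>\<mu>. prob_space \<mu> \<and> sets \<mu> = sets borel \<and>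
      (\<forall>u. (\<integral>x. cis (u \<bullet> x) \<partial>\<mu>) = exp (- complex_of_real (u \<bullet> (S *v u)) / 2)) \<and>
      weakly_converges (\<lambda>t. distr P borel (\<lambda>\<omega>. sqrt (real t + 1) *\<^sub>R Y t \<omega>)) \<mu>"
  proof (rule rm.asymptotic_normality)
    show "y \<bullet> (?J *v w) = (?J *v y) \<bullet> w" for y w
      by (rule symmetric_matrix_inner[OF net.jacobian_symmetric])
    show "y \<bullet> (S *v w) = (S *v y) \<bullet> w" for y w
      using lyap(1)[of y w] by (simp add: SI)
  qed (rule matrix_vector_mul_linear lyapunov)+
  then show ?thesis unfolding multivariate_normal_def Y_def by simp
qed

end
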